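(* Let $\{X_i\}_{i\ge 1}$ be a strictly stationary $m$-dependent sequence of random vectors in $\mathbb{R}^d$ with marginal density $p$, satisfying Assumption $\mathcal{A}$, and let $\epsilon=\epsilon(n)>0$ with $\epsilon(n)\to 0$ as $n\to\infty$. Assume $p\in H_2^{(\alpha)}(K)$ for some $0<\alpha\le 1$ and $K>0$. Let $L(n)$, $n\ge 1$, be a slowly varying function as $n\to\infty$. (i) The bias satisfies $|\mathrm{E}\tilde Q_n-q_2|\le \frac12 K^2\epsilon^{2\alpha}+o\!\left(1/(n\epsilon^{d/2})\right)$ as $n\to\infty$. (ii) If $0<\alpha\le d/4$ and $\epsilon\sim c\,n^{-2/(4\alpha+d)}$ for some $c>0$, then $$\tilde Q_n-q_2=O_{\mathrm P}\!\left(n^{-\frac{4\alpha}{4\alpha+d}}\right)\quad\text{and}\quad \tilde H_n-h_2=O_{\mathrm P}\!\left(n^{-\frac{4\alpha}{4\alpha+d}}\right)\quad\text{as } n\to\infty.$$ (iii) If $\alpha>d/4$, $\epsilon\sim L(n)n^{-1/d}$ and $n\epsilon^d\to a$ with $0<a\le\infty$, then $$\tilde Q_n-q_2=O_{\mathrm P}(n^{-1/2})\quad\text{and}\quad \tilde H_n-h_2=O_{\mathrm P}(n^{-1/2})\quad\text{as } n\to\infty.$$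
   Context: $m\ge 0$ is a fixed integer. $\{X_i\}$ is $m$-dependent if the families $\{X_{a-r},\dots,X_a\}$ and $\{X_b,\dots,X_{b+s}\}$ are independent whenever $b-a>m$. $\|\cdot\|$ is the Euclidean norm on $\mathbb{R}^d$ and $I(D)$ is the indicator of $D$. $q_2:=\int_{\mathbb{R}^d}p(x)^2\,dx$ and $h_2:=-\log q_2$. $b_1(d)=2\pi^{d/2}/(d\,\Gamma(d/2))$ and $b_\epsilon(d)=\epsilon^d b_1(d)$ is the volume of a ball of radius $\epsilon$. Estimators: $N_n:=\sum_{1\le i<j\le n} I(\|X_i-X_j\|\le\epsilon(n))$, $\tilde Q_n:=\binom{n}{2}^{-1}N_n/b_{\epsilon(n)}(d)$, $\tilde H_n:=-\log(\max(\tilde Q_n,1/n))$. Assumption $\mathcal{A}$: $p\in L_3(\mathbb{R}^d)$, and for each $4$-tuple of distinct positive integers $\mathbf{t}=(t_1,t_2,t_3,t_4)$ the vector $(X_{t_1},X_{t_2},X_{t_3},X_{t_4})$ has a density $p_{\mathbf{t}}(x_1,x_2,x_3,x_4)$ in $\mathbb{R}^{4d}$ such that $g_{\mathbf{t}}(x_1,x_2):=\left(\int_{\mathbb{R}^{2d}}p_{\mathbf{t}}(x_1,x_2,x_3,x_4)^2\,dx_3\,dx_4\right)^{1/2}$ belongs to $L_1(\mathbb{R}^{2d})$. $H_2^{(\alpha)}(K)$ is the class of functions $p$ on $\mathbb{R}^d$ satisfying $\left(\int_{\mathbb{R}^d}(p(x+h)-p(x))^2\,dx\right)^{1/2}\le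 K\|h\|^\alpha$ for all $h\in\mathbb{R}^d$ with $\|h\|\le 1$. $u_n\sim v_n$ means $u_n/v_n\to 1$. $U_n=O_{\mathrm P}(v_n)$ means that $U_n/v_n$ is bounded in probability: for every $\delta>0$ there is $C>0$ with $P(|U_n/v_n|>C)\le\delta$ for all large enough $n$. *)

theory Defs
  imports "HOL-Analysis.Analysis" "HOL-Probability.Probability" "HOL-Library.Landau_Symbols"
begin

text \<open>
  The space \<open>\<real>\<^sup>d\<close> is an arbitrary type \<open>'a :: euclidean_space\<close> with \<open>d = DIM('a)\<close>. Sequences of random
  vectors are functions on \<open>nat\<close> of which only the values at indices \<open>\<ge> 1\<close> are used.
\<close>

definition m_dependent :: "'w measure \<Rightarrow> nat \<Rightarrow> (nat \<Rightarrow> 'w \<Rightarrow> 'a::euclidean_space) \<Rightarrow> bool" where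
  "m_dependent M m X \<longleftrightarrow>
     (\<forall>a r b s. r < a \<longrightarrow> a + m < b \<longrightarrow>
        prob_space.indep_var M
          (PiM {a - r..a} (\<lambda>_. borel)) (\<lambda>\<omega>. \<lambda>i\<in>{a - r..a}. X i \<omega>)
          (PiM {b..b + s} (\<lambda>_. borel)) (\<lambda>\<omega>. \<lambda>i\<in>{b..b + s}. X i \<omega>))"

definition strictly_stationary :: "'w measure \<Rightarrow> (nat \<Rightarrow> 'w \<Rightarrow> 'a::euclidean_space) \<Rightarrow> bool" where
  "strictly_stationary M X \<longleftrightarrow>
     (\<forall>J h. finite J \<longrightarrow> J \<subseteq> {1..} \<longrightarrow>
        distr M (PiM J (\<lambda>_. borel)) (\<lambda>\<omega>. \<lambda>i\<in>J. X (i + h) \<omega>) =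
        distr M (PiM J (\<lambda>_. borel)) (\<lambda>\<omega>. \<lambda>i\<in>J. X i \<omega>))"

definition has_density :: "'w measure \<Rightarrow> ('w \<Rightarrow> 'a::euclidean_space) \<Rightarrow> ('a \<Rightarrow> real) \<Rightarrow> bool" where
  "has_density M Y f \<longleftrightarrow> (\<forall>x. 0 \<le> f x) \<and> distributed M lborel Y (\<lambda>x. ennreal (f x))"

text \<open>
  The Bochner integral of a non-integrable function is \<open>0\<close>. The almost everywhere clause makes sure
  that the inner integral defining \<open>g\<close> is finite rather than \<open>0\<close> by convention; this is implied by
  \<open>g \<in> L\<^sub>1\<close> when \<open>g\<close> is read as a function with values in \<open>[0, \<infinity>]\<close>.
\<close>

definition assumption_A ::
    "'w measure \<Rightarrow> (nat \<Rightarrow> 'w \<Rightarrow> 'a::euclidean_space) \<Rightarrow> ('a \<Rightarrow> real) \<Rightarrow> bool" where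
  "assumption_A M X p \<longleftrightarrow>
     integrable lborel (\<lambda>x. \<bar>p x\<bar> ^ 3) \<and>
     (\<forall>t1\<ge>1. \<forall>t2\<ge>1. \<forall>t3\<ge>1. \<forall>t4\<ge>1. distinct [t1, t2, t3, t4] \<longrightarrow>
        (\<exists>f :: 'a \<times> 'a \<times> 'a \<times> 'a \<Rightarrow> real.
           has_density M (\<lambda>\<omega>. (X t1 \<omega>, X t2 \<omega>, X t3 \<omega>, X t4 \<omega>)) f \<and>
           (AE (x1, x2) in lborel. integrable lborel (\<lambda>(x3, x4). (f (x1, x2, x3, x4))\<^sup>2)) \<and>
           integrable lborel
             (\<lambda>(x1, x2). sqrt (LINT (x3, x4)|lborel. (f (x1, x2, x3, x4))\<^sup>2))))"

definition H2_class :: "real \<Rightarrow> real \<Rightarrow> ('a::euclidean_space \<Rightarrow> real) set" where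
  "H2_class \<alpha> K =
     {p \<in> borel_measurable lborel.
        \<forall>h. norm h \<le> 1 \<longrightarrow>
          integrable lborel (\<lambda>x. (p (x + h) - p x)\<^sup>2) \<and>
          sqrt (LINT x|lborel. (p (x + h) - p x)\<^sup>2) \<le> K * norm h powr \<alpha>}"

definition q2 :: "('a::euclidean_space \<Rightarrow> real) \<Rightarrow> real" where
  "q2 p = (LINT x|lborel. (p x)\<^sup>2)"

definition h2 :: "('a::euclidean_space \<Rightarrow> real) \<Rightarrow> real" where
  "h2 p = - ln (q2 p)"

definition ball_vol :: "nat \<Rightarrow> real \<Rightarrow> real" where
  "ball_vol d e = e ^ d * (2 * pi powr (real d / 2) / (real d * Gamma (real d / 2)))"

definition close_pairs :: "(nat \<Rightarrow> 'w \<Rightarrow> 'a::euclidean_space) \<Rightarrow> real \<Rightarrow> nat \<Rightarrow> 'w \<Rightarrow> real" where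
  "close_pairs X e n \<omega> = (\<Sum>j=1..n. \<Sum>i=1..<j. of_bool (norm (X i \<omega> - X j \<omega>) \<le> e))"

definition Q_est :: "(nat \<Rightarrow> 'w \<Rightarrow> 'a::euclidean_space) \<Rightarrow> (nat \<Rightarrow> real) \<Rightarrow> nat \<Rightarrow> 'w \<Rightarrow> real" where
  "Q_est X \<epsilon> n \<omega> = close_pairs X (\<epsilon> n) n \<omega> / real (n choose 2) / ball_vol DIM('a) (\<epsilon> n)"

definition H_est :: "(nat \<Rightarrow> 'w \<Rightarrow> 'a::euclidean_space) \<Rightarrow> (nat \<Rightarrow> real) \<Rightarrow> nat \<Rightarrow> 'w \<Rightarrow> real" where
  "H_est X \<epsilon> n \<omega> = - ln (max (Q_est X \<epsilon> n \<omega>) (1 / real n))"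

definition slowly_varying :: "(real \<Rightarrow> real) \<Rightarrow> bool" where
  "slowly_varying L \<longleftrightarrow>
     L \<in> borel_measurable (lebesgue_on {1..}) \<and> (\<forall>x\<ge>1. 0 < L x) \<and>
     (\<forall>t>0. ((\<lambda>x. L (t * x) / L x) \<longlongrightarrow> 1) at_top)"

definition bigo_prob :: "'w measure \<Rightarrow> (nat \<Rightarrow> 'w \<Rightarrow> real) \<Rightarrow> (nat \<Rightarrow> real) \<Rightarrow> bool" where
  "bigo_prob M U v \<longleftrightarrow>
     (\<forall>\<delta>>0. \<exists>C>0. \<forall>\<^sub>F n in sequentially. measure M {\<omega> \<in> space M. \<bar>U n \<omega> / v n\<bar> > C} \<le> \<delta>)"

end

theory Submission
  imports Defs
begin

text \<open>
  Call two indices near if they differ by at most \<open>m\<close>, and let \<open>b = ball_vol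
  DIM('a) e\<close>. The estimator is a normalised count of the pairs at distance at most
  \<open>e\<close>, so everything follows from the mean and the variance of that count.

  Mean. For indices that are not near, the two observations are independent, and the probability of
  a close pair is the integral over \<open>norm h \<le> e\<close> of the autocorrelation
  \<open>\<integral> p x * p (x + h)\<close>. Expanding a square turns the autocorrelation into
  \<open>q2 p - \<integral> (p (x + h) - p x)\<^sup>2 / 2\<close>, so the error per unit volume is
  at most \<open>K\<^sup>2 / 2 * e powr (2 * \<alpha>)\<close> (\<open>close_prob_far_le\<close>,
  \<open>close_prob_far_ge\<close>). Only \<open>O(n)\<close> of the pairs have near indices. Each
  of them is close with probability \<open>o(e powr (d / 2))\<close>, \<open>d\<close> being the
  dimension: placing an independent copy of the pair far away squares this probability, and the
  square is controlled by the joint density of four observations through the Cauchy--Schwarz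
  inequality and dominated convergence (\<open>near_close_prob_smallo\<close>).

  Variance. The covariance of the indicators of two pairs vanishes unless an index of one pair is
  near an index of the other. In the remaining quadruples the two other indices may be isolated:
  there are \<open>O(n^3)\<close> of these, and both pairs are close with probability at most
  \<open>b\<^sup>2 * \<integral> p ^ 3\<close>. If they are not isolated but one of the pairs has
  indices that are not near, then that pair is close with probability \<open>O(b)\<close>, and there
  are \<open>O(n\<^sup>2)\<close> such quadruples. The last \<open>O(n)\<close> quadruples form a
  single cluster, where the bound for small lags applies. After normalisation the variance is
  \<open>O(1 / n + 1 / (n\<^sup>2 * e ^ d) + 1 / (n * e powr (d / 2)) ^ 3)\<close>
  (\<open>both_close_prob_le_cluster_bound\<close>, \<open>Q_est_variance_le\<close>).

  Rates. Chebyshev's inequality converts bias and variance into a rate in probability, and the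
  logarithm preserves it because \<open>q2 p > 0\<close>. In the smooth regime the bias is small
  enough because a slowly varying function grows more slowly than any power, which rests on a local
  uniformity property that measurability provides
  (\<open>slowly_varying_locally_bounded_ratio\<close>).
\<close>

section \<open>Independence of separated index sets\<close>

context prob_space begin

lemma indep_var_prob_Int:
  assumes "indep_var S Y T Z" "A \<in> sets S" "B \<in> sets T"
  shows "prob ((Y -` A \<inter> space M) \<inter> (Z -` B \<inter> space M)) =
    prob (Y -` A \<inter> space M) * prob (Z -` B \<inter> space M)"
proof -
  have "indep_set (sigma_sets (space M) {Y -` A \<inter> space M | A. A \<in> sets S})
      (sigma_sets (space M) {Z -` A \<inter> space M | A. A \<in> sets T})"
    using assms(1) by (simp add: indep_var_eq)
  then show ?thesis
    by (rule indep_setD; intro sigma_sets.Basic) (use assms in auto)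
qed

lemma prob_product_blocks:
  fixes X :: "nat \<Rightarrow> 'a \<Rightarrow> 'b::euclidean_space"
  assumes dep: "m_dependent M m X"
    and S: "finite S" "S \<subseteq> {1..}" and T: "finite T" "T \<subseteq> {1..}"
    and gap: "\<And>s t. s \<in> S \<Longrightarrow> t \<in> T \<Longrightarrow> s + m < t"
    and E: "\<And>i. E i \<in> sets borel"
  shows "prob {\<omega> \<in> space M. \<forall>i \<in> S \<union> T. X i \<omega> \<in> E i} =
    prob {\<omega> \<in> space M. \<forall>i \<in> S. X i \<omega> \<in> E i} * prob {\<omega> \<in> space M. \<forall>i \<in> T. X i \<omega> \<in> E i}"
proof (cases "S = {} \<or> T = {}")
  case True
  then show ?thesis by (auto simp: prob_space)
next
  case False
  define a where "a = Max S"
  define r where "r = Max S - Min S"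
  define b where "b = Min T"
  define s where "s = Max T - Min T"
  have mm: "Min S \<le> Max S" "Min T \<le> Max T" "1 \<le> Min S" 
    using S T False by (auto simp: subset_iff)
  have I: "a - r = Min S" "b + s = Max T"
    using mm by (auto simp: a_def r_def b_def s_def)
  have sub: "S \<subseteq> {a - r..a}" "T \<subseteq> {b..b + s}"
    unfolding I using S T by (auto simp: a_def b_def)
  have "r < a"
    using mm unfolding a_def r_def by linarith
  moreover have "a + m < b"
    using gap[of a b] S T False by (auto simp: a_def b_def)
  ultimately
  have ind: "indep_var
        (PiM {a - r..a} (\<lambda>_. borel)) (\<lambda>\<omega>. \<lambda>i\<in>{a - r..a}. X i \<omega>)
        (PiM {b..b + s} (\<lambda>_. borel)) (\<lambda>\<omega>. \<lambda>i\<in>{b..b + s}. X i \<omega>)"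
    using dep unfolding m_dependent_def by blast
  define A where "A = PiE {a - r..a} (\<lambda>i. if i \<in> S then E i else UNIV)"
  define B where "B = PiE {b..b + s} (\<lambda>i. if i \<in> T then E i else UNIV)"
  have AB: "A \<in> sets (PiM {a - r..a} (\<lambda>_. borel))" "B \<in> sets (PiM {b..b + s} (\<lambda>_. borel))"
    unfolding A_def B_def using E by (auto intro!: sets_PiM_I_finite)
  have eq: "(\<lambda>\<omega>. \<lambda>i\<in>{a - r..a}. X i \<omega>) -` A \<inter> space M = {\<omega> \<in> space M. \<forall>i \<in> S. X i \<omega> \<in> E i}"
     "(\<lambda>\<omega>. \<lambda>i\<in>{b..b + s}. X i \<omega>) -` B \<inter> space M = {\<omega> \<in> space M. \<forall>i \<in> T. X i \<omega> \<in> E i}"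
    using sub unfolding A_def B_def by (auto simp: PiE_iff subset_iff split: if_splits)
  have "prob (((\<lambda>\<omega>. \<lambda>i\<in>{a - r..a}. X i \<omega>) -` A \<inter> space M) \<inter>
              ((\<lambda>\<omega>. \<lambda>i\<in>{b..b + s}. X i \<omega>) -` B \<inter> space M)) =
        prob ((\<lambda>\<omega>. \<lambda>i\<in>{a - r..a}. X i \<omega>) -` A \<inter> space M) *
        prob ((\<lambda>\<omega>. \<lambda>i\<in>{b..b + s}. X i \<omega>) -` B \<inter> space M)"
    by (rule indep_var_prob_Int[OF ind AB])
  moreover have "{\<omega> \<in> space M. \<forall>i \<in> S. X i \<omega> \<in> E i} \<inter> {\<omega> \<in> space M. \<forall>i \<in> T. X i \<omega> \<in> E i}
     = {\<omega> \<in> space M. \<forall>i \<in> S \<union> T. X i \<omega> \<in> E i}" by auto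
  ultimately show ?thesis unfolding eq by simp
qed

text \<open>
  The definition of \<open>m\<close>-dependence speaks of two blocks, one after the other; here the
  index sets may interleave. By induction: the indices of one set beyond the last index of the other
  one form a block after everything else. Peeling it off leaves interleaved sets of smaller total
  size.
\<close>

lemma prob_product_separated:
  fixes X :: "nat \<Rightarrow> 'a \<Rightarrow> 'b::euclidean_space"
  assumes dep: "m_dependent M m X"
    and E: "\<And>i. E i \<in> sets borel"
    and "finite A" "A \<subseteq> {1..}" "finite B" "B \<subseteq> {1..}"
    and "\<And>a b. a \<in> A \<Longrightarrow> b \<in> B \<Longrightarrow> a + m < b \<or> b + m < a"
  shows "prob {\<omega> \<in> space M. \<forall>i \<in> A \<union> B. X i \<omega> \<in> E i} =
    prob {\<omega> \<in> space M. \<forall>i \<in> A. X i \<omega> \<in> E i} * prob {\<omega> \<in> space M. \<forall>i \<in> B. X i \<omega> \<in> E i}"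
  using assms(3-)
proof (induction "card (A \<union> B)" arbitrary: A B rule: less_induct)
  case less
  define \<phi> where "\<phi> S = prob {\<omega> \<in> space M. \<forall>i \<in> S. X i \<omega> \<in> E i}" for S
  have step: "\<phi> (A \<union> B) = \<phi> A * \<phi> B"
    if AB: "finite A" "A \<subseteq> {1..}" "finite B" "B \<subseteq> {1..}"
      "\<And>a b. a \<in> A \<Longrightarrow> b \<in> B \<Longrightarrow> a + m < b \<or> b + m < a"
      and IH: "\<And>A' B'. card (A' \<union> B') < card (A \<union> B) \<Longrightarrow> finite A' \<Longrightarrow> A' \<subseteq> {1..} \<Longrightarrow>
        finite B' \<Longrightarrow> B' \<subseteq> {1..} \<Longrightarrow> 
       (\<And>a b. a \<in> A' \<Longrightarrow> b \<in> B' \<Longrightarrow> a + m < b \<or> b + m < a) \<Longrightarrow> \<phi> (A' \<union> B') = \<phi> A' * \<phi> B'"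
      and ne: "A \<noteq> {}" "B \<noteq> {}" and lt: "Max B < Max A" for A B
  proof -
    define A1 where "A1 = {a \<in> A. a < Max B}"
    define A2 where "A2 = {a \<in> A. Max B < a}"
    have MB: "Max B \<in> B" using AB ne by auto
    have A: "A = A1 \<union> A2"
      using AB(5)[OF _ MB] by (force simp: A1_def A2_def)
    have fin: "finite A1" "finite A2" "A1 \<subseteq> {1..}" "A2 \<subseteq> {1..}"
      using AB by (auto simp: A1_def A2_def)
    have g2: "Max B + m < t" if "t \<in> A2" for t
      using AB(5)[of t "Max B"] MB that by (auto simp: A2_def)
    have leB: "b \<le> Max B" if "b \<in> B" for b using that AB by auto
    have gap: "s + m < t" if "s \<in> A1 \<union> B" "t \<in> A2" for s t
      using g2[OF that(2)] that(1) leB[of s] by (auto simp: A1_def)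
    have "Max A \<in> A2" using lt AB ne by (auto simp: A2_def)
    moreover have "Max A \<notin> A1 \<union> B"
      using lt leB[of "Max A"] leB[OF MB] by (auto simp: A1_def)
    ultimately have "A1 \<union> B \<subset> A \<union> B" using A by blast
    then have card: "card (A1 \<union> B) < card (A \<union> B)"
      using AB by (intro psubset_card_mono) auto
    have "\<phi> (A \<union> B) = \<phi> ((A1 \<union> B) \<union> A2)" using A by (simp add: Un_ac)
    also have "\<dots> = \<phi> (A1 \<union> B) * \<phi> A2"
      unfolding \<phi>_def using AB fin gap by (intro prob_product_blocks[OF dep _ _ _ _ _ E]) auto
    also have "\<phi> (A1 \<union> B) = \<phi> A1 * \<phi> B"
      using AB fin A by (intro IH card) auto
    also have "\<phi> A1 * \<phi> B * \<phi> A2 = (\<phi> A1 * \<phi> A2) * \<phi> B" by simp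
    also have "\<phi> A1 * \<phi> A2 = \<phi> (A1 \<union> A2)"
      unfolding \<phi>_def using AB fin gap by (intro prob_product_blocks[OF dep _ _ _ _ _ E, symmetric]) auto
    finally show ?thesis using A by simp
  qed
  have IH: "\<And>A' B'. card (A' \<union> B') < card (A \<union> B) \<Longrightarrow> finite A' \<Longrightarrow> A' \<subseteq> {1..} \<Longrightarrow>
        finite B' \<Longrightarrow> B' \<subseteq> {1..} \<Longrightarrow> 
       (\<And>a b. a \<in> A' \<Longrightarrow> b \<in> B' \<Longrightarrow> a + m < b \<or> b + m < a) \<Longrightarrow> \<phi> (A' \<union> B') = \<phi> A' * \<phi> B'"
    unfolding \<phi>_def using less.hyps by blast
  have "\<phi> (A \<union> B) = \<phi> A * \<phi> B"
  proof (cases "A = {} \<or> B = {}")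
    case True
    then show ?thesis by (auto simp: \<phi>_def prob_space)
  next
    case False
    then have "Max A \<noteq> Max B"
      using less.prems(5)[of "Max A" "Max B"] less.prems(1,3) Max_in[of A] Max_in[of B] by auto
    then consider "Max B < Max A" | "Max A < Max B" by linarith
    then show ?thesis
    proof cases
      case 1
      show ?thesis by (rule step) (use less.prems False IH 1 in auto)
    next
      case 2
      have "\<phi> (B \<union> A) = \<phi> B * \<phi> A"
      proof (rule step)
        show "\<And>a b. a \<in> B \<Longrightarrow> b \<in> A \<Longrightarrow> a + m < b \<or> b + m < a"
          using less.prems(5) by blast
        show "\<And>A' B'. card (A' \<union> B') < card (B \<union> A) \<Longrightarrow> finite A' \<Longrightarrow> A' \<subseteq> {1..} \<Longrightarrow>
          finite B' \<Longrightarrow> B' \<subseteq> {1..} \<Longrightarrow>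
          (\<And>a b. a \<in> A' \<Longrightarrow> b \<in> B' \<Longrightarrow> a + m < b \<or> b + m < a) \<Longrightarrow> \<phi> (A' \<union> B') = \<phi> A' * \<phi> B'"
          by (rule IH) (simp_all add: Un_commute)
      qed (use less.prems False 2 in auto)
      then show ?thesis by (simp add: Un_commute)
    qed
  qed
  then show ?case unfolding \<phi>_def .
qed

text \<open>
  The product rule for rectangles extends to the generated \<open>\<sigma>\<close>-algebras, since
  rectangles are closed under intersection.
\<close>

lemma m_dependent_indep_separated:
  fixes X :: "nat \<Rightarrow> 'a \<Rightarrow> 'b::euclidean_space"
  assumes dep: "m_dependent M m X"
    and X: "\<And>i. i \<ge> 1 \<Longrightarrow> X i \<in> borel_measurable M"
    and A: "finite A" "A \<subseteq> {1..}" and B: "finite B" "B \<subseteq> {1..}"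
    and sep: "\<And>a b. a \<in> A \<Longrightarrow> b \<in> B \<Longrightarrow> a + m < b \<or> b + m < a"
  shows "indep_var (PiM A (\<lambda>_. borel)) (\<lambda>\<omega>. \<lambda>i\<in>A. X i \<omega>) (PiM B (\<lambda>_. borel)) (\<lambda>\<omega>. \<lambda>i\<in>B. X i \<omega>)"
proof -
  define G where "G S = {{\<omega> \<in> space M. \<forall>i \<in> S. X i \<omega> \<in> E i} | E. \<forall>i. E i \<in> sets borel}" for S :: "nat set"
  have ev: "G S \<subseteq> events" if "finite S" "S \<subseteq> {1..}" for S
  proof
    fix x assume "x \<in> G S"
    then obtain E where x: "x = {\<omega> \<in> space M. \<forall>i \<in> S. X i \<omega> \<in> E i}" and E: "\<And>i. E i \<in> sets borel"
      by (auto simp: G_def)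
    have "Measurable.pred M (\<lambda>\<omega>. X i \<omega> \<in> E i)" if "i \<in> S" for i
      using X[of i] E[of i] that \<open>S \<subseteq> {1..}\<close> by (intro pred_sets2[OF E]) auto
    then have "Measurable.pred M (\<lambda>\<omega>. \<forall>i \<in> S. X i \<omega> \<in> E i)"
      using \<open>finite S\<close> by (intro pred_intros_finite) auto
    then show "x \<in> events" unfolding x by (auto simp: pred_def)
  qed
  have "Int_stable (G S)" for S
  proof (rule Int_stableI)
    fix a b assume "a \<in> G S" "b \<in> G S"
    then obtain E F where a: "a = {\<omega> \<in> space M. \<forall>i \<in> S. X i \<omega> \<in> E i}" "\<And>i. E i \<in> sets borel"
       and b: "b = {\<omega> \<in> space M. \<forall>i \<in> S. X i \<omega> \<in> F i}" "\<And>i. F i \<in> sets borel"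
      by (auto simp: G_def)
    have "a \<inter> b = {\<omega> \<in> space M. \<forall>i \<in> S. X i \<omega> \<in> E i \<inter> F i}" unfolding a b by auto
    then show "a \<inter> b \<in> G S" unfolding G_def using a b
      by (intro CollectI exI[of _ "\<lambda>i. E i \<inter> F i"]) auto
  qed
  note stable = this
  have "indep_set (G A) (G B)"
    unfolding indep_sets2_eq
  proof (intro conjI ballI)
    fix a b assume "a \<in> G A" "b \<in> G B"
    then obtain E F where a: "a = {\<omega> \<in> space M. \<forall>i \<in> A. X i \<omega> \<in> E i}" "\<And>i. E i \<in> sets borel"
       and b: "b = {\<omega> \<in> space M. \<forall>i \<in> B. X i \<omega> \<in> F i}" "\<And>i. F i \<in> sets borel"
      by (auto simp: G_def)
    have disj: "i \<notin> B" if "i \<in> A" for i using sep[of i i] that by auto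
    define H where "H i = (if i \<in> A then E i else F i)" for i
    have a': "a = {\<omega> \<in> space M. \<forall>i \<in> A. X i \<omega> \<in> H i}" and b': "b = {\<omega> \<in> space M. \<forall>i \<in> B. X i \<omega> \<in> H i}"
      unfolding a b H_def using disj by auto
    have "a \<inter> b = {\<omega> \<in> space M. \<forall>i \<in> A \<union> B. X i \<omega> \<in> H i}" unfolding a' b' by auto
    moreover have "prob \<dots> = prob a * prob b"
      unfolding a' b' using a b A B sep by (intro prob_product_separated[OF dep]) (auto simp: H_def)
    ultimately show "prob (a \<inter> b) = prob a * prob b" by simp
  qed (use ev A B in auto)
  then have ind: "indep_set (sigma_sets (space M) (G A)) (sigma_sets (space M) (G B))"
    by (rule indep_set_sigma_sets[OF _ stable stable])
  have sub: "sigma_sets (space M) {(\<lambda>\<omega>. \<lambda>i\<in>S. X i \<omega>) -` Q \<inter> space M | Q. Q \<in> sets (PiM S (\<lambda>_. borel))}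
     \<subseteq> sigma_sets (space M) (G S)"
    if S: "finite S" "S \<subseteq> {1..}" for S
  proof (rule sigma_sets_mono, safe)
    fix Q :: "(nat \<Rightarrow> 'b) set" assume Q: "Q \<in> sets (PiM S (\<lambda>_. borel))"
    interpret s: sigma_algebra "space M" "sigma_sets (space M) (G S)"
      using ev[OF S] by (intro sigma_algebra_sigma_sets) (auto dest: sets.sets_into_space)
    have eq: "sets (PiM S (\<lambda>_. borel :: 'b measure)) = sigma_sets (\<Pi>\<^sub>E i\<in>S. UNIV) {Pi\<^sub>E S E | E. \<forall>i\<in>S. E i \<in> sets borel}"
      using sets_PiM[of S "\<lambda>_. borel :: 'b measure"] prod_algebra_eq_finite[OF S(1), of "\<lambda>_. borel :: 'b measure"]
      by (simp add: Pi_def Ball_def)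
    have "(\<lambda>\<omega>. \<lambda>i\<in>S. X i \<omega>) \<in> measurable (sigma (space M) (sigma_sets (space M) (G S))) (PiM S (\<lambda>_. borel))"
    proof (rule measurable_sigma_sets[OF eq])
      fix y assume "y \<in> {Pi\<^sub>E S E |E. \<forall>i\<in>S. E i \<in> sets (borel :: 'b measure)}"
      then obtain E where y: "y = Pi\<^sub>E S E" and E: "\<And>i. i \<in> S \<Longrightarrow> E i \<in> sets borel" by auto
      have "(\<lambda>\<omega>. \<lambda>i\<in>S. X i \<omega>) -` y \<inter> space M = {\<omega> \<in> space M. \<forall>i \<in> S. X i \<omega> \<in> (if i \<in> S then E i else UNIV)}"
        unfolding y by (auto simp: PiE_iff)
      moreover have "\<dots> \<in> G S" unfolding G_def 
        by (intro CollectI exI[of _ "\<lambda>i. if i \<in> S then E i else UNIV"]) (use E in auto)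
      ultimately show "(\<lambda>\<omega>. \<lambda>i\<in>S. X i \<omega>) -` y \<inter> space (sigma (space M) (sigma_sets (space M) (G S)))
        \<in> sets (sigma (space M) (sigma_sets (space M) (G S)))"
        by (simp add: s.space_closed s.sigma_sets_eq)
    qed (auto simp: s.space_closed)
    from measurable_sets[OF this Q]
    show "(\<lambda>\<omega>. \<lambda>i\<in>S. X i \<omega>) -` Q \<inter> space M \<in> sigma_sets (space M) (G S)"
      by (simp add: s.space_closed s.sigma_sets_eq)
  qed
  have rv: "(\<lambda>\<omega>. \<lambda>i\<in>S. X i \<omega>) \<in> measurable M (PiM S (\<lambda>_. borel))" if "S \<subseteq> {1..}" for S
    using that X by (intro measurable_restrict) auto
  show ?thesis
    unfolding indep_var_eq
    using rv[OF A(2)] rv[OF B(2)] ind sub[OF A] sub[OF B]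
    unfolding indep_sets2_eq by blast
qed

end

section \<open>Ball volumes and the autocorrelation of a density\<close>

lemma measure_cball_ball_vol:
  fixes c :: "'a::euclidean_space"
  assumes "e \<ge> 0"
  shows "measure lborel (cball c e) = ball_vol DIM('a) e"
proof -
  have "Gamma (real DIM('a) / 2 + 1) = real DIM('a) / 2 * Gamma (real DIM('a) / 2)"
  proof (intro trans[OF Gamma_plus1] refl)
    have "real DIM('a) / 2 > 0" by simp
    then show "real DIM('a) / 2 \<notin> \<int>\<^sub>\<le>\<^sub>0" by (meson nonpos_Ints_nonpos not_le)
  qed
  note Gamma = this
  have *: "unit_ball_vol (real DIM('a)) = 2 * pi powr (real DIM('a) / 2) / (real DIM('a) * Gamma (real DIM('a) / 2))"
    unfolding unit_ball_vol_def Gamma by simp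
  show ?thesis
    using content_cball[OF assms, of c] unfolding * ball_vol_def by simp
qed

lemma emeasure_cball_ball_vol:
  fixes c :: "'a::euclidean_space"
  assumes "e \<ge> 0"
  shows "emeasure lborel (cball c e) = ennreal (ball_vol DIM('a) e)"
  using measure_cball_ball_vol[OF assms, of c] emeasure_lborel_cball_finite[of c e]
  by (simp add: emeasure_eq_ennreal_measure less_top)

lemma ball_vol_nonneg: "e \<ge> 0 \<Longrightarrow> ball_vol DIM('a::euclidean_space) e \<ge> 0"
  using measure_cball_ball_vol[of e "0::'a"] measure_nonneg by metis

lemma measurable_indicator_cball [measurable (raw)]:
  fixes f g :: "'b \<Rightarrow> 'a::euclidean_space"
  assumes [measurable]: "f \<in> borel_measurable M" "g \<in> borel_measurable M"
  shows "(\<lambda>x. indicator (cball (f x) e) (g x) :: ennreal) \<in> borel_measurable M"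
  by (intro borel_measurable_indicator') (simp add: mem_cball)

lemma ball_vol_pos: "e > 0 \<Longrightarrow> ball_vol DIM('a::euclidean_space) e > 0"
  using measure_cball_ball_vol[of e "0::'a"] content_cball_gt_0_iff[of "0::'a" e] by simp

lemma nn_integral_lborel_shift:
  fixes f :: "'a::euclidean_space \<Rightarrow> ennreal"
  assumes [measurable]: "f \<in> borel_measurable borel"
  shows "(\<integral>\<^sup>+x. f (c + x) \<partial>lborel) = (\<integral>\<^sup>+x. f x \<partial>lborel)"
proof -
  have "(\<integral>\<^sup>+x. f x \<partial>lborel) = (\<integral>\<^sup>+x. f x \<partial>(distr lborel borel ((+) c)))"
    by (simp add: lborel_distr_plus)
  also have "\<dots> = (\<integral>\<^sup>+x. f (c + x) \<partial>lborel)"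
    by (subst nn_integral_distr) auto
  finally show ?thesis by simp
qed

lemma nn_integral_lborel_Fubini:
  fixes f :: "'a::euclidean_space \<Rightarrow> 'b::euclidean_space \<Rightarrow> ennreal"
  assumes "case_prod f \<in> borel_measurable (borel \<Otimes>\<^sub>M borel)"
  shows "(\<integral>\<^sup>+x. \<integral>\<^sup>+y. f x y \<partial>lborel \<partial>lborel) = (\<integral>\<^sup>+y. \<integral>\<^sup>+x. f x y \<partial>lborel \<partial>lborel)"
proof -
  show ?thesis
    using assms by (intro lborel_pair.Fubini'[symmetric]) (simp add: measurable_def space_pair_measure sets_pair_measure)
qed

text \<open>
  Interpolation between \<open>L\<^sub>1\<close> and \<open>L\<^sub>3\<close>, by \<open>y\<^sup>2
  \<le> y + y ^ 3\<close>.
\<close>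

lemma square_integrable_of_cube:
  fixes p :: "'a::euclidean_space \<Rightarrow> real"
  assumes p: "p \<in> borel_measurable borel" "\<And>x. 0 \<le> p x" 
    and int: "integrable lborel p" and cube: "integrable lborel (\<lambda>x. \<bar>p x\<bar> ^ 3)"
  shows "integrable lborel (\<lambda>x. (p x)\<^sup>2)"
proof (rule Bochner_Integration.integrable_bound)
  show "integrable lborel (\<lambda>x. p x + \<bar>p x\<bar> ^ 3)" using int cube by simp
  have "y\<^sup>2 \<le> y + y ^ 3" if "y \<ge> 0" for y :: real
  proof -
    have "0 \<le> y * ((y - 1)\<^sup>2 + y)" using that by simp
    also have "\<dots> = y + y ^ 3 - y\<^sup>2" by (simp add: power2_eq_square power3_eq_cube algebra_simps)
    finally show ?thesis by simp
  qed
  then show "AE x in lborel. norm ((p x)\<^sup>2) \<le> norm (p x + \<bar>p x\<bar> ^ 3)"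
    using p(2) by (auto simp: abs_of_nonneg)
qed (use p in auto)

locale L2_density =
  fixes p :: "'a::euclidean_space \<Rightarrow> real"
  assumes measurable_p [measurable]: "p \<in> borel_measurable borel"
    and nonneg: "\<And>x. 0 \<le> p x"
    and square_integrable: "integrable lborel (\<lambda>x. (p x)\<^sup>2)"
begin

definition autocorr :: "'a \<Rightarrow> real" where
  "autocorr h = (LINT x|lborel. p x * p (x + h))"

lemma square_integrable_shift: "integrable lborel (\<lambda>x. (p (x + h))\<^sup>2)"
  and square_integral_shift: "(LINT x|lborel. (p (x + h))\<^sup>2) = q2 p"
proof -
  have "has_bochner_integral lborel (\<lambda>x. (p x)\<^sup>2) (q2 p)"
    using square_integrable by (simp add: has_bochner_integral_iff q2_def)
  moreover have "lborel = distr lborel borel (\<lambda>x::'a. x + h)"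
    by (subst add.commute) (rule lborel_distr_plus[symmetric])
  ultimately have "has_bochner_integral (distr lborel borel (\<lambda>x::'a. x + h)) (\<lambda>x. (p x)\<^sup>2) (q2 p)" by simp
  then have "has_bochner_integral lborel (\<lambda>x. (p (x + h))\<^sup>2) (q2 p)"
    by (simp add: has_bochner_integral_iff integrable_distr_eq integral_distr)
  then show "integrable lborel (\<lambda>x. (p (x + h))\<^sup>2)" "(LINT x|lborel. (p (x + h))\<^sup>2) = q2 p"
    by (auto simp: has_bochner_integral_iff)
qed

lemma integrable_autocorr: "integrable lborel (\<lambda>x. p x * p (x + h))"
proof (rule Bochner_Integration.integrable_bound)
  show "integrable lborel (\<lambda>x. (p x)\<^sup>2 + (p (x + h))\<^sup>2)"
    using square_integrable square_integrable_shift by simp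
  show "AE x in lborel. norm (p x * p (x + h)) \<le> norm ((p x)\<^sup>2 + (p (x + h))\<^sup>2)"
  proof (rule AE_I2)
    fix x
    have "2 * (p x * p (x + h)) \<le> (p x)\<^sup>2 + (p (x + h))\<^sup>2"
      using sum_squares_bound[of "p x" "p (x + h)"] by simp
    moreover have "0 \<le> p x * p (x + h)" using nonneg by simp
    ultimately show "norm (p x * p (x + h)) \<le> norm ((p x)\<^sup>2 + (p (x + h))\<^sup>2)" by simp
  qed
qed auto

text \<open>
  This identity doubles the order of the bias: the autocorrelation at \<open>h\<close> deviates from
  its value \<open>q2 p\<close> at \<open>0\<close> only by the squared
  \<open>L\<^sub>2\<close>-modulus of continuity, and always downwards.
\<close>

lemma autocorr_eq: "autocorr h = q2 p - (LINT x|lborel. (p (x + h) - p x)\<^sup>2) / 2"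
proof -
  have "(LINT x|lborel. (p (x + h) - p x)\<^sup>2) = (LINT x|lborel. (p (x + h))\<^sup>2 + (p x)\<^sup>2 - 2 * (p x * p (x + h)))"
    by (simp add: power2_diff algebra_simps)
  also have "\<dots> = q2 p + q2 p - 2 * autocorr h"
    using square_integrable square_integrable_shift integrable_autocorr
    by (simp add: square_integral_shift autocorr_def q2_def)
  finally show ?thesis by (simp add: field_simps)
qed

lemma autocorr_le: "autocorr h \<le> q2 p"
proof -
  have "0 \<le> (LINT x|lborel. (p (x + h) - p x)\<^sup>2)" by simp
  then show ?thesis unfolding autocorr_eq by simp
qed

lemma autocorr_ge:
  assumes "p \<in> H2_class \<alpha> K" "norm h \<le> e" "e \<le> 1" "\<alpha> > 0"
  shows "q2 p - K\<^sup>2 / 2 * e powr (2 * \<alpha>) \<le> autocorr h"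
proof -
  let ?D = "LINT x|lborel. (p (x + h) - p x)\<^sup>2"
  have "sqrt ?D \<le> K * norm h powr \<alpha>"
    using assms unfolding H2_class_def by auto
  then have "(sqrt ?D)\<^sup>2 \<le> (K * norm h powr \<alpha>)\<^sup>2" 
    by (intro power_mono) auto
  also have "(sqrt ?D)\<^sup>2 = ?D" by simp
  also have "(K * norm h powr \<alpha>)\<^sup>2 = K\<^sup>2 * norm h powr (2 * \<alpha>)"
    by (simp add: power_mult_distrib power2_eq_square flip: powr_add)
  also have "\<dots> \<le> K\<^sup>2 * e powr (2 * \<alpha>)"
    using assms by (intro mult_left_mono powr_mono2) auto
  finally show ?thesis unfolding autocorr_eq by simp
qed

text \<open>
  Substitute \<open>y = x + h\<close> and exchange the integrals.
\<close>

lemma nn_integral_close_pair: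
  "(\<integral>\<^sup>+x. \<integral>\<^sup>+y. ennreal (p x) * ennreal (p y) * indicator (cball x e) y \<partial>lborel \<partial>lborel) =
    (\<integral>\<^sup>+h. ennreal (autocorr h) * indicator (cball 0 e) h \<partial>lborel)"
proof -
  have "(\<integral>\<^sup>+x. \<integral>\<^sup>+y. ennreal (p x) * ennreal (p y) * indicator (cball x e) y \<partial>lborel \<partial>lborel)
     = (\<integral>\<^sup>+x. \<integral>\<^sup>+h. ennreal (p x) * ennreal (p (x + h)) * indicator (cball x e) (x + h) \<partial>lborel \<partial>lborel)"
    by (intro nn_integral_cong nn_integral_lborel_shift[symmetric]) measurable
  also have "\<dots> = (\<integral>\<^sup>+x. \<integral>\<^sup>+h. ennreal (p x) * ennreal (p (x + h)) * indicator (cball 0 e) h \<partial>lborel \<partial>lborel)"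
    by (intro nn_integral_cong) (auto simp: indicator_def dist_norm)
  also have "\<dots> = (\<integral>\<^sup>+h. \<integral>\<^sup>+x. ennreal (p x) * ennreal (p (x + h)) * indicator (cball 0 e) h \<partial>lborel \<partial>lborel)"
    by (intro nn_integral_lborel_Fubini) measurable
  also have "\<dots> = (\<integral>\<^sup>+h. ennreal (autocorr h) * indicator (cball 0 e) h \<partial>lborel)"
  proof (intro nn_integral_cong)
    fix h
    have "(\<integral>\<^sup>+x. ennreal (p x) * ennreal (p (x + h)) * indicator (cball 0 e) h \<partial>lborel)
       = (\<integral>\<^sup>+x. ennreal (p x * p (x + h)) \<partial>lborel) * indicator (cball 0 e) h"
      by (subst nn_integral_multc) (auto simp: ennreal_mult nonneg)
    also have "(\<integral>\<^sup>+x. ennreal (p x * p (x + h)) \<partial>lborel) = ennreal (autocorr h)"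
      unfolding autocorr_def using integrable_autocorr nonneg by (intro nn_integral_eq_integral) auto
    finally show "(\<integral>\<^sup>+x. ennreal (p x) * ennreal (p (x + h)) * indicator (cball 0 e) h \<partial>lborel) =
      ennreal (autocorr h) * indicator (cball 0 e) h" .
  qed
  finally show ?thesis .
qed

lemma nn_integral_close_pair_le:
  assumes "e \<ge> 0"
  shows "(\<integral>\<^sup>+x. \<integral>\<^sup>+y. ennreal (p x) * ennreal (p y) * indicator (cball x e) y \<partial>lborel \<partial>lborel)
     \<le> ennreal (q2 p * ball_vol DIM('a) e)"
proof -
  have "(\<integral>\<^sup>+h. ennreal (autocorr h) * indicator (cball (0::'a) e) h \<partial>lborel) \<le>
     (\<integral>\<^sup>+h. ennreal (q2 p) * indicator (cball (0::'a) e) h \<partial>lborel)"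
    by (intro nn_integral_mono mult_right_mono ennreal_leI autocorr_le) auto
  also have "\<dots> = ennreal (q2 p) * ennreal (ball_vol DIM('a) e)"
    using emeasure_cball_ball_vol[OF assms, of "0::'a"] by (simp add: nn_integral_cmult_indicator)
  also have "\<dots> = ennreal (q2 p * ball_vol DIM('a) e)"
    using ball_vol_nonneg[OF assms] by (intro ennreal_mult[symmetric]) (auto simp: q2_def)
  finally show ?thesis unfolding nn_integral_close_pair .
qed

text \<open>
  The lower bound may be negative, in which case it is truncated to \<open>0\<close> by
  \<open>ennreal\<close>; the inequality then still holds.
\<close>

lemma nn_integral_close_pair_ge:
  assumes "p \<in> H2_class \<alpha> K" "0 \<le> e" "e \<le> 1" "\<alpha> > 0"
  shows "ennreal ((q2 p - K\<^sup>2 / 2 * e powr (2 * \<alpha>)) * ball_vol DIM('a) e) \<le>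
     (\<integral>\<^sup>+x. \<integral>\<^sup>+y. ennreal (p x) * ennreal (p y) * indicator (cball x e) y \<partial>lborel \<partial>lborel)"
proof -
  have "ennreal ((q2 p - K\<^sup>2 / 2 * e powr (2 * \<alpha>)) * ball_vol DIM('a) e) \<le>
     ennreal (q2 p - K\<^sup>2 / 2 * e powr (2 * \<alpha>)) * ennreal (ball_vol DIM('a) e)"
    using measure_cball_ball_vol[OF assms(2), of "0::'a"] measure_nonneg[of lborel "cball (0::'a) e"]
    by (cases "q2 p - K\<^sup>2 / 2 * e powr (2 * \<alpha>) \<ge> 0")
       (auto simp: ennreal_mult ennreal_neg mult_nonpos_nonneg)
  also have "\<dots> = (\<integral>\<^sup>+h. ennreal (q2 p - K\<^sup>2 / 2 * e powr (2 * \<alpha>)) * indicator (cball (0::'a) e) h \<partial>lborel)"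
    using emeasure_cball_ball_vol[OF assms(2), of "0::'a"] by (simp add: nn_integral_cmult_indicator)
  also have "\<dots> \<le> (\<integral>\<^sup>+h. ennreal (autocorr h) * indicator (cball (0::'a) e) h \<partial>lborel)"
    using autocorr_ge[OF assms(1) _ assms(3,4)]
    by (intro nn_integral_mono) (simp add: ennreal_leI split: split_indicator)
  finally show ?thesis unfolding nn_integral_close_pair .
qed

lemma q2_nonneg: "q2 p \<ge> 0" by (simp add: q2_def)

lemma q2_pos:
  assumes "(LINT x|lborel. p x) = 1"
  shows "q2 p > 0"
proof (rule ccontr)
  assume "\<not> q2 p > 0"
  then have "q2 p = 0" using q2_nonneg by simp
  then have "AE x in lborel. (p x)\<^sup>2 = 0"
    unfolding q2_def using square_integrable by (subst (asm) integral_nonneg_eq_0_iff_AE) auto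
  then have "AE x in lborel. p x = 0" by simp
  then have "(LINT x|lborel. p x) = (LINT x|(lborel::'a measure). (0::real))"
    by (intro integral_cong_AE) (auto simp: measurable_p)
  also have "\<dots> = 0" by simp
  finally have "(LINT x|lborel. p x) = 0" .
  then show False using assms by simp
qed

end

lemma three_AM_GM:
  fixes a b c :: real
  assumes "0 \<le> a" "0 \<le> b" "0 \<le> c"
  shows "a * b * c \<le> (a ^ 3 + b ^ 3 + c ^ 3) / 3"
proof -
  have "0 \<le> (a + b + c) * ((a - b)\<^sup>2 + (b - c)\<^sup>2 + (c - a)\<^sup>2)"
    using assms by simp
  also have "\<dots> = 2 * (a ^ 3 + b ^ 3 + c ^ 3) - 6 * (a * b * c)"
    by (simp add: power2_eq_square power3_eq_cube algebra_simps)
  finally show ?thesis by simp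
qed

text \<open>
  The left-hand side is the integral over \<open>h\<close> and \<open>k\<close> in the ball of the
  triple correlation \<open>\<integral> p x * p (x + h) * p (x + k)\<close>. By the inequality of
  arithmetic and geometric means and translation invariance, each triple correlation is at most
  \<open>\<integral> p ^ 3\<close>.
\<close>

lemma nn_integral_ball_mass_square_le:
  fixes p :: "'a::euclidean_space \<Rightarrow> real"
  assumes [measurable]: "p \<in> borel_measurable borel" and nonneg: "\<And>x. 0 \<le> p x"
    and cube: "integrable lborel (\<lambda>x. p x ^ 3)" and e: "e \<ge> 0"
  shows "(\<integral>\<^sup>+x. ennreal (p x) * (\<integral>\<^sup>+y. ennreal (p y) * indicator (cball x e) y \<partial>lborel)\<^sup>2 \<partial>lborel)
     \<le> ennreal ((LINT x|lborel. p x ^ 3) * (ball_vol DIM('a) e)\<^sup>2)"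
proof -
  define c where "c = (LINT x|lborel. p x ^ 3)"
  define I :: "'a \<Rightarrow> ennreal" where "I = indicator (cball 0 e)"
  have [measurable]: "I \<in> borel_measurable borel" unfolding I_def by measurable
  have c: "(\<integral>\<^sup>+x. ennreal (p x ^ 3) \<partial>lborel) = ennreal c"
    unfolding c_def using cube nonneg by (intro nn_integral_eq_integral) auto
  have shift: "(\<integral>\<^sup>+y. ennreal (p y) * indicator (cball x e) y \<partial>lborel) = (\<integral>\<^sup>+h. ennreal (p (x + h)) * I h \<partial>lborel)" for x
    unfolding I_def
    by (subst nn_integral_lborel_shift[symmetric, where c = x]) (auto intro!: nn_integral_cong simp: indicator_def dist_norm)
  have I1: "(\<integral>\<^sup>+h. I h \<partial>lborel) = ennreal (ball_vol DIM('a) e)"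
    unfolding I_def using emeasure_cball_ball_vol[OF e, of "0::'a"] by simp
  have b0: "ball_vol DIM('a) e \<ge> 0"
    using measure_cball_ball_vol[OF e, of "0::'a"] measure_nonneg by metis
  have triple: "(\<integral>\<^sup>+x. ennreal (p x) * ennreal (p (x + h)) * ennreal (p (x + k)) \<partial>lborel) \<le> ennreal c" for h k
  proof -
    have "(\<integral>\<^sup>+x. ennreal (p x) * ennreal (p (x + h)) * ennreal (p (x + k)) \<partial>lborel)
       \<le> (\<integral>\<^sup>+x. ennreal (1/3) * (ennreal (p x ^ 3) + ennreal (p (h + x) ^ 3) + ennreal (p (k + x) ^ 3)) \<partial>lborel)"
      using three_AM_GM[OF nonneg nonneg nonneg] nonneg
      by (intro nn_integral_mono)
         (auto simp flip: ennreal_mult ennreal_plus intro!: ennreal_leI simp: add.commute)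
    also have "\<dots> = ennreal (1/3) * (ennreal c + ennreal c + ennreal c)"
      using nn_integral_lborel_shift[of "\<lambda>x. ennreal (p x ^ 3)" h] nn_integral_lborel_shift[of "\<lambda>x. ennreal (p x ^ 3)" k]
      by (simp add: nn_integral_cmult nn_integral_add c)
    also have "\<dots> = ennreal c"
      using nonneg by (simp flip: ennreal_mult ennreal_plus add: c_def)
    finally show ?thesis .
  qed
  have "(\<integral>\<^sup>+x. ennreal (p x) * (\<integral>\<^sup>+h. ennreal (p (x + h)) * I h \<partial>lborel)\<^sup>2 \<partial>lborel) =
    (\<integral>\<^sup>+x. \<integral>\<^sup>+h. \<integral>\<^sup>+k. ennreal (p x) * ennreal (p (x + h)) * ennreal (p (x + k)) * (I h * I k) \<partial>lborel \<partial>lborel \<partial>lborel)"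
  proof (intro nn_integral_cong)
    fix x
    define J where "J = (\<integral>\<^sup>+h. ennreal (p (x + h)) * I h \<partial>lborel)"
    have "(\<integral>\<^sup>+h. \<integral>\<^sup>+k. ennreal (p x) * ennreal (p (x + h)) * ennreal (p (x + k)) * (I h * I k) \<partial>lborel \<partial>lborel)
      = (\<integral>\<^sup>+h. \<integral>\<^sup>+k. (ennreal (p x) * (ennreal (p (x + h)) * I h)) * (ennreal (p (x + k)) * I k) \<partial>lborel \<partial>lborel)"
      by (intro nn_integral_cong) (simp only: mult_ac)
    also have "\<dots> = (\<integral>\<^sup>+h. (ennreal (p x) * (ennreal (p (x + h)) * I h)) * J \<partial>lborel)"
      unfolding J_def by (intro nn_integral_cong nn_integral_cmult) measurable
    also have "\<dots> = (\<integral>\<^sup>+h. ennreal (p x) * (ennreal (p (x + h)) * I h) \<partial>lborel) * J"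
      by (intro nn_integral_multc) measurable
    also have "(\<integral>\<^sup>+h. ennreal (p x) * (ennreal (p (x + h)) * I h) \<partial>lborel) = ennreal (p x) * J"
      unfolding J_def by (intro nn_integral_cmult) measurable
    finally show "ennreal (p x) * (\<integral>\<^sup>+h. ennreal (p (x + h)) * I h \<partial>lborel)\<^sup>2 = (\<integral>\<^sup>+h. \<integral>\<^sup>+k. ennreal (p x) * ennreal (p (x + h)) * ennreal (p (x + k)) * (I h * I k) \<partial>lborel \<partial>lborel)"
      unfolding J_def[symmetric] power2_eq_square by (simp only: mult.assoc)
  qed
  also have "\<dots> = (\<integral>\<^sup>+h. \<integral>\<^sup>+x. \<integral>\<^sup>+k. ennreal (p x) * ennreal (p (x + h)) * ennreal (p (x + k)) * (I h * I k) \<partial>lborel \<partial>lborel \<partial>lborel)"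
    by (intro nn_integral_lborel_Fubini) measurable
  also have "\<dots> = (\<integral>\<^sup>+h. \<integral>\<^sup>+k. \<integral>\<^sup>+x. ennreal (p x) * ennreal (p (x + h)) * ennreal (p (x + k)) * (I h * I k) \<partial>lborel \<partial>lborel \<partial>lborel)"
    by (intro nn_integral_cong nn_integral_lborel_Fubini) measurable
  also have "\<dots> \<le> (\<integral>\<^sup>+h. \<integral>\<^sup>+k. ennreal c * (I h * I k) \<partial>lborel \<partial>lborel)"
    by (intro nn_integral_mono) (simp add: nn_integral_multc mult_right_mono triple)
  also have "\<dots> = ennreal c * (ennreal (ball_vol DIM('a) e) * ennreal (ball_vol DIM('a) e))"
    by (simp add: nn_integral_cmult nn_integral_multc I1)
  also have "\<dots> = ennreal (c * (ball_vol DIM('a) e)\<^sup>2)"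
    using b0 nonneg by (simp add: power2_eq_square ennreal_mult c_def)
  finally show ?thesis unfolding shift c_def .
qed

section \<open>Probabilities that pairs of observations are close\<close>

lemma (in prob_space) indep_var_nn_integral:
  assumes ind: "indep_var S Y T Z" and h: "h \<in> borel_measurable (S \<Otimes>\<^sub>M T)"
  shows "(\<integral>\<^sup>+\<omega>. h (Y \<omega>, Z \<omega>) \<partial>M) = (\<integral>\<^sup>+\<omega>. (\<integral>\<^sup>+z. h (Y \<omega>, z) \<partial>distr M T Z) \<partial>M)"
proof -
  have [measurable]: "Y \<in> measurable M S" "Z \<in> measurable M T"
    using ind by (auto simp: indep_var_eq)
  note h [measurable]
  interpret Z: prob_space "distr M T Z" by (rule prob_space_distr) simp
  have "(\<integral>\<^sup>+\<omega>. h (Y \<omega>, Z \<omega>) \<partial>M) = (\<integral>\<^sup>+x. h x \<partial>distr M (S \<Otimes>\<^sub>M T) (\<lambda>\<omega>. (Y \<omega>, Z \<omega>)))"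
    by (subst nn_integral_distr) auto
  also have "distr M (S \<Otimes>\<^sub>M T) (\<lambda>\<omega>. (Y \<omega>, Z \<omega>)) = distr M S Y \<Otimes>\<^sub>M distr M T Z"
    using ind by (simp add: indep_var_distribution_eq)
  also have "(\<integral>\<^sup>+x. h x \<partial>\<dots>) = (\<integral>\<^sup>+y. (\<integral>\<^sup>+z. h (y, z) \<partial>distr M T Z) \<partial>distr M S Y)"
    by (intro Z.nn_integral_fst[symmetric]) simp
  also have "\<dots> = (\<integral>\<^sup>+\<omega>. (\<integral>\<^sup>+z. h (Y \<omega>, z) \<partial>distr M T Z) \<partial>M)"
    by (intro nn_integral_distr) auto
  finally show ?thesis .
qed

lemma ennreal_le_sqrt:
  fixes a :: ennreal
  assumes "a\<^sup>2 \<le> ennreal c" "c \<ge> 0"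
  shows "a \<le> ennreal (sqrt c)"
proof (cases a)
  case (real r)
  with assms have "r\<^sup>2 \<le> c" by (simp add: ennreal_power)
  then show ?thesis using real by (auto intro!: ennreal_leI real_le_rsqrt)
qed (use assms in \<open>auto simp: power2_eq_square top_unique\<close>)

locale stationary_m_dependent = prob_space M
  for M :: "'w measure" and X :: "nat \<Rightarrow> 'w \<Rightarrow> 'a::euclidean_space"
    and p :: "'a \<Rightarrow> real" and m :: nat +
  assumes stationary: "strictly_stationary M X"
    and m_dep: "m_dependent M m X"
    and density: "\<And>i. i \<ge> 1 \<Longrightarrow> has_density M (X i) p"
    and cube_integrable: "integrable lborel (\<lambda>x. \<bar>p x\<bar> ^ 3)"
begin

lemma X_measurable: "i \<ge> 1 \<Longrightarrow> X i \<in> borel_measurable M"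
  using density[of i] by (simp add: has_density_def distributed_def)

lemma p_nonneg: "0 \<le> p x"
  using density[of 1] by (simp add: has_density_def)

lemma p_measurable [measurable]: "p \<in> borel_measurable borel"
proof -
  have "(\<lambda>x. ennreal (p x)) \<in> borel_measurable borel"
    using density[of 1] by (auto simp: has_density_def distributed_def)
  then have "(\<lambda>x. enn2real (ennreal (p x))) \<in> borel_measurable borel" by measurable
  then show ?thesis by (simp add: p_nonneg)
qed

lemma distr_X: "i \<ge> 1 \<Longrightarrow> distr M borel (X i) = density lborel p"
  using density[of i] by (auto simp: has_density_def distributed_def cong: distr_cong)

lemma nn_integral_X:
  assumes "i \<ge> 1" "h \<in> borel_measurable borel"
  shows "(\<integral>\<^sup>+\<omega>. h (X i \<omega>) \<partial>M) = (\<integral>\<^sup>+x. ennreal (p x) * h x \<partial>lborel)"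
proof -
  have "(\<integral>\<^sup>+\<omega>. h (X i \<omega>) \<partial>M) = (\<integral>\<^sup>+x. h x \<partial>distr M borel (X i))"
    using X_measurable assms by (simp add: nn_integral_distr)
  also have "\<dots> = (\<integral>\<^sup>+x. ennreal (p x) * h x \<partial>lborel)"
    unfolding distr_X[OF assms(1)] using assms by (intro nn_integral_density) auto
  finally show ?thesis .
qed

lemma p_has_integral: "has_bochner_integral lborel p 1"
proof (rule has_bochner_integral_nn_integral)
  show "(\<integral>\<^sup>+x. ennreal (p x) \<partial>lborel) = ennreal 1"
    using nn_integral_X[of 1 "\<lambda>_. 1"] by (simp add: emeasure_space_1)
qed (auto simp: p_nonneg)

lemma L2_density: "L2_density p"
  using p_has_integral p_nonneg cube_integrable
  by unfold_locales (auto intro!: square_integrable_of_cube simp: has_bochner_integral_iff)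

sublocale L2_density p by (rule L2_density)

lemma q2_positive: "q2 p > 0"
  using p_has_integral by (intro q2_pos) (simp add: has_bochner_integral_iff)

definition near :: "nat \<Rightarrow> nat \<Rightarrow> bool" where
  "near i j \<longleftrightarrow> i \<le> j + m \<and> j \<le> i + m"

lemma indep_separated_vectors:
  assumes "finite A" "A \<subseteq> {1..}" "finite B" "B \<subseteq> {1..}"
    and "\<And>a b. a \<in> A \<Longrightarrow> b \<in> B \<Longrightarrow> \<not> near a b"
  shows "indep_var (PiM A (\<lambda>_. borel)) (\<lambda>\<omega>. \<lambda>i\<in>A. X i \<omega>) (PiM B (\<lambda>_. borel)) (\<lambda>\<omega>. \<lambda>i\<in>B. X i \<omega>)"
  using assms unfolding near_def
  by (intro m_dependent_indep_separated[OF m_dep X_measurable]) force+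

text \<open>
  An observation far from all indices of \<open>A\<close> can be integrated out against the density
  \<open>p\<close>. The function \<open>f\<close> selects the coordinates that are kept.
\<close>

lemma nn_integral_indep_coordinate:
  assumes A: "finite A" "A \<subseteq> {1..}" and j: "j \<ge> 1" "\<And>a. a \<in> A \<Longrightarrow> \<not> near a j"
    and f: "f \<in> measurable (PiM A (\<lambda>_. borel)) S" and h: "h \<in> borel_measurable (S \<Otimes>\<^sub>M borel)"
  shows "(\<integral>\<^sup>+\<omega>. h (f (\<lambda>i\<in>A. X i \<omega>), X j \<omega>) \<partial>M) =
    (\<integral>\<^sup>+\<omega>. (\<integral>\<^sup>+y. ennreal (p y) * h (f (\<lambda>i\<in>A. X i \<omega>), y) \<partial>lborel) \<partial>M)"
proof -
  let ?XA = "\<lambda>\<omega>. \<lambda>i\<in>A. X i \<omega>" and ?Xj = "\<lambda>\<omega>. \<lambda>i\<in>{j}. X i \<omega>"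
  note f [measurable] h [measurable]
  have ind: "indep_var (PiM A (\<lambda>_. borel)) ?XA (PiM {j} (\<lambda>_. borel)) ?Xj"
    using A j by (intro indep_separated_vectors) auto
  have Xj: "?Xj \<in> measurable M (PiM {j} (\<lambda>_. borel))"
    using j by (intro measurable_restrict X_measurable) auto
  have XA: "?XA \<in> measurable M (PiM A (\<lambda>_. borel))"
    using A by (intro measurable_restrict X_measurable) auto
  have "(\<integral>\<^sup>+\<omega>. h (f (?XA \<omega>), X j \<omega>) \<partial>M) = (\<integral>\<^sup>+\<omega>. (\<lambda>(x, y). h (f x, y j)) (?XA \<omega>, ?Xj \<omega>) \<partial>M)"
    by simp
  also have "\<dots> = (\<integral>\<^sup>+\<omega>. (\<integral>\<^sup>+y. (\<lambda>(x, y). h (f x, y j)) (?XA \<omega>, y) \<partial>distr M (PiM {j} (\<lambda>_. borel)) ?Xj) \<partial>M)"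
    by (intro indep_var_nn_integral[OF ind]) measurable
  also have "\<dots> = (\<integral>\<^sup>+\<omega>. (\<integral>\<^sup>+y. ennreal (p y) * h (f (?XA \<omega>), y) \<partial>lborel) \<partial>M)"
  proof (intro nn_integral_cong)
    fix \<omega> assume "\<omega> \<in> space M"
    then have [simp]: "f (?XA \<omega>) \<in> space S"
      using measurable_space[OF f measurable_space[OF XA]] by auto
    have [measurable]: "(\<lambda>y. h (f (?XA \<omega>), y)) \<in> borel_measurable borel"
      by measurable
    have "(\<integral>\<^sup>+y. (\<lambda>(x, y). h (f x, y j)) (?XA \<omega>, y) \<partial>distr M (PiM {j} (\<lambda>_. borel)) ?Xj) =
       (\<integral>\<^sup>+\<omega>'. h (f (?XA \<omega>), X j \<omega>') \<partial>M)"
      using Xj by (subst nn_integral_distr) auto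
    also have "\<dots> = (\<integral>\<^sup>+y. ennreal (p y) * h (f (?XA \<omega>), y) \<partial>lborel)"
      using j by (intro nn_integral_X) auto
    finally show "(\<integral>\<^sup>+y. (\<lambda>(x, y). h (f x, y j)) (?XA \<omega>, y) \<partial>distr M (PiM {j} (\<lambda>_. borel)) ?Xj) =
      (\<integral>\<^sup>+y. ennreal (p y) * h (f (?XA \<omega>), y) \<partial>lborel)" .
  qed
  finally show ?thesis .
qed

definition close_prob :: "real \<Rightarrow> nat \<Rightarrow> nat \<Rightarrow> real" where
  "close_prob e i j = prob {\<omega> \<in> space M. norm (X i \<omega> - X j \<omega>) \<le> e}"

definition both_close_prob :: "real \<Rightarrow> nat \<Rightarrow> nat \<Rightarrow> nat \<Rightarrow> nat \<Rightarrow> real" where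
  "both_close_prob e i j k l =
     prob {\<omega> \<in> space M. norm (X i \<omega> - X j \<omega>) \<le> e \<and> norm (X k \<omega> - X l \<omega>) \<le> e}"

lemma close_event [measurable]:
  assumes "i \<ge> 1" "j \<ge> 1"
  shows "{\<omega> \<in> space M. norm (X i \<omega> - X j \<omega>) \<le> e} \<in> events"
proof -
  note [measurable] = X_measurable[OF assms(1)] X_measurable[OF assms(2)]
  show ?thesis by measurable
qed

lemma both_close_event [measurable]:
  assumes "i \<ge> 1" "j \<ge> 1" "k \<ge> 1" "l \<ge> 1"
  shows "{\<omega> \<in> space M. norm (X i \<omega> - X j \<omega>) \<le> e \<and> norm (X k \<omega> - X l \<omega>) \<le> e} \<in> events"
proof -
  note [measurable] = X_measurable[OF assms(1)] X_measurable[OF assms(2)]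
    X_measurable[OF assms(3)] X_measurable[OF assms(4)]
  show ?thesis by measurable
qed

lemma both_close_prob_factor:
  assumes "i \<ge> 1" "j \<ge> 1" "k \<ge> 1" "l \<ge> 1"
    and "\<not> near i k" "\<not> near i l" "\<not> near j k" "\<not> near j l"
  shows "both_close_prob e i j k l = close_prob e i j * close_prob e k l"
proof -
  have ind: "indep_var borel (\<lambda>\<omega>. norm (X i \<omega> - X j \<omega>)) borel (\<lambda>\<omega>. norm (X k \<omega> - X l \<omega>))"
  proof -
    have "indep_var (PiM {i, j} (\<lambda>_. borel)) (\<lambda>\<omega>. \<lambda>i\<in>{i, j}. X i \<omega>) (PiM {k, l} (\<lambda>_. borel)) (\<lambda>\<omega>. \<lambda>i\<in>{k, l}. X i \<omega>)"
      using assms by (intro indep_separated_vectors) auto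
    from indep_var_compose[OF this, of "\<lambda>x. norm (x i - x j)" borel "\<lambda>x. norm (x k - x l)" borel]
    show ?thesis by (simp add: comp_def)
  qed
  have "prob (((\<lambda>\<omega>. norm (X i \<omega> - X j \<omega>)) -` {..e} \<inter> space M) \<inter> ((\<lambda>\<omega>. norm (X k \<omega> - X l \<omega>)) -` {..e} \<inter> space M))
     = prob ((\<lambda>\<omega>. norm (X i \<omega> - X j \<omega>)) -` {..e} \<inter> space M) * prob ((\<lambda>\<omega>. norm (X k \<omega> - X l \<omega>)) -` {..e} \<inter> space M)"
    by (rule indep_var_prob_Int[OF ind]) auto
  then show ?thesis
    unfolding both_close_prob_def close_prob_def by (simp add: vimage_def Int_def conj_ac)
qed

lemma close_prob_shift:
  assumes "i \<ge> 1" "j \<ge> 1"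
  shows "close_prob e (i + h) (j + h) = close_prob e i j"
proof -
  let ?J = "{i, j}"
  let ?D = "{f \<in> space (PiM ?J (\<lambda>_. borel :: 'a measure)). norm (f i - f j) \<le> e}"
  have D: "?D \<in> sets (PiM ?J (\<lambda>_. borel))" by measurable
  have *: "measure (distr M (PiM ?J (\<lambda>_. borel)) (\<lambda>\<omega>. \<lambda>a\<in>?J. X (a + h) \<omega>)) ?D = close_prob e (i + h) (j + h)" for h
  proof -
    have "(\<lambda>\<omega>. \<lambda>a\<in>?J. X (a + h) \<omega>) \<in> measurable M (PiM ?J (\<lambda>_. borel))"
      using assms by (intro measurable_restrict X_measurable) auto
    then have "measure (distr M (PiM ?J (\<lambda>_. borel)) (\<lambda>\<omega>. \<lambda>a\<in>?J. X (a + h) \<omega>)) ?D =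
       prob ((\<lambda>\<omega>. \<lambda>a\<in>?J. X (a + h) \<omega>) -` ?D \<inter> space M)"
      using D by (rule measure_distr)
    also have "(\<lambda>\<omega>. \<lambda>a\<in>?J. X (a + h) \<omega>) -` ?D \<inter> space M = {\<omega> \<in> space M. norm (X (i + h) \<omega> - X (j + h) \<omega>) \<le> e}"
      by (auto simp: space_PiM)
    finally show ?thesis unfolding close_prob_def .
  qed
  have "distr M (PiM ?J (\<lambda>_. borel)) (\<lambda>\<omega>. \<lambda>a\<in>?J. X (a + h) \<omega>) = distr M (PiM ?J (\<lambda>_. borel)) (\<lambda>\<omega>. \<lambda>a\<in>?J. X a \<omega>)"
    using assms by (intro stationary[unfolded strictly_stationary_def, rule_format]) auto
  then have "close_prob e (i + h) (j + h) = close_prob e (i + 0) (j + 0)"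
    unfolding *[symmetric] by (simp only: add_0_right)
  then show ?thesis by (simp only: add_0_right)
qed

lemma close_prob_commute: "close_prob e i j = close_prob e j i"
  by (simp add: close_prob_def norm_minus_commute)

definition ball_mass :: "real \<Rightarrow> 'a \<Rightarrow> ennreal" where
  "ball_mass e x = (\<integral>\<^sup>+y. ennreal (p y) * indicator (cball x e) y \<partial>lborel)"

lemma ball_mass_measurable [measurable]: "ball_mass e \<in> borel_measurable borel"
  unfolding ball_mass_def by measurable

lemma close_prob_far_eq:
  assumes "i \<ge> 1" "j \<ge> 1" "\<not> near i j"
  shows "ennreal (close_prob e i j) =
    (\<integral>\<^sup>+x. \<integral>\<^sup>+y. ennreal (p x) * ennreal (p y) * indicator (cball x e) y \<partial>lborel \<partial>lborel)"
proof -
  have "ennreal (close_prob e i j) = emeasure M {\<omega> \<in> space M. norm (X i \<omega> - X j \<omega>) \<le> e}"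
    by (simp add: close_prob_def emeasure_eq_measure)
  also have "\<dots> = (\<integral>\<^sup>+\<omega>. indicator {\<omega> \<in> space M. norm (X i \<omega> - X j \<omega>) \<le> e} \<omega> \<partial>M)"
    using close_event[OF assms(1,2), of e] by (rule nn_integral_indicator[symmetric])
  also have "\<dots> = (\<integral>\<^sup>+\<omega>. (\<lambda>(x, y). indicator (cball x e) y) ((\<lambda>x. x i) (\<lambda>i\<in>{i}. X i \<omega>), X j \<omega>) \<partial>M)"
    by (intro nn_integral_cong) (simp add: indicator_def dist_norm)
  also have "\<dots> = (\<integral>\<^sup>+\<omega>. ball_mass e (X i \<omega>) \<partial>M)"
    using assms by (subst nn_integral_indep_coordinate[where S = borel]) (auto simp: ball_mass_def)
  also have "\<dots> = (\<integral>\<^sup>+x. ennreal (p x) * ball_mass e x \<partial>lborel)"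
    using assms by (intro nn_integral_X) auto
  also have "\<dots> = (\<integral>\<^sup>+x. \<integral>\<^sup>+y. ennreal (p x) * ennreal (p y) * indicator (cball x e) y \<partial>lborel \<partial>lborel)"
    unfolding ball_mass_def by (intro nn_integral_cong) (simp add: nn_integral_cmult mult.assoc)
  finally show ?thesis .
qed

lemma close_prob_far_le:
  assumes "i \<ge> 1" "j \<ge> 1" "\<not> near i j" "e \<ge> 0"
  shows "close_prob e i j \<le> q2 p * ball_vol DIM('a) e"
proof -
  have "ennreal (close_prob e i j) \<le> ennreal (q2 p * ball_vol DIM('a) e)"
    unfolding close_prob_far_eq[OF assms(1-3)] by (rule nn_integral_close_pair_le[OF assms(4)])
  then show ?thesis
    using ball_vol_nonneg[OF assms(4), where 'a='a] q2_nonneg by (subst (asm) ennreal_le_iff) auto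
qed

lemma close_prob_far_ge:
  assumes "i \<ge> 1" "j \<ge> 1" "\<not> near i j" "0 \<le> e" "e \<le> 1" "p \<in> H2_class \<alpha> K" "\<alpha> > 0"
  shows "(q2 p - K\<^sup>2 / 2 * e powr (2 * \<alpha>)) * ball_vol DIM('a) e \<le> close_prob e i j"
proof -
  have "ennreal ((q2 p - K\<^sup>2 / 2 * e powr (2 * \<alpha>)) * ball_vol DIM('a) e) \<le> ennreal (close_prob e i j)"
    unfolding close_prob_far_eq[OF assms(1-3)] using assms by (intro nn_integral_close_pair_ge) auto
  then show ?thesis
    by (subst (asm) ennreal_le_iff) (auto simp: close_prob_def)
qed

text \<open>
  Integrating out \<open>X j\<close> and then \<open>X l\<close> leaves the expectation of the
  product of the ball masses at \<open>X i\<close> and \<open>X k\<close>. Their joint law is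
  unknown, because \<open>i\<close> and \<open>k\<close> may be near, but the Cauchy--Schwarz
  inequality reduces it to the marginal law.
\<close>

lemma both_close_prob_isolated_le:
  assumes "i \<ge> 1" "j \<ge> 1" "k \<ge> 1" "l \<ge> 1"
    and "\<not> near j i" "\<not> near j k" "\<not> near j l" "\<not> near l i" "\<not> near l k" "e \<ge> 0"
  shows "both_close_prob e i j k l \<le> (LINT x|lborel. p x ^ 3) * (ball_vol DIM('a) e)\<^sup>2"
proof -
  define c where "c = (LINT x|lborel. p x ^ 3) * (ball_vol DIM('a) e)\<^sup>2"
  note [measurable] = X_measurable[OF assms(1)] X_measurable[OF assms(2)] X_measurable[OF assms(3)] X_measurable[OF assms(4)]
  have c0: "c \<ge> 0" unfolding c_def by (simp add: p_nonneg)
  define h1 where "h1 = (\<lambda>u :: ('a \<times> 'a \<times> 'a) \<times> 'a.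
    indicator (cball (fst (fst u)) e) (snd u) * indicator (cball (fst (snd (fst u))) e) (snd (snd (fst u))) :: ennreal)"
  define h2 where "h2 = (\<lambda>u :: ('a \<times> 'a) \<times> 'a. ball_mass e (fst (fst u)) * indicator (cball (snd (fst u)) e) (snd u))"
  define f1 where "f1 = (\<lambda>x :: nat \<Rightarrow> 'a. (x i, x k, x l))"
  define f2 where "f2 = (\<lambda>x :: nat \<Rightarrow> 'a. (x i, x k))"
  have h1: "h1 \<in> borel_measurable ((borel \<Otimes>\<^sub>M (borel \<Otimes>\<^sub>M borel)) \<Otimes>\<^sub>M borel)"
    unfolding h1_def by measurable
  have h2: "h2 \<in> borel_measurable ((borel \<Otimes>\<^sub>M borel) \<Otimes>\<^sub>M borel)"
    unfolding h2_def by measurable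
  have f1: "f1 \<in> measurable (PiM {i, k, l} (\<lambda>_. borel)) (borel \<Otimes>\<^sub>M (borel \<Otimes>\<^sub>M borel))"
    unfolding f1_def by measurable
  have f2: "f2 \<in> measurable (PiM {i, k} (\<lambda>_. borel)) (borel \<Otimes>\<^sub>M borel)"
    unfolding f2_def by measurable
  have far: "\<not> near i j" "\<not> near k j" "\<not> near l j" "\<not> near i l" "\<not> near k l"
    using assms by (auto simp: near_def)
  have "ennreal (both_close_prob e i j k l) = emeasure M {\<omega> \<in> space M. norm (X i \<omega> - X j \<omega>) \<le> e \<and> norm (X k \<omega> - X l \<omega>) \<le> e}"
    by (simp add: both_close_prob_def emeasure_eq_measure)
  also have "\<dots> = (\<integral>\<^sup>+\<omega>. indicator {\<omega> \<in> space M. norm (X i \<omega> - X j \<omega>) \<le> e \<and> norm (X k \<omega> - X l \<omega>) \<le> e} \<omega> \<partial>M)"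
    using both_close_event[OF assms(1-4), of e] by (rule nn_integral_indicator[symmetric])
  also have "\<dots> = (\<integral>\<^sup>+\<omega>. h1 (f1 (\<lambda>a\<in>{i, k, l}. X a \<omega>), X j \<omega>) \<partial>M)"
    by (intro nn_integral_cong) (simp add: h1_def f1_def indicator_def dist_norm)
  also have "\<dots> = (\<integral>\<^sup>+\<omega>. \<integral>\<^sup>+y. ennreal (p y) * h1 (f1 (\<lambda>a\<in>{i, k, l}. X a \<omega>), y) \<partial>lborel \<partial>M)"
    by (rule nn_integral_indep_coordinate[OF _ _ _ _ f1 h1]) (use assms far in auto)
  also have "\<dots> = (\<integral>\<^sup>+\<omega>. ball_mass e (X i \<omega>) * indicator (cball (X k \<omega>) e) (X l \<omega>) \<partial>M)"
    unfolding ball_mass_def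
    by (intro nn_integral_cong, subst nn_integral_multc[symmetric]) (auto simp: h1_def f1_def mult.assoc)
  also have "\<dots> = (\<integral>\<^sup>+\<omega>. h2 (f2 (\<lambda>a\<in>{i, k}. X a \<omega>), X l \<omega>) \<partial>M)"
    by (simp add: h2_def f2_def)
  also have "\<dots> = (\<integral>\<^sup>+\<omega>. \<integral>\<^sup>+y. ennreal (p y) * h2 (f2 (\<lambda>a\<in>{i, k}. X a \<omega>), y) \<partial>lborel \<partial>M)"
    by (rule nn_integral_indep_coordinate[OF _ _ _ _ f2 h2]) (use assms far in auto)
  also have "\<dots> = (\<integral>\<^sup>+\<omega>. ball_mass e (X i \<omega>) * ball_mass e (X k \<omega>) \<partial>M)"
  proof (intro nn_integral_cong)
    fix \<omega>
    have "(\<integral>\<^sup>+y. ennreal (p y) * (c * indicator (cball x e) y) \<partial>lborel) = c * ball_mass e x" for c x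
      unfolding ball_mass_def by (subst nn_integral_cmult[symmetric]) (auto intro!: nn_integral_cong simp: mult_ac)
    then show "(\<integral>\<^sup>+y. ennreal (p y) * h2 (f2 (\<lambda>a\<in>{i, k}. X a \<omega>), y) \<partial>lborel) = ball_mass e (X i \<omega>) * ball_mass e (X k \<omega>)"
      by (simp add: h2_def f2_def)
  qed
  finally have eq: "ennreal (both_close_prob e i j k l) = (\<integral>\<^sup>+\<omega>. ball_mass e (X i \<omega>) * ball_mass e (X k \<omega>) \<partial>M)" .
  have sq: "(\<integral>\<^sup>+\<omega>. (ball_mass e (X a \<omega>))\<^sup>2 \<partial>M) \<le> ennreal c" if "a \<ge> 1" for a
  proof -
    have "(\<integral>\<^sup>+\<omega>. (ball_mass e (X a \<omega>))\<^sup>2 \<partial>M) = (\<integral>\<^sup>+x. ennreal (p x) * (ball_mass e x)\<^sup>2 \<partial>lborel)"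
      using that by (intro nn_integral_X) auto
    also have "\<dots> \<le> ennreal c"
      unfolding ball_mass_def c_def using cube_integrable assms
      by (intro nn_integral_ball_mass_square_le) (auto simp: p_nonneg)
    finally show ?thesis .
  qed
  have "(ennreal (both_close_prob e i j k l))\<^sup>2 \<le> ennreal c * ennreal c"
    unfolding eq using sq assms
    by (intro order_trans[OF Cauchy_Schwarz_nn_integral] mult_mono) auto
  also have "\<dots> = ennreal (c\<^sup>2)" using c0 by (simp add: power2_eq_square ennreal_mult)
  finally have "ennreal (both_close_prob e i j k l) \<le> ennreal (sqrt (c\<^sup>2))"
    by (rule ennreal_le_sqrt) simp
  then show ?thesis using c0 by (simp add: c_def)
qed

end

section \<open>Close pairs at small lags\<close>

lemma borel_measurable_fst_snd [measurable (raw)]: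
  fixes f :: "'c \<Rightarrow> 'a::second_countable_topology \<times> 'b::second_countable_topology"
  assumes "f \<in> borel_measurable M"
  shows "(\<lambda>x. fst (f x)) \<in> borel_measurable M" "(\<lambda>x. snd (f x)) \<in> borel_measurable M"
  by (rule measurable_compose[OF assms], rule borel_measurable_continuous_onI,
      auto intro!: continuous_on_fst continuous_on_snd continuous_on_id)+

lemma nn_integral_lborel_pair:
  fixes h :: "'a::euclidean_space \<times> 'b::euclidean_space \<Rightarrow> ennreal"
  assumes "h \<in> borel_measurable borel"
  shows "(\<integral>\<^sup>+u. h u \<partial>lborel) = (\<integral>\<^sup>+x. \<integral>\<^sup>+y. h (x, y) \<partial>lborel \<partial>lborel)"
  using lborel.nn_integral_fst[of h lborel] assms by (simp add: lborel_prod)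

context stationary_m_dependent begin

text \<open>
  Assumption \<open>\<A>\<close> does not bound the density of a single near pair. Take a second
  copy of the pair, shifted so far that it is independent of the first one; by stationarity, the
  probability that both are close is the square of the probability in question. It is the integral
  of the joint density of the four observations over \<open>(x\<^sub>1, x\<^sub>2)\<close> and over
  \<open>(x\<^sub>3, x\<^sub>4)\<close> in the product of the balls around \<open>x\<^sub>1\<close> and \<open>x\<^sub>2\<close>. By the
  Cauchy--Schwarz inequality in \<open>(x\<^sub>3, x\<^sub>4)\<close> it is at most the ball volume
  times the integral of the root of the square integral of the density over shrinking sets, which
  tends to \<open>0\<close> by dominated convergence.
\<close>

lemma near_close_prob_smallo:
  fixes \<epsilon> :: "nat \<Rightarrow> real"
  assumes A: "assumption_A M X p" and k: "k \<ge> 1"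
    and pos: "\<And>n. n \<ge> 1 \<Longrightarrow> \<epsilon> n > 0" and lim: "\<epsilon> \<longlonglongrightarrow> 0"
  shows "(\<lambda>n. close_prob (\<epsilon> n) 1 (1 + k)) \<in> o(\<lambda>n. \<epsilon> n powr (DIM('a) / 2))"
proof -
  \<comment> \<open>The least shift for which the two pairs are not near each other.\<close>
  define T where "T = k + m + 1"
  have dist: "distinct [1, 1 + T, 1 + k, 1 + k + T]" using k by (auto simp: T_def)
  obtain f :: "'a \<times> 'a \<times> 'a \<times> 'a \<Rightarrow> real" where
    dens: "has_density M (\<lambda>\<omega>. (X 1 \<omega>, X (1 + T) \<omega>, X (1 + k) \<omega>, X (1 + k + T) \<omega>)) f"
    and sq: "AE (x1, x2) in lborel. integrable lborel (\<lambda>(x3, x4). (f (x1, x2, x3, x4))\<^sup>2)"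
    and g: "integrable lborel (\<lambda>(x1, x2). sqrt (LINT (x3, x4)|lborel. (f (x1, x2, x3, x4))\<^sup>2))"
  proof -
    have "1 \<le> (1::nat)" "1 \<le> 1 + T" "1 \<le> 1 + k" "1 \<le> 1 + k + T" by simp_all
    then show thesis
      using A dist that unfolding assumption_A_def by blast
  qed
  have f0: "0 \<le> f z" for z using dens unfolding has_density_def by blast
  have fm: "f \<in> borel_measurable borel"
  proof -
    have "(\<lambda>x. ennreal (f x)) \<in> borel_measurable borel"
      using dens by (auto simp: has_density_def distributed_def)
    then have "(\<lambda>x. enn2real (ennreal (f x))) \<in> borel_measurable borel" by measurable
    then show ?thesis by (simp add: f0)
  qed
  note fm [measurable]
  \<comment> \<open>The first members \<open>w\<close> of the two pairs are separated from the second members \<open>z\<close>, to integrate over \<open>z\<close> first.\<close>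
  define \<phi> where "\<phi> w z = f (fst w, snd w, fst z, snd z)" for w z :: "'a \<times> 'a"
  define D where "D n w = cball (fst w) (\<epsilon> n) \<times> cball (snd w) (\<epsilon> n)" for n and w :: "'a \<times> 'a"
  define S where "S n w = (LINT z|lborel. (\<phi> w z)\<^sup>2 * indicator (D n w) z)" for n w
  define b where "b n = ball_vol DIM('a) (\<epsilon> n)" for n
  have sq': "AE w in lborel. integrable lborel (\<lambda>z. (\<phi> w z)\<^sup>2)"
    using sq by (simp add: \<phi>_def case_prod_unfold)
  have g': "integrable lborel (\<lambda>w. sqrt (LINT z|lborel. (\<phi> w z)\<^sup>2))"
    using g by (simp add: \<phi>_def case_prod_unfold)
  have ind_eq: "indicator (D n w) z = (of_bool (dist (fst w) (fst z) \<le> \<epsilon> n \<and> dist (snd w) (snd z) \<le> \<epsilon> n) :: real)" for n w z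
    by (cases z) (auto simp: D_def indicator_def)
  have m1: "(\<lambda>u. (\<phi> (fst u) (snd u))\<^sup>2 * indicator (D n (fst u)) (snd u)) \<in> borel_measurable borel" for n
    unfolding ind_eq \<phi>_def by measurable
  have m2 [measurable]: "\<phi> w \<in> borel_measurable borel" for w
    unfolding \<phi>_def by measurable
  have m3 [measurable]: "(\<lambda>z. indicator (D n w) z :: real) \<in> borel_measurable borel" for n w
    unfolding ind_eq by measurable
  have m4 [measurable]: "S n \<in> borel_measurable borel" for n
    unfolding S_def using lborel.borel_measurable_lebesgue_integral[of "\<lambda>w z. (\<phi> w z)\<^sup>2 * indicator (D n w) z" lborel] m1[of n]
    by (simp add: lborel_prod case_prod_unfold)
  have m5: "(\<lambda>u. ennreal (\<phi> (fst u) (snd u)) * indicator (D n (fst u)) (snd u)) \<in> borel_measurable borel" for n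
  proof -
    have "(\<lambda>u. ennreal (\<phi> (fst u) (snd u) * indicator (D n (fst u)) (snd u))) \<in> borel_measurable borel"
      unfolding ind_eq \<phi>_def by measurable
    moreover have "ennreal (\<phi> (fst u) (snd u) * indicator (D n (fst u)) (snd u)) =
        ennreal (\<phi> (fst u) (snd u)) * indicator (D n (fst u)) (snd u)" for u
      by (cases "snd u \<in> D n (fst u)") auto
    ultimately show ?thesis by simp
  qed
  have S0: "S n w \<ge> 0" for n w unfolding S_def by (intro integral_nonneg_AE) auto
  have Sint: "integrable lborel (\<lambda>z. (\<phi> w z)\<^sup>2 * indicator (D n w) z)" if "integrable lborel (\<lambda>z. (\<phi> w z)\<^sup>2)" for n w
    by (rule Bochner_Integration.integrable_bound[OF that]) (auto split: split_indicator)
  have Sle: "S n w \<le> (LINT z|lborel. (\<phi> w z)\<^sup>2)" if "integrable lborel (\<lambda>z. (\<phi> w z)\<^sup>2)" for n w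
    unfolding S_def by (intro integral_mono Sint that) (auto simp: indicator_def)
  have Slim: "(\<lambda>n. S n w) \<longlonglongrightarrow> 0" if "integrable lborel (\<lambda>z. (\<phi> w z)\<^sup>2)" for w
  proof -
    have "(\<lambda>n. S n w) \<longlonglongrightarrow> (LINT z|(lborel::('a \<times> 'a) measure). (0::real))"
      unfolding S_def
    proof (rule integral_dominated_convergence[OF _ _ that])
      show "AE z in lborel. (\<lambda>n. (\<phi> w z)\<^sup>2 * indicator (D n w) z) \<longlonglongrightarrow> 0"
        \<comment> \<open>The sets \<open>D n w\<close> shrink to the single point \<open>w\<close>.\<close>
        using AE_lborel_singleton[of w]
      proof eventually_elim
        case (elim z)
        then have "dist (fst w) (fst z) > 0 \<or> dist (snd w) (snd z) > 0"
          by (auto simp: prod_eq_iff)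
        then have "\<forall>\<^sub>F n in sequentially. \<epsilon> n < dist (fst w) (fst z) \<or> \<epsilon> n < dist (snd w) (snd z)"
        proof
          assume "dist (fst w) (fst z) > 0"
          from order_tendstoD(2)[OF lim this] show ?thesis by eventually_elim simp
        next
          assume "dist (snd w) (snd z) > 0"
          from order_tendstoD(2)[OF lim this] show ?thesis by eventually_elim simp
        qed
        then have "\<forall>\<^sub>F n in sequentially. (\<phi> w z)\<^sup>2 * indicator (D n w) z = 0"
          by eventually_elim (auto simp: ind_eq)
        then show ?case by (rule tendsto_eventually)
      qed
    qed (auto split: split_indicator)
    then show ?thesis by simp
  qed
  have bnd: "AE w in lborel. norm (sqrt (S n w)) \<le> sqrt (LINT z|lborel. (\<phi> w z)\<^sup>2)" for n
    using sq' by eventually_elim (auto simp: S0 Sle)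
  have intlim: "(\<lambda>n. LINT w|lborel. sqrt (S n w)) \<longlonglongrightarrow> 0"
  proof -
    have "(\<lambda>n. LINT w|lborel. sqrt (S n w)) \<longlonglongrightarrow> (LINT w|(lborel::('a \<times> 'a) measure). (0::real))"
    proof (rule integral_dominated_convergence[OF _ _ g' _ bnd])
      show "AE w in lborel. (\<lambda>n. sqrt (S n w)) \<longlonglongrightarrow> 0"
        using sq' by eventually_elim (use tendsto_real_sqrt[OF Slim] in auto)
    qed auto
    then show ?thesis by simp
  qed
  have sqrtint: "integrable lborel (\<lambda>w. sqrt (S n w))" for n
    by (rule Bochner_Integration.integrable_bound[OF g']) (use bnd[of n] S0 in \<open>auto elim: AE_mp\<close>)
  have bound: "both_close_prob (\<epsilon> n) 1 (1 + k) (1 + T) (1 + k + T) \<le> (LINT w|lborel. sqrt (S n w)) * b n" if n: "n \<ge> 1" for n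
  proof -
    let ?Y = "\<lambda>\<omega>. (X 1 \<omega>, X (1 + T) \<omega>, X (1 + k) \<omega>, X (1 + k + T) \<omega>)"
    let ?E = "{\<omega> \<in> space M. norm (X 1 \<omega> - X (1 + k) \<omega>) \<le> \<epsilon> n \<and> norm (X (1 + T) \<omega> - X (1 + k + T) \<omega>) \<le> \<epsilon> n}"
    define H :: "'a \<times> 'a \<times> 'a \<times> 'a \<Rightarrow> ennreal" where
      "H u = indicator (D n (fst u, fst (snd u))) (snd (snd u))" for u
    have b0: "b n \<ge> 0" using pos[OF n] unfolding b_def by (intro ball_vol_nonneg) simp
    have Hm [measurable]: "H \<in> borel_measurable borel"
    proof -
      have "H = (\<lambda>u. ennreal (indicator (D n (fst u, fst (snd u))) (snd (snd u))))"
        unfolding H_def by (simp add: fun_eq_iff ennreal_indicator)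
      also have "\<dots> \<in> borel_measurable borel" unfolding ind_eq by measurable
      finally show ?thesis .
    qed
    have "ennreal (both_close_prob (\<epsilon> n) 1 (1 + k) (1 + T) (1 + k + T)) = emeasure M ?E"
      by (simp add: both_close_prob_def emeasure_eq_measure)
    also have "\<dots> = (\<integral>\<^sup>+\<omega>. indicator ?E \<omega> \<partial>M)"
      by (rule nn_integral_indicator[symmetric], rule both_close_event) auto
    also have "\<dots> = (\<integral>\<^sup>+\<omega>. H (?Y \<omega>) \<partial>M)"
      by (intro nn_integral_cong) (simp add: H_def D_def indicator_def dist_norm)
    also have "\<dots> = (\<integral>\<^sup>+u. ennreal (f u) * H u \<partial>lborel)"
      using dens Hm unfolding has_density_def by (intro distributed_nn_integral[symmetric]) auto
    also have "\<dots> = (\<integral>\<^sup>+x. \<integral>\<^sup>+y. \<integral>\<^sup>+z. ennreal (f (x, y, z)) * H (x, y, z) \<partial>lborel \<partial>lborel \<partial>lborel)"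
    proof (subst nn_integral_lborel_pair)
      show "(\<integral>\<^sup>+x. \<integral>\<^sup>+r. ennreal (f (x, r)) * H (x, r) \<partial>lborel \<partial>lborel) = 
        (\<integral>\<^sup>+x. \<integral>\<^sup>+y. \<integral>\<^sup>+z. ennreal (f (x, y, z)) * H (x, y, z) \<partial>lborel \<partial>lborel \<partial>lborel)"
        by (intro nn_integral_cong nn_integral_lborel_pair) measurable
    qed measurable
    also have "\<dots> = (\<integral>\<^sup>+x. \<integral>\<^sup>+y. \<integral>\<^sup>+z. ennreal (\<phi> (x, y) z) * indicator (D n (x, y)) z \<partial>lborel \<partial>lborel \<partial>lborel)"
      by (simp add: \<phi>_def H_def)
    also have "\<dots> = (\<integral>\<^sup>+w. \<integral>\<^sup>+z. ennreal (\<phi> w z) * indicator (D n w) z \<partial>lborel \<partial>lborel)"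
      using lborel.borel_measurable_nn_integral[of "\<lambda>w z. ennreal (\<phi> w z) * indicator (D n w) z" lborel] m5[of n]
      by (intro nn_integral_lborel_pair[symmetric]) (simp add: lborel_prod case_prod_unfold)
    also have "\<dots> \<le> (\<integral>\<^sup>+w. ennreal (sqrt (S n w) * b n) \<partial>lborel)"
      using sq'
    proof (intro nn_integral_mono_AE, eventually_elim)
      case (elim w)
      define u where "u z = ennreal (\<phi> w z) * indicator (D n w) z" for z
      define v where "v z = (indicator (D n w) z :: ennreal)" for z
      have [measurable]: "D n w \<in> sets borel"
        unfolding D_def by (intro borel_closed closed_Times) auto
      have [measurable]: "u \<in> borel_measurable borel" "v \<in> borel_measurable borel"
        unfolding u_def v_def by measurable
      have "(\<integral>\<^sup>+z. u z * v z \<partial>lborel)\<^sup>2 \<le> (\<integral>\<^sup>+z. (u z)\<^sup>2 \<partial>lborel) * (\<integral>\<^sup>+z. (v z)\<^sup>2 \<partial>lborel)"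
        by (intro Cauchy_Schwarz_nn_integral) auto
      also have "(\<integral>\<^sup>+z. (u z)\<^sup>2 \<partial>lborel) = (\<integral>\<^sup>+z. ennreal ((\<phi> w z)\<^sup>2 * indicator (D n w) z) \<partial>lborel)"
        by (intro nn_integral_cong) (auto simp: u_def indicator_def ennreal_power f0 \<phi>_def)
      also have "\<dots> = ennreal (S n w)"
        unfolding S_def by (intro nn_integral_eq_integral Sint elim) auto
      also have "(\<integral>\<^sup>+z. (v z)\<^sup>2 \<partial>lborel) = (\<integral>\<^sup>+z. indicator (D n w) z \<partial>lborel)"
        by (intro nn_integral_cong) (auto simp: v_def indicator_def)
      also have "\<dots> = emeasure (lborel \<Otimes>\<^sub>M lborel) (D n w)"
        by (subst nn_integral_indicator) (auto simp: lborel_prod)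
      also have "\<dots> = ennreal (b n) * ennreal (b n)"
        using pos[OF n] emeasure_cball_ball_vol[of "\<epsilon> n" "fst w"] emeasure_cball_ball_vol[of "\<epsilon> n" "snd w"]
        unfolding D_def b_def by (subst lborel.emeasure_pair_measure_Times) auto
      also have "ennreal (S n w) * (ennreal (b n) * ennreal (b n)) = ennreal (S n w * (b n)\<^sup>2)"
        using b0 S0 by (simp add: ennreal_mult power2_eq_square)
      finally have "(\<integral>\<^sup>+z. u z * v z \<partial>lborel) \<le> ennreal (sqrt (S n w * (b n)\<^sup>2))"
        by (rule ennreal_le_sqrt) (simp add: S0)
      also have "sqrt (S n w * (b n)\<^sup>2) = sqrt (S n w) * b n"
        using b0 by (simp add: real_sqrt_mult)
      also have "(\<integral>\<^sup>+z. u z * v z \<partial>lborel) = (\<integral>\<^sup>+z. ennreal (\<phi> w z) * indicator (D n w) z \<partial>lborel)"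
        by (intro nn_integral_cong) (auto simp: u_def v_def indicator_def)
      finally show ?case .
    qed
    also have "\<dots> = ennreal (LINT w|lborel. sqrt (S n w) * b n)"
      using sqrtint[of n] b0 S0 by (intro nn_integral_eq_integral) auto
    also have "(LINT w|lborel. sqrt (S n w) * b n) = (LINT w|lborel. sqrt (S n w)) * b n"
      by simp
    finally show ?thesis
      using b0 S0 by (subst (asm) ennreal_le_iff) (auto intro!: mult_nonneg_nonneg integral_nonneg_AE)
  qed
  define J where "J n = (LINT w|lborel. sqrt (S n w))" for n
  define v where "v = ball_vol DIM('a) 1"
  have J0: "J n \<ge> 0" for n unfolding J_def using S0 by (intro integral_nonneg_AE) auto
  have v0: "v > 0" unfolding v_def by (intro ball_vol_pos) simp
  have near_bound: "close_prob (\<epsilon> n) 1 (1 + k) / \<epsilon> n powr (DIM('a) / 2) \<le> sqrt (J n * v)" if n: "n \<ge> 1" for n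
  proof -
    let ?q = "close_prob (\<epsilon> n) 1 (1 + k)"
    have q0: "?q \<ge> 0" by (simp add: close_prob_def)
    have bn: "b n = v * \<epsilon> n ^ DIM('a)" by (simp add: b_def v_def ball_vol_def)
    have "both_close_prob (\<epsilon> n) 1 (1 + k) (1 + T) (1 + k + T) = ?q * close_prob (\<epsilon> n) (1 + T) (1 + k + T)"
      by (rule both_close_prob_factor) (auto simp: near_def T_def)
    also have "close_prob (\<epsilon> n) (1 + T) (1 + k + T) = ?q"
      by (rule close_prob_shift) auto
    finally have "?q\<^sup>2 \<le> J n * (v * \<epsilon> n ^ DIM('a))"
      using bound[OF n] by (simp add: J_def bn power2_eq_square)
    moreover have "(\<epsilon> n powr (DIM('a) / 2))\<^sup>2 = \<epsilon> n ^ DIM('a)"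
      using pos[OF n] by (simp add: power2_eq_square powr_realpow flip: powr_add)
    ultimately have "(?q / \<epsilon> n powr (DIM('a) / 2))\<^sup>2 \<le> J n * v"
      using pos[OF n] by (simp add: power_divide divide_le_eq mult.assoc)
    then show ?thesis by (rule real_le_rsqrt)
  qed
  show ?thesis
  proof (rule smalloI_tendsto)
    have "(\<lambda>n. sqrt (J n * v)) \<longlonglongrightarrow> sqrt (0 * v)"
      unfolding J_def by (intro tendsto_intros intlim)
    then have l: "(\<lambda>n. sqrt (J n * v)) \<longlonglongrightarrow> 0" by simp
    show "(\<lambda>n. close_prob (\<epsilon> n) 1 (1 + k) / \<epsilon> n powr (DIM('a) / 2)) \<longlonglongrightarrow> 0"
      by (rule tendsto_sandwich[OF _ _ tendsto_const l])
         (use near_bound in \<open>auto simp: close_prob_def eventually_sequentially intro!: exI[of _ 1]\<close>)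
    show "\<forall>\<^sub>F n in sequentially. \<epsilon> n powr (DIM('a) / 2) \<noteq> 0"
      by (rule eventually_sequentiallyI[of 1]) (use pos in force)
  qed
qed

end

section \<open>Mean and variance of the number of close pairs\<close>

lemma sum_pred_eq_choose_two: "(\<Sum>j=1..n. j - 1) = n choose 2"
proof (induction n)
  case (Suc n)
  have "Suc n choose 2 = (n choose 1) + (n choose 2)"
    by (metis Suc_1 binomial_Suc_Suc One_nat_def)
  then show ?case using Suc by simp
qed (simp add: numeral_2_eq_2)

lemma choose_two_lower:
  assumes "n \<ge> 2"
  shows "(real n)\<^sup>2 / 4 \<le> real (n choose 2)"
proof -
  have "2 * (n choose 2) = n * (n - 1)"
  proof -
    have "even (n * (n - 1))" by (cases n) auto
    then show ?thesis by (simp add: choose_two)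
  qed
  then have "real (2 * (n choose 2)) = real (n * (n - 1))" by (simp only:)
  then have "2 * real (n choose 2) = real n * (real n - 1)"
    using assms by (simp add: of_nat_diff)
  moreover have "real n * (real n - 1) \<ge> real n * (real n / 2)"
    using assms by (intro mult_left_mono) auto
  ultimately show ?thesis by (simp add: power2_eq_square)
qed

context stationary_m_dependent begin

definition close_ind :: "real \<Rightarrow> nat \<Rightarrow> nat \<Rightarrow> 'w \<Rightarrow> real" where
  "close_ind e i j \<omega> = of_bool (norm (X i \<omega> - X j \<omega>) \<le> e)"

definition near_ind :: "nat \<Rightarrow> nat \<Rightarrow> real" where
  "near_ind i j = of_bool (near i j)"

lemma near_ind_nonneg [simp]: "0 \<le> near_ind i j" by (simp add: near_ind_def)

lemma near_ind_commute: "near_ind i j = near_ind j i" by (auto simp: near_ind_def near_def)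

lemma sum_near_ind_le: "(\<Sum>j\<in>{1..n}. near_ind j i) \<le> 2 * real m + 1"
proof -
  have "(\<Sum>j\<in>{1..n}. near_ind j i) = real (card ({1..n} \<inter> {j. near j i}))"
    unfolding near_ind_def by (subst sum_of_bool_eq) auto
  also have "card ({1..n} \<inter> {j. near j i}) \<le> card {i - m..i + m}"
    by (intro card_mono) (auto simp: near_def)
  also have "\<dots> \<le> 2 * m + 1" by simp
  finally show ?thesis by simp
qed

lemma sum_near_ind_le_right: "(\<Sum>j\<in>{1..n}. near_ind i j) \<le> 2 * real m + 1"
  unfolding near_ind_commute[of i] by (rule sum_near_ind_le)

lemma integrable_close_ind:
  assumes "i \<ge> 1" "j \<ge> 1" "k \<ge> 1" "l \<ge> 1"
  shows "integrable M (close_ind e i j)" "expectation (close_ind e i j) = close_prob e i j"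
    "integrable M (\<lambda>\<omega>. close_ind e i j \<omega> * close_ind e k l \<omega>)"
    "expectation (\<lambda>\<omega>. close_ind e i j \<omega> * close_ind e k l \<omega>) = both_close_prob e i j k l"
proof -
  let ?A = "{\<omega> \<in> space M. norm (X i \<omega> - X j \<omega>) \<le> e}"
  let ?B = "{\<omega> \<in> space M. norm (X i \<omega> - X j \<omega>) \<le> e \<and> norm (X k \<omega> - X l \<omega>) \<le> e}"
  have A: "?A \<in> events" and B: "?B \<in> events" using assms by (auto intro: close_event both_close_event)
  have eqA: "close_ind e i j \<omega> = indicator ?A \<omega>" if "\<omega> \<in> space M" for \<omega>
    using that by (simp add: close_ind_def indicator_def)
  have eqB: "close_ind e i j \<omega> * close_ind e k l \<omega> = indicator ?B \<omega>" if "\<omega> \<in> space M" for \<omega>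
    using that by (simp add: close_ind_def indicator_def)
  show "integrable M (close_ind e i j)"
    using A by (subst Bochner_Integration.integrable_cong[OF refl eqA]) (auto simp: less_top[symmetric])
  show "expectation (close_ind e i j) = close_prob e i j"
    using A by (subst Bochner_Integration.integral_cong[OF refl eqA]) (auto simp: close_prob_def)
  show "integrable M (\<lambda>\<omega>. close_ind e i j \<omega> * close_ind e k l \<omega>)"
    using B by (subst Bochner_Integration.integrable_cong[OF refl eqB]) (auto simp: less_top[symmetric])
  show "expectation (\<lambda>\<omega>. close_ind e i j \<omega> * close_ind e k l \<omega>) = both_close_prob e i j k l"
    using B by (subst Bochner_Integration.integral_cong[OF refl eqB]) (auto simp: both_close_prob_def)
qed

text \<open>
  The larger index comes first, in the order in which \<open>close_pairs\<close> sums.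
\<close>

definition pairs :: "nat \<Rightarrow> (nat \<times> nat) set" where
  "pairs n = (SIGMA j:{1..n}. {1..<j})"

lemma finite_pairs [simp]: "finite (pairs n)"
  by (simp add: pairs_def)

lemma card_pairs: "card (pairs n) = n choose 2"
  unfolding pairs_def using sum_pred_eq_choose_two[of n] by (subst card_SigmaI) auto

lemma close_pairs_eq: "close_pairs X e n \<omega> = (\<Sum>u\<in>pairs n. close_ind e (snd u) (fst u) \<omega>)"
  unfolding close_pairs_def pairs_def close_ind_def
  by (subst sum.Sigma) (auto simp: case_prod_unfold)

lemma pairsD: "u \<in> pairs n \<Longrightarrow> 1 \<le> fst u \<and> fst u \<le> n \<and> 1 \<le> snd u \<and> snd u \<le> n \<and> snd u \<noteq> fst u"
  by (auto simp: pairs_def)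

lemma expectation_close_pairs:
  "expectation (close_pairs X e n) = (\<Sum>u\<in>pairs n. close_prob e (snd u) (fst u))"
  unfolding close_pairs_eq[abs_def]
  by (subst Bochner_Integration.integral_sum) (auto intro!: integrable_close_ind sum.cong dest!: pairsD)

lemma integrable_close_pairs: "integrable M (close_pairs X e n)"
  unfolding close_pairs_eq[abs_def]
  by (intro Bochner_Integration.integrable_sum integrable_close_ind) (auto dest!: pairsD)

lemma close_pairs_square:
  "(close_pairs X e n \<omega>)\<^sup>2 = (\<Sum>u\<in>pairs n. \<Sum>w\<in>pairs n. close_ind e (snd u) (fst u) \<omega> * close_ind e (snd w) (fst w) \<omega>)"
  unfolding close_pairs_eq power2_eq_square by (rule sum_product)

lemma integrable_close_pairs_square: "integrable M (\<lambda>\<omega>. (close_pairs X e n \<omega>)\<^sup>2)"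
  unfolding close_pairs_square
  by (intro Bochner_Integration.integrable_sum integrable_close_ind) (auto dest!: pairsD)

lemma variance_close_pairs:
  "variance (close_pairs X e n) = (\<Sum>u\<in>pairs n. \<Sum>w\<in>pairs n.
     both_close_prob e (snd u) (fst u) (snd w) (fst w) - close_prob e (snd u) (fst u) * close_prob e (snd w) (fst w))"
proof -
  have "variance (close_pairs X e n) = expectation (\<lambda>\<omega>. (close_pairs X e n \<omega>)\<^sup>2) - (expectation (close_pairs X e n))\<^sup>2"
    using integrable_close_pairs integrable_close_pairs_square by (rule variance_eq)
  also have "expectation (\<lambda>\<omega>. (close_pairs X e n \<omega>)\<^sup>2) =
      (\<Sum>u\<in>pairs n. \<Sum>w\<in>pairs n. both_close_prob e (snd u) (fst u) (snd w) (fst w))"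
  proof -
    have i: "integrable M (\<lambda>\<omega>. close_ind e (snd u) (fst u) \<omega> * close_ind e (snd w) (fst w) \<omega>)"
      "expectation (\<lambda>\<omega>. close_ind e (snd u) (fst u) \<omega> * close_ind e (snd w) (fst w) \<omega>) = both_close_prob e (snd u) (fst u) (snd w) (fst w)"
      if "u \<in> pairs n" "w \<in> pairs n" for u w
      using pairsD[OF that(1)] pairsD[OF that(2)] by (auto intro!: integrable_close_ind)
    show ?thesis
      unfolding close_pairs_square
      by (subst Bochner_Integration.integral_sum, use i in \<open>force intro: Bochner_Integration.integrable_sum\<close>)
         (intro sum.cong refl, subst Bochner_Integration.integral_sum, use i in auto)
  qed
  also have "(expectation (close_pairs X e n))\<^sup>2 = (\<Sum>u\<in>pairs n. \<Sum>w\<in>pairs n. close_prob e (snd u) (fst u) * close_prob e (snd w) (fst w))"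
    unfolding expectation_close_pairs power2_eq_square by (rule sum_product)
  finally show ?thesis by (simp add: sum_subtractf)
qed

lemma close_prob_nonneg: "0 \<le> close_prob e i j" by (simp add: close_prob_def)

lemma both_close_prob_le:
  assumes "i \<ge> 1" "j \<ge> 1" "k \<ge> 1" "l \<ge> 1"
  shows "both_close_prob e i j k l \<le> close_prob e i j" "both_close_prob e i j k l \<le> close_prob e k l"
  unfolding both_close_prob_def close_prob_def using assms
  by (auto intro!: finite_measure_mono close_event)

lemma both_close_prob_commute:
  "both_close_prob e i j k l = both_close_prob e j i k l" "both_close_prob e i j k l = both_close_prob e i j l k"
  by (simp_all add: both_close_prob_def norm_minus_commute)

text \<open>
  A sum over the lags instead of a maximum, so that a rate for each lag is a rate for the sum.
\<close>

definition near_prob_bound :: "real \<Rightarrow> real" where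
  "near_prob_bound e = (\<Sum>k=1..m. close_prob e 1 (1 + k))"

lemma near_prob_bound_nonneg: "near_prob_bound e \<ge> 0"
  unfolding near_prob_bound_def by (intro sum_nonneg close_prob_nonneg)

lemma close_prob_near_le:
  assumes "i \<ge> 1" "j \<ge> 1" "near i j" "i \<noteq> j"
  shows "close_prob e i j \<le> near_prob_bound e"
proof -
  have *: "close_prob e i j \<le> near_prob_bound e" if "i \<ge> 1" "near i j" "i < j" for i j
  proof -
    have "close_prob e i j = close_prob e (1 + (i - 1)) ((1 + (j - i)) + (i - 1))"
      using that by (intro arg_cong2[where f = "close_prob e"]) auto
    also have "\<dots> = close_prob e 1 (1 + (j - i))"
      by (rule close_prob_shift) auto
    also have "\<dots> \<le> near_prob_bound e"
      unfolding near_prob_bound_def using that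
      by (intro member_le_sum[of "j - i" "{1..m}" "\<lambda>k. close_prob e 1 (1 + k)"]) (auto simp: near_def close_prob_nonneg)
    finally show ?thesis .
  qed
  show ?thesis
    using *[of i j] *[of j i] assms close_prob_commute[of e i j] by (cases "i < j") (auto simp: near_def)
qed

text \<open>
  Bound for the probability that the pairs \<open>(i, j)\<close> and \<open>(k, l)\<close> are both
  close when \<open>i\<close> and \<open>k\<close> are near. The first summand covers the case where
  \<open>j\<close> and \<open>l\<close> are isolated; in each of the others an indicator restricts
  the quadruples that contribute.
\<close>

definition cluster_bound :: "real \<Rightarrow> nat \<Rightarrow> nat \<Rightarrow> nat \<Rightarrow> nat \<Rightarrow> real" where
  "cluster_bound e i j k l =
     (LINT x|lborel. p x ^ 3) * (ball_vol DIM('a) e)\<^sup>2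
     + q2 p * ball_vol DIM('a) e * (near_ind j i + near_ind j k + near_ind j l + near_ind l i + near_ind l k)
     + near_prob_bound e * (near_ind j i * near_ind l k)"

lemma cube_integral_nonneg: "0 \<le> (LINT x|lborel. p x ^ 3)"
  by (intro integral_nonneg_AE) (simp add: p_nonneg)

lemma cluster_bound_nonneg: "e \<ge> 0 \<Longrightarrow> 0 \<le> cluster_bound e i j k l"
  unfolding cluster_bound_def
  using cube_integral_nonneg q2_nonneg ball_vol_nonneg[of e, where 'a='a] near_prob_bound_nonneg
  by (intro add_nonneg_nonneg mult_nonneg_nonneg) auto

text \<open>
  If \<open>j\<close> or \<open>l\<close> is not isolated, one of the indicators is
  \<open>1\<close>, and it suffices that one of the two pairs has indices that are not near. The
  last case is that both pairs have near indices.
\<close>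

lemma both_close_prob_le_cluster_bound:
  assumes ge: "i \<ge> 1" "j \<ge> 1" "k \<ge> 1" "l \<ge> 1" and ne: "i \<noteq> j" "k \<noteq> l" and e: "e \<ge> 0"
  shows "both_close_prob e i j k l \<le> cluster_bound e i j k l"
proof -
  define b where "b = ball_vol DIM('a) e"
  define c where "c = (LINT x|lborel. p x ^ 3)"
  define \<rho> where "\<rho> = near_prob_bound e"
  define \<Sigma> where "\<Sigma> = near_ind j i + near_ind j k + near_ind j l + near_ind l i + near_ind l k"
  have nn: "0 \<le> c * b\<^sup>2" "0 \<le> q2 p * b" "0 \<le> \<rho>" "0 \<le> \<rho> * (near_ind j i * near_ind l k)" "0 \<le> \<Sigma>"
    using cube_integral_nonneg q2_nonneg ball_vol_nonneg[OF e, where 'a='a] near_prob_bound_nonneg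
    by (auto simp: c_def b_def \<rho>_def \<Sigma>_def)
  have cb: "cluster_bound e i j k l = c * b\<^sup>2 + q2 p * b * \<Sigma> + \<rho> * (near_ind j i * near_ind l k)"
    by (simp add: cluster_bound_def c_def b_def \<rho>_def \<Sigma>_def)
  note le = both_close_prob_le[OF ge, of e]
  consider (isolated) "\<not> near j i" "\<not> near j k" "\<not> near j l" "\<not> near l i" "\<not> near l k"
    | (far) "\<Sigma> \<ge> 1" "\<not> near i j \<or> \<not> near k l"
    | (cluster) "near j i" "near l k"
  proof -
    have comm: "near i j = near j i" "near k l = near l k" by (auto simp: near_def)
    have "\<Sigma> \<ge> 1" if "near j i \<or> near j k \<or> near j l \<or> near l i \<or> near l k"
      using that unfolding \<Sigma>_def near_ind_def by (elim disjE) simp_all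
    then show thesis using that comm by blast
  qed
  then show ?thesis
  proof cases
    case isolated
    then have "both_close_prob e i j k l \<le> c * b\<^sup>2"
      unfolding c_def b_def using ge e by (intro both_close_prob_isolated_le) auto
    then show ?thesis unfolding cb using nn mult_nonneg_nonneg[OF nn(2,5)] by linarith
  next
    case far
    then have "both_close_prob e i j k l \<le> q2 p * b"
      using close_prob_far_le[OF ge(1,2) _ e] close_prob_far_le[OF ge(3,4) _ e] le
      unfolding b_def by (metis order_trans)
    also have "\<dots> \<le> q2 p * b * \<Sigma>" using mult_left_mono[OF far(1) nn(2)] by simp
    finally show ?thesis unfolding cb using nn by linarith
  next
    case cluster
    then have "both_close_prob e i j k l \<le> \<rho> * (near_ind j i * near_ind l k)"
      using le(1) close_prob_near_le[OF ge(1,2), of e] ne by (simp add: near_ind_def \<rho>_def near_def)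
    then show ?thesis unfolding cb using nn mult_nonneg_nonneg[OF nn(2,5)] by linarith
  qed
qed

text \<open>
  Any of the four pairs of indices can be the near one that links the two indicators; the symmetry
  of the closeness relation reduces all of them to \<open>cluster_bound\<close>.
\<close>

lemma covariance_le:
  assumes ge: "i \<ge> 1" "j \<ge> 1" "k \<ge> 1" "l \<ge> 1" and ne: "i \<noteq> j" "k \<noteq> l" and e: "e \<ge> 0"
  shows "both_close_prob e i j k l - close_prob e i j * close_prob e k l \<le>
    near_ind i k * cluster_bound e i j k l + near_ind i l * cluster_bound e i j l k
    + near_ind j k * cluster_bound e j i k l + near_ind j l * cluster_bound e j i l k"
proof -
  have nn: "0 \<le> near_ind a b * cluster_bound e a' b' c' d'" for a b a' b' c' d'
    using cluster_bound_nonneg[OF e] by simp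
  have c0: "0 \<le> close_prob e i j * close_prob e k l" by (simp add: close_prob_nonneg)
  have 1: "both_close_prob e i j k l \<le> cluster_bound e i j k l"
    using assms by (intro both_close_prob_le_cluster_bound) auto
  have 2: "both_close_prob e i j k l \<le> cluster_bound e i j l k"
    unfolding both_close_prob_commute(2)[of e i j k l] using assms by (intro both_close_prob_le_cluster_bound) auto
  have 3: "both_close_prob e i j k l \<le> cluster_bound e j i k l"
    unfolding both_close_prob_commute(1)[of e i j k l] using assms by (intro both_close_prob_le_cluster_bound) auto
  have 4: "both_close_prob e i j k l \<le> cluster_bound e j i l k"
    unfolding both_close_prob_commute(1)[of e i j k l] both_close_prob_commute(2)[of e j i k l]
    using assms by (intro both_close_prob_le_cluster_bound) auto
  show ?thesis
  proof (cases "near i k \<or> near i l \<or> near j k \<or> near j l")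
    case False
    then have "both_close_prob e i j k l = close_prob e i j * close_prob e k l"
      using both_close_prob_factor[OF ge] by blast
    then show ?thesis using nn by (simp add: add_nonneg_nonneg)
  next
    case True
    then consider "near_ind i k = 1" | "near_ind i l = 1" | "near_ind j k = 1" | "near_ind j l = 1"
      by (auto simp: near_ind_def)
    then show ?thesis
      using 1 2 3 4 c0 nn[of i k i j k l] nn[of i l i j l k] nn[of j k j i k l] nn[of j l j i l k]
      by cases simp_all
  qed
qed

text \<open>
  The linking factor does not depend on \<open>j\<close> and \<open>l\<close>. It is therefore
  enough to bound the sum over \<open>j\<close> and \<open>l\<close> uniformly in \<open>i\<close>
  and \<open>k\<close>, and to use that every index is near to at most \<open>2 * m + 1\<close>
  indices, itself included.
\<close>

lemma sum_cluster_bound_le: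
  fixes e :: real and n :: nat
  assumes e: "e \<ge> 0"
  defines "N \<equiv> {1..n}" and "s \<equiv> 2 * real m + 1" and "b \<equiv> ball_vol DIM('a) e"
  shows "(\<Sum>i\<in>N. \<Sum>j\<in>N. \<Sum>k\<in>N. \<Sum>l\<in>N. near_ind i k * cluster_bound e i j k l)
    \<le> real n * s * ((LINT x|lborel. p x ^ 3) * b\<^sup>2 * (real n)\<^sup>2 + 5 * q2 p * b * real n * s + near_prob_bound e * s\<^sup>2)"
proof -
  define c where "c = (LINT x|lborel. p x ^ 3)"
  define \<rho> where "\<rho> = near_prob_bound e"
  have nn: "0 \<le> c" "0 \<le> q2 p * b" "0 \<le> \<rho>" "0 \<le> s"
    using cube_integral_nonneg q2_nonneg ball_vol_nonneg[OF e, where 'a='a] near_prob_bound_nonneg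
    by (auto simp: c_def b_def \<rho>_def s_def)
  have s1: "(\<Sum>j\<in>N. near_ind j i) \<le> s" for i unfolding N_def s_def by (rule sum_near_ind_le)
  have s2: "(\<Sum>j\<in>N. near_ind i j) \<le> s" for i unfolding N_def s_def by (rule sum_near_ind_le_right)
  have cN: "real (card N) = real n" by (simp add: N_def)
  have dbl: "(\<Sum>j\<in>N. \<Sum>l\<in>N. near_ind j l) \<le> real n * s"
    using sum_mono[of N "\<lambda>j. \<Sum>l\<in>N. near_ind j l" "\<lambda>_. s"] s2 cN by simp
  define G where "G = c * b\<^sup>2 * (real n)\<^sup>2 + 5 * q2 p * b * real n * s + \<rho> * s\<^sup>2"
  have inner: "(\<Sum>j\<in>N. \<Sum>l\<in>N. cluster_bound e i j k l) \<le> G" for i k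
  proof -
    have "(\<Sum>j\<in>N. \<Sum>l\<in>N. cluster_bound e i j k l) =
       (\<Sum>j\<in>N. \<Sum>l\<in>N. c * b\<^sup>2) + q2 p * b * ((\<Sum>j\<in>N. \<Sum>l\<in>N. near_ind j i) + (\<Sum>j\<in>N. \<Sum>l\<in>N. near_ind j k)
       + (\<Sum>j\<in>N. \<Sum>l\<in>N. near_ind j l) + (\<Sum>j\<in>N. \<Sum>l\<in>N. near_ind l i) + (\<Sum>j\<in>N. \<Sum>l\<in>N. near_ind l k))
       + \<rho> * (\<Sum>j\<in>N. \<Sum>l\<in>N. near_ind j i * near_ind l k)"
      unfolding cluster_bound_def c_def[symmetric] b_def[symmetric] \<rho>_def[symmetric]
      by (simp add: sum.distrib algebra_simps flip: sum_distrib_left)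
    also have "(\<Sum>j\<in>N. \<Sum>l\<in>N. c * b\<^sup>2) = c * b\<^sup>2 * (real n)\<^sup>2"
      using cN by (simp add: power2_eq_square)
    also have "(\<Sum>j\<in>N. \<Sum>l\<in>N. near_ind j i * near_ind l k) = (\<Sum>j\<in>N. near_ind j i) * (\<Sum>l\<in>N. near_ind l k)"
      by (rule sum_product[symmetric])
    also have "\<dots> \<le> s * s"
      using s1 nn by (intro mult_mono) (auto intro: sum_nonneg)
    also have "(\<Sum>j\<in>N. \<Sum>l\<in>N. near_ind j i) = real n * (\<Sum>j\<in>N. near_ind j i)" 
      using cN by (simp add: sum_distrib_left)
    also have "(\<Sum>j\<in>N. \<Sum>l\<in>N. near_ind j k) = real n * (\<Sum>j\<in>N. near_ind j k)"
      using cN by (simp add: sum_distrib_left)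
    also have "(\<Sum>j\<in>N. \<Sum>l\<in>N. near_ind l i) = real n * (\<Sum>l\<in>N. near_ind l i)"
      using cN by simp
    also have "(\<Sum>j\<in>N. \<Sum>l\<in>N. near_ind l k) = real n * (\<Sum>l\<in>N. near_ind l k)"
      using cN by simp
    finally have 1: "(\<Sum>j\<in>N. \<Sum>l\<in>N. cluster_bound e i j k l) \<le> c * b\<^sup>2 * (real n)\<^sup>2
      + q2 p * b * (real n * (\<Sum>j\<in>N. near_ind j i) + real n * (\<Sum>j\<in>N. near_ind j k) + (\<Sum>j\<in>N. \<Sum>l\<in>N. near_ind j l)
        + real n * (\<Sum>l\<in>N. near_ind l i) + real n * (\<Sum>l\<in>N. near_ind l k)) + \<rho> * (s * s)"
      using nn by (simp add: mult_left_mono)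
    have 2: "real n * (\<Sum>j\<in>N. near_ind j i) \<le> real n * s" for i
      using s1 by (intro mult_left_mono) auto
    have "real n * (\<Sum>j\<in>N. near_ind j i) + real n * (\<Sum>j\<in>N. near_ind j k) + (\<Sum>j\<in>N. \<Sum>l\<in>N. near_ind j l)
        + real n * (\<Sum>l\<in>N. near_ind l i) + real n * (\<Sum>l\<in>N. near_ind l k) \<le> 5 * (real n * s)"
      using 2[of i] 2[of k] dbl by linarith
    from mult_left_mono[OF this nn(2)] 1 show ?thesis
      unfolding G_def by (simp add: power2_eq_square mult_ac)
  qed
  have G0: "0 \<le> G" unfolding G_def using nn q2_nonneg ball_vol_nonneg[OF e, where 'a='a]
    by (auto intro!: add_nonneg_nonneg mult_nonneg_nonneg simp: b_def)
  have "(\<Sum>i\<in>N. \<Sum>j\<in>N. \<Sum>k\<in>N. \<Sum>l\<in>N. near_ind i k * cluster_bound e i j k l) =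
    (\<Sum>i\<in>N. \<Sum>k\<in>N. near_ind i k * (\<Sum>j\<in>N. \<Sum>l\<in>N. cluster_bound e i j k l))"
    by (subst sum.swap[of _ N N]) (simp add: sum_distrib_left)
  also have "\<dots> \<le> (\<Sum>i\<in>N. \<Sum>k\<in>N. near_ind i k * G)"
    by (intro sum_mono mult_left_mono inner) auto
  also have "\<dots> = (\<Sum>i\<in>N. \<Sum>k\<in>N. near_ind i k) * G"
    by (simp add: sum_distrib_right)
  also have "\<dots> \<le> real n * s * G" by (rule mult_right_mono[OF dbl G0])
  finally show ?thesis by (simp add: G_def c_def \<rho>_def)
qed

lemma variance_close_pairs_le:
  fixes e :: real and n :: nat
  assumes e: "e \<ge> 0"
  defines "s \<equiv> 2 * real m + 1" and "b \<equiv> ball_vol DIM('a) e"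
  shows "variance (close_pairs X e n) \<le> 4 * (real n * s *
    ((LINT x|lborel. p x ^ 3) * b\<^sup>2 * (real n)\<^sup>2 + 5 * q2 p * b * real n * s + near_prob_bound e * s\<^sup>2))"
proof -
  let ?N = "{1..n}"
  define B where "B i j k l = near_ind i k * cluster_bound e i j k l" for i j k l
  define Z where "Z = (\<Sum>i\<in>?N. \<Sum>j\<in>?N. \<Sum>k\<in>?N. \<Sum>l\<in>?N. B i j k l)"
  define T where "T i j k l = B i j k l + B i j l k + B j i k l + B j i l k" for i j k l
  have T0: "0 \<le> T i j k l" for i j k l
    unfolding T_def B_def using cluster_bound_nonneg[OF e] by (intro add_nonneg_nonneg mult_nonneg_nonneg) auto
  have sub: "pairs n \<subseteq> ?N \<times> ?N" by (auto simp: pairs_def)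
  have "variance (close_pairs X e n) \<le> (\<Sum>u\<in>pairs n. \<Sum>w\<in>pairs n. T (snd u) (fst u) (snd w) (fst w))"
    unfolding variance_close_pairs
  proof (intro sum_mono)
    fix u w assume "u \<in> pairs n" "w \<in> pairs n"
    then show "both_close_prob e (snd u) (fst u) (snd w) (fst w) - close_prob e (snd u) (fst u) * close_prob e (snd w) (fst w)
       \<le> T (snd u) (fst u) (snd w) (fst w)"
      unfolding T_def B_def using pairsD[of u n] pairsD[of w n] e by (intro covariance_le) auto
  qed
  also have "\<dots> \<le> (\<Sum>u\<in>pairs n. \<Sum>w\<in>?N \<times> ?N. T (snd u) (fst u) (snd w) (fst w))"
    by (intro sum_mono sum_mono2 sub) (auto simp: T0)
  also have "\<dots> \<le> (\<Sum>u\<in>?N \<times> ?N. \<Sum>w\<in>?N \<times> ?N. T (snd u) (fst u) (snd w) (fst w))"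
    by (intro sum_mono2 sub) (auto simp: T0 intro!: sum_nonneg)
  also have "\<dots> = (\<Sum>j\<in>?N. \<Sum>i\<in>?N. \<Sum>l\<in>?N. \<Sum>k\<in>?N. T i j k l)"
  proof -
    have cart: "(\<Sum>u\<in>?N \<times> ?N. h (fst u) (snd u)) = (\<Sum>j\<in>?N. \<Sum>i\<in>?N. h j i)" for h :: "nat \<Rightarrow> nat \<Rightarrow> real"
      by (simp add: sum.cartesian_product case_prod_unfold)
    have "(\<Sum>w\<in>?N \<times> ?N. T i j (snd w) (fst w)) = (\<Sum>l\<in>?N. \<Sum>k\<in>?N. T i j k l)" for i j
      by (rule cart)
    then show ?thesis using cart[of "\<lambda>j i. \<Sum>w\<in>?N \<times> ?N. T i j (snd w) (fst w)"] by (simp only:)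
  qed
  also have "\<dots> = (\<Sum>i\<in>?N. \<Sum>j\<in>?N. \<Sum>l\<in>?N. \<Sum>k\<in>?N. T i j k l)"
    by (rule sum.swap)
  also have "\<dots> = (\<Sum>i\<in>?N. \<Sum>j\<in>?N. \<Sum>k\<in>?N. \<Sum>l\<in>?N. T i j k l)"
    by (intro sum.cong refl sum.swap)
  also have "\<dots> = Z + (\<Sum>i\<in>?N. \<Sum>j\<in>?N. \<Sum>k\<in>?N. \<Sum>l\<in>?N. B i j l k)
     + (\<Sum>i\<in>?N. \<Sum>j\<in>?N. \<Sum>k\<in>?N. \<Sum>l\<in>?N. B j i k l) + (\<Sum>i\<in>?N. \<Sum>j\<in>?N. \<Sum>k\<in>?N. \<Sum>l\<in>?N. B j i l k)"
    unfolding T_def Z_def by (simp only: sum.distrib)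
  also have "(\<Sum>i\<in>?N. \<Sum>j\<in>?N. \<Sum>k\<in>?N. \<Sum>l\<in>?N. B i j l k) = Z"
    unfolding Z_def by (intro sum.cong refl sum.swap)
  also have "(\<Sum>i\<in>?N. \<Sum>j\<in>?N. \<Sum>k\<in>?N. \<Sum>l\<in>?N. B j i l k) = (\<Sum>i\<in>?N. \<Sum>j\<in>?N. \<Sum>k\<in>?N. \<Sum>l\<in>?N. B j i k l)"
    by (intro sum.cong refl sum.swap)
  also have "(\<Sum>i\<in>?N. \<Sum>j\<in>?N. \<Sum>k\<in>?N. \<Sum>l\<in>?N. B j i k l) = Z"
    unfolding Z_def by (rule sum.swap)
  also have "Z + Z + Z + Z = 4 * Z" by simp
  also have "Z \<le> real n * s * ((LINT x|lborel. p x ^ 3) * b\<^sup>2 * (real n)\<^sup>2 + 5 * q2 p * b * real n * s + near_prob_bound e * s\<^sup>2)"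
    unfolding Z_def B_def s_def b_def by (rule sum_cluster_bound_le[OF e])
  finally show ?thesis by simp
qed

text \<open>
  Pairs with near indices are few, so for them a bound by the sum of the two terms suffices.
\<close>

lemma expectation_close_pairs_bias:
  fixes e :: real and n :: nat
  assumes e: "0 \<le> e" "e \<le> 1" and p: "p \<in> H2_class \<alpha> K" "\<alpha> > 0"
  defines "s \<equiv> 2 * real m + 1" and "b \<equiv> ball_vol DIM('a) e"
  shows "\<bar>expectation (close_pairs X e n) - real (n choose 2) * (b * q2 p)\<bar> \<le>
    real (n choose 2) * (b * (K\<^sup>2 / 2 * e powr (2 * \<alpha>))) + real n * s * (near_prob_bound e + b * q2 p)"
proof -
  let ?N = "{1..n}"
  define \<beta> where "\<beta> = b * (K\<^sup>2 / 2 * e powr (2 * \<alpha>))"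
  have b0: "b \<ge> 0" unfolding b_def by (rule ball_vol_nonneg[OF e(1)])
  have nn: "0 \<le> \<beta>" "0 \<le> near_prob_bound e + b * q2 p"
    using b0 q2_nonneg near_prob_bound_nonneg by (auto simp: \<beta>_def)
  have one: "\<bar>close_prob e i j - b * q2 p\<bar> \<le> \<beta> + near_ind j i * (near_prob_bound e + b * q2 p)"
    if "i \<ge> 1" "j \<ge> 1" "i \<noteq> j" for i j
  proof (cases "near i j")
    case True
    then have "near_ind j i = 1" by (simp add: near_ind_def near_def)
    moreover have "\<bar>close_prob e i j - b * q2 p\<bar> \<le> near_prob_bound e + b * q2 p"
      using close_prob_near_le[OF that(1,2) True that(3), of e] close_prob_nonneg[of e i j]
        mult_nonneg_nonneg[OF b0 q2_nonneg] near_prob_bound_nonneg[of e] by linarith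
    ultimately show ?thesis using nn by simp
  next
    case False
    have "close_prob e i j \<le> q2 p * b" "(q2 p - K\<^sup>2 / 2 * e powr (2 * \<alpha>)) * b \<le> close_prob e i j"
      unfolding b_def using close_prob_far_le[OF that(1,2) False e(1)] close_prob_far_ge[OF that(1,2) False e p] by auto
    then have "\<bar>close_prob e i j - b * q2 p\<bar> \<le> \<beta>"
      using nn(1) unfolding \<beta>_def by (simp add: abs_le_iff algebra_simps)
    moreover have "0 \<le> near_ind j i * (near_prob_bound e + b * q2 p)" using nn by simp
    ultimately show ?thesis by linarith
  qed
  have "expectation (close_pairs X e n) - real (n choose 2) * (b * q2 p) =
    (\<Sum>u\<in>pairs n. close_prob e (snd u) (fst u) - b * q2 p)"
    by (simp add: expectation_close_pairs sum_subtractf card_pairs)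
  then have "\<bar>expectation (close_pairs X e n) - real (n choose 2) * (b * q2 p)\<bar> \<le>
    (\<Sum>u\<in>pairs n. \<bar>close_prob e (snd u) (fst u) - b * q2 p\<bar>)"
    by (simp add: sum_abs)
  also have "\<dots> \<le> (\<Sum>u\<in>pairs n. \<beta> + near_ind (fst u) (snd u) * (near_prob_bound e + b * q2 p))"
    by (intro sum_mono one) (auto dest!: pairsD)
  also have "\<dots> = real (n choose 2) * \<beta> + (\<Sum>u\<in>pairs n. near_ind (fst u) (snd u)) * (near_prob_bound e + b * q2 p)"
    by (simp add: sum.distrib card_pairs sum_distrib_right)
  also have "(\<Sum>u\<in>pairs n. near_ind (fst u) (snd u)) \<le> (\<Sum>u\<in>?N \<times> ?N. near_ind (fst u) (snd u))"
    by (intro sum_mono2) (auto simp: pairs_def)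
  also have "\<dots> = (\<Sum>j\<in>?N. \<Sum>i\<in>?N. near_ind j i)"
    by (simp add: sum.cartesian_product case_prod_unfold)
  also have "\<dots> \<le> (\<Sum>j\<in>?N. s)"
    unfolding s_def by (intro sum_mono sum_near_ind_le_right)
  finally show ?thesis using nn by (simp add: \<beta>_def mult_right_mono)
qed

end

section \<open>Growth of slowly varying functions\<close>

lemma borel_measurable_dilation:
  assumes L: "L \<in> borel_measurable (lebesgue_on {1..})" and x: "x \<ge> (1::real)"
  shows "(\<lambda>t. L (t * x)) \<in> borel_measurable (lebesgue_on {1..})"
proof -
  have 1: "(\<lambda>t. t * x) \<in> measurable lebesgue lebesgue"
  proof -
    have "(\<lambda>t. t * x) = (*\<^sub>R) x" by auto
    then show ?thesis using lebesgue_measurable_scaling[of x] by (simp only:)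
  qed
  have "(\<lambda>t. t * x) \<in> measurable (lebesgue_on {1..}) (lebesgue_on {1..})"
  proof (rule measurable_restrict_space3[OF 1])
    show "(\<lambda>t. t * x) \<in> {1..} \<rightarrow> {1..}"
      using x mult_mono[of 1 _ 1 x] by auto
  qed
  from measurable_compose[OF this L] show ?thesis .
qed

lemma measure_exhausting_interval_tendsto:
  fixes V :: "nat \<Rightarrow> real set"
  assumes V: "\<And>n. V n \<in> sets lebesgue" "incseq V" and U: "(\<Union>n. V n) = {a..b}" and "a \<le> b"
  shows "(\<lambda>n. measure lebesgue (V n)) \<longlonglongrightarrow> b - a"
proof -
  have "(\<lambda>n. measure lebesgue (V n)) \<longlonglongrightarrow> measure lebesgue (\<Union>n. V n)"
    using V emeasure_lborel_Icc[OF \<open>a \<le> b\<close>] by (intro Lim_measure_incseq) (auto simp: U)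
  then show ?thesis using \<open>a \<le> b\<close> by (simp add: U)
qed

text \<open>
  A weak form of the uniform convergence theorem for slowly varying functions. If it fails along
  points \<open>x n\<close> and factors \<open>u n\<close>, then for large \<open>n\<close> the
  factors \<open>t\<close> that change \<open>L\<close> by at most a factor \<open>2\<close> fill
  almost all of \<open>{1..4}\<close>, both starting from \<open>x n\<close> and from \<open>u n * x
  n\<close>. Dilated to a common scale, these two sets have total measure more than \<open>4 * u n -
  1\<close>, the length of an interval that contains them, so they meet; a common point compares
  \<open>L (x n)\<close> with \<open>L (u n * x n)\<close> and gives a contradiction.
\<close>

lemma slowly_varying_locally_bounded_ratio:
  assumes L: "slowly_varying L"
  shows "\<exists>x0\<ge>1. \<forall>x\<ge>x0. \<forall>u\<in>{1..2}. L (u * x) \<le> 4 * L x"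
proof (rule ccontr)
  assume neg: "\<not> ?thesis"
  have meas: "L \<in> borel_measurable (lebesgue_on {1..})" and pos: "\<And>x. x \<ge> 1 \<Longrightarrow> 0 < L x"
    and lim: "\<And>t. t > 0 \<Longrightarrow> ((\<lambda>x. L (t * x) / L x) \<longlongrightarrow> 1) at_top"
    using L by (auto simp: slowly_varying_def)
  have "\<forall>n::nat. \<exists>x u. x \<ge> real n + 1 \<and> 1 \<le> u \<and> u \<le> 2 \<and> L (u * x) > 4 * L x"
  proof
    fix n :: nat
    have "1 \<le> real n + 1" by simp
    with neg obtain x u where "x \<ge> real n + 1" "u \<in> {1..2}" "\<not> L (u * x) \<le> 4 * L x" by meson
    then show "\<exists>x u. x \<ge> real n + 1 \<and> 1 \<le> u \<and> u \<le> 2 \<and> L (u * x) > 4 * L x" by (auto simp: not_le)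
  qed
  then obtain x u where x: "\<And>n::nat. x n \<ge> real n + 1" and u: "\<And>n. 1 \<le> u n" "\<And>n. u n \<le> 2"
    and big: "\<And>n. L (u n * x n) > 4 * L (x n)" by metis
  have x1: "x n \<ge> 1" for n using x[of n] by simp
  have xlim: "filterlim x at_top sequentially"
    by (rule filterlim_at_top_mono[OF filterlim_real_sequentially]) 
       (use x in \<open>auto simp: eventually_sequentially intro!: exI[of _ 0] order_trans[OF _ x]\<close>)
  define y where "y n = u n * x n" for n
  have yx: "y n \<ge> x n" for n
    using mult_right_mono[OF u(1)[of n], of "x n"] x1[of n] by (simp add: y_def)
  then have y1: "y n \<ge> 1" for n using x1[of n] order_trans by blast
  have ylim: "filterlim y at_top sequentially"
    by (rule filterlim_at_top_mono[OF xlim]) (simp add: yx)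
  define V where "V z n = {t \<in> {1..4}. \<forall>k\<in>{n..}. L (t * z k) / L (z k) \<in> {1/2..2}}" for z :: "nat \<Rightarrow> real" and n
  have Vlim: "(\<lambda>n. measure lebesgue (V z n)) \<longlonglongrightarrow> 3" and Vset: "\<And>n. V z n \<in> sets lebesgue"
    if z1: "\<And>k. z k \<ge> 1" and zlim: "filterlim z at_top sequentially" for z
  proof -
    show sets: "V z n \<in> sets lebesgue" for n
    proof -
      have [measurable]: "(\<lambda>t. L (t * z k)) \<in> borel_measurable (lebesgue_on {1..})" for k
        by (rule borel_measurable_dilation[OF meas z1])
      have [measurable]: "(\<lambda>t. t) \<in> borel_measurable (lebesgue_on {1..})"
        by (intro measurable_restrict_space1 measurable_completion) simp
      have "{t \<in> space (lebesgue_on {1..}). t \<le> 4 \<and> (\<forall>k\<in>{n..}. 1/2 \<le> L (t * z k) / L (z k) \<and> L (t * z k) / L (z k) \<le> 2)} \<in> sets (lebesgue_on {1..})"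
        by measurable
      also have "{t \<in> space (lebesgue_on {1..}). t \<le> 4 \<and> (\<forall>k\<in>{n..}. 1/2 \<le> L (t * z k) / L (z k) \<and> L (t * z k) / L (z k) \<le> 2)} = V z n"
        by (auto simp: V_def)
      finally show ?thesis by (subst (asm) sets_restrict_space_iff) auto
    qed
    have U: "(\<Union>n. V z n) = {1..4}"
    proof (intro equalityI subsetI)
      fix t :: real assume t: "t \<in> {1..4}"
      have "((\<lambda>k. L (t * z k) / L (z k)) \<longlonglongrightarrow> 1)"
        using filterlim_compose[OF lim zlim, of t] t by simp
      then have "\<forall>\<^sub>F k in sequentially. L (t * z k) / L (z k) > 1/2 \<and> L (t * z k) / L (z k) < 2"
        by (intro eventually_conj order_tendstoD) auto
      then obtain n where "\<And>k. k \<ge> n \<Longrightarrow> L (t * z k) / L (z k) > 1/2 \<and> L (t * z k) / L (z k) < 2"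
        by (auto simp: eventually_sequentially)
      then have "t \<in> V z n" using t by (auto simp: V_def less_imp_le)
      then show "t \<in> (\<Union>n. V z n)" by blast
    qed (auto simp: V_def)
    have "incseq (V z)" by (auto simp: incseq_def V_def)
    from measure_exhausting_interval_tendsto[OF sets this U] show "(\<lambda>n. measure lebesgue (V z n)) \<longlonglongrightarrow> 3" by simp
  qed
  have "\<forall>\<^sub>F n in sequentially. measure lebesgue (V x n) > 5/2 \<and> measure lebesgue (V y n) > 5/2"
    using order_tendstoD(1)[OF Vlim[OF x1 xlim], of "5/2"] order_tendstoD(1)[OF Vlim[OF y1 ylim], of "5/2"]
    by (simp add: eventually_conj_iff)
  then obtain n where n: "measure lebesgue (V x n) > 5/2" "measure lebesgue (V y n) > 5/2"
    by (auto simp: eventually_sequentially)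
  define W where "W = (\<lambda>t. u n * t) ` V y n"
  have Wm: "W \<in> sets lebesgue" "measure lebesgue W = u n * measure lebesgue (V y n)"
  proof -
    have "W = (\<lambda>t. u n *\<^sub>R t) ` V y n" by (simp add: W_def)
    then show "measure lebesgue W = u n * measure lebesgue (V y n)"
      using measure_lebesgue_affine[of "u n" 0 "V y n"] u(1)[of n] by simp
    have "W = (\<lambda>t. t / u n) -` V y n \<inter> space lebesgue"
      using u(1)[of n] by (auto simp: W_def image_iff field_simps intro!: bexI[of _ "_ / u n"])
    also have "\<dots> \<in> sets lebesgue"
    proof (rule measurable_sets[OF _ Vset[OF y1 ylim]])
      have "(\<lambda>t. t / u n) = (*\<^sub>R) (1 / u n)" by auto
      then show "(\<lambda>t. t / u n) \<in> measurable lebesgue lebesgue"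
        using lebesgue_measurable_scaling[of "1 / u n"] by (simp only:)
    qed
    finally show "W \<in> sets lebesgue" .
  qed
  have sub: "V x n \<subseteq> {1..4 * u n}" "W \<subseteq> {1..4 * u n}"
  proof -
    show "V x n \<subseteq> {1..4 * u n}" using u(1)[of n] by (auto simp: V_def)
    show "W \<subseteq> {1..4 * u n}"
    proof
      fix w assume "w \<in> W"
      then obtain t where t: "w = u n * t" "1 \<le> t" "t \<le> 4" by (auto simp: W_def V_def)
      then show "w \<in> {1..4 * u n}" using u(1)[of n] mult_mono[of 1 "u n" 1 t] by auto
    qed
  qed
  have "V x n \<inter> W \<noteq> {}"
  proof
    assume disj: "V x n \<inter> W = {}"
    have fin: "V x n \<in> lmeasurable" "W \<in> lmeasurable"
      using sub Wm Vset[OF x1 xlim, of n] 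
      by (auto intro: lmeasurable_interval fmeasurableI2[OF lmeasurable_interval(1)])
    have "measure lebesgue (V x n \<union> W) = measure lebesgue (V x n) + measure lebesgue W"
      using fin disj by (intro measure_Union) (auto simp: fmeasurable_def)
    moreover have "measure lebesgue (V x n \<union> W) \<le> measure lebesgue {1..4 * u n}"
      using sub fin by (intro measure_mono_fmeasurable) (auto intro: lmeasurable_interval)
    moreover have "measure lebesgue {1..4 * u n} = 4 * u n - 1"
      using u(1)[of n] by simp
    moreover have "u n * measure lebesgue (V y n) \<ge> u n * (5/2)"
      using n u(1)[of n] by (intro mult_left_mono) auto
    ultimately show False using n u(1,2)[of n] Wm by simp
  qed
  then obtain v where v: "v \<in> V x n" "v \<in> W" by blast
  then obtain t where t: "v = u n * t" "t \<in> V y n" by (auto simp: W_def)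
  have eq: "v * x n = t * y n" by (simp add: t y_def)
  have "L (v * x n) / L (x n) \<le> 2" using v by (auto simp: V_def)
  then have "L (v * x n) \<le> 2 * L (x n)" using pos[OF x1[of n]] by (simp add: divide_le_eq)
  moreover have "1/2 \<le> L (t * y n) / L (y n)" using t by (auto simp: V_def)
  then have "L (y n) / 2 \<le> L (t * y n)" using pos[OF y1[of n]] by (simp add: le_divide_eq)
  moreover have "L (y n) > 4 * L (x n)" using big by (simp add: y_def)
  ultimately show False unfolding eq by linarith
qed

text \<open>
  Far out, each doubling of the argument multiplies \<open>L\<close> by at most \<open>2 powr
  \<delta>\<close>. The local bound is needed once, to reach an arbitrary argument from a point of
  the form \<open>2 ^ k * z\<close>.
\<close>

lemma slowly_varying_bounded_by_power:
  assumes L: "slowly_varying L" and "\<delta> > 0"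
  shows "\<exists>C>0. \<forall>\<^sub>F n in sequentially. L (real n) \<le> C * real n powr \<delta>"
proof -
  have pos: "\<And>x. x \<ge> 1 \<Longrightarrow> 0 < L x"
    and lim: "((\<lambda>x. L (2 * x) / L x) \<longlongrightarrow> 1) at_top"
    using L by (auto simp: slowly_varying_def)
  obtain x0 where x0: "x0 \<ge> 1" and loc: "\<And>x u. x \<ge> x0 \<Longrightarrow> u \<in> {1..2} \<Longrightarrow> L (u * x) \<le> 4 * L x"
    using slowly_varying_locally_bounded_ratio[OF L] by blast
  have "1 < 2 powr \<delta>" using \<open>\<delta> > 0\<close> by simp
  then have "\<forall>\<^sub>F x in at_top. L (2 * x) / L x < 2 powr \<delta>"
    using order_tendstoD(2)[OF lim] by blast
  then obtain x2 where x2: "\<And>x. x \<ge> x2 \<Longrightarrow> L (2 * x) / L x < 2 powr \<delta>"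
    by (auto simp: eventually_at_top_linorder)
  define z where "z = max x0 x2"
  have z: "z \<ge> 1" "z \<ge> x0" "z \<ge> x2" using x0 by (auto simp: z_def)
  have doubling: "L (2 * x) \<le> 2 powr \<delta> * L x" if "x \<ge> z" for x
    using x2[of x] pos[of x] that z by (simp add: divide_less_eq)
  have pow: "L (2 ^ k * w) \<le> (2 ^ k) powr \<delta> * L w" if "w \<ge> z" for k w
  proof (induction k)
    case (Suc k)
    have "2 ^ k * w \<ge> w" using that z mult_right_mono[of 1 "2 ^ k" w] by simp
    then have "L (2 * (2 ^ k * w)) \<le> 2 powr \<delta> * L (2 ^ k * w)" using that by (intro doubling) simp
    also have "\<dots> \<le> 2 powr \<delta> * ((2 ^ k) powr \<delta> * L w)" by (intro mult_left_mono Suc) simp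
    finally show ?case by (simp add: powr_mult mult.assoc)
  qed simp
  have main: "L x \<le> 4 * L z * x powr \<delta>" if "x \<ge> z" for x
  proof -
    define k where "k = nat \<lfloor>log 2 (x / z)\<rfloor>"
    have xz: "x / z \<ge> 1" using that z by simp
    have "log 2 (x / z) \<ge> 0" using xz by simp
    then have k: "real k \<le> log 2 (x / z)" "log 2 (x / z) < real k + 1"
      unfolding k_def by (auto simp: le_nat_iff of_nat_nat floor_less_iff)
    have "x / z > 0" using xz by simp
    then have "2 powr (log 2 (x / z)) = x / z" by simp
    then have "2 powr real k \<le> x / z" "x / z < 2 powr (real k + 1)"
      using powr_mono[OF k(1), of 2] powr_less_mono[OF k(2), of 2] by simp_all
    then have k2: "2 ^ k \<le> x / z" "x / z < 2 * 2 ^ k"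
      by (auto simp: powr_add powr_realpow)
    define w where "w = x / 2 ^ k"
    define s where "s = w / z"
    have s: "s \<in> {1..2}" using k2 z by (auto simp: s_def w_def field_simps)
    have w: "w = s * z" using z by (simp add: s_def)
    have "w \<ge> z" using s z w mult_right_mono[of 1 s z] by auto
    have "L x = L (2 ^ k * w)" by (simp add: w_def)
    also have "\<dots> \<le> (2 ^ k) powr \<delta> * L w" by (rule pow) fact
    also have "\<dots> \<le> (2 ^ k) powr \<delta> * (4 * L z)"
      unfolding w using loc[OF z(2) s] by (intro mult_left_mono) auto
    also have "\<dots> \<le> x powr \<delta> * (4 * L z)"
    proof (intro mult_right_mono powr_mono2)
      have "x / z \<le> x" using z that by (simp add: divide_le_eq mult_le_cancel_left1)
      then show "2 ^ k \<le> x" using k2 by simp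
    qed (use pos[OF z(1)] \<open>\<delta> > 0\<close> in auto)
    finally show ?thesis by (simp add: mult_ac)
  qed
  have "\<forall>\<^sub>F n in sequentially. real n \<ge> z"
    by (rule eventually_ge_at_top[of z, THEN eventually_compose_filterlim[OF _ filterlim_real_sequentially]])
  then have "\<forall>\<^sub>F n in sequentially. L (real n) \<le> (4 * L z) * real n powr \<delta>"
    by eventually_elim (rule main)
  then show ?thesis using pos[OF z(1)] by (intro exI[of _ "4 * L z"]) auto
qed

section \<open>Rates in probability\<close>

lemma (in prob_space) bigo_prob_bias_variance:
  fixes U :: "nat \<Rightarrow> 'a \<Rightarrow> real"
  assumes U: "\<And>n. U n \<in> borel_measurable M" "\<And>n. integrable M (\<lambda>\<omega>. (U n \<omega>)\<^sup>2)"
    and w: "\<forall>\<^sub>F n in sequentially. w n > 0"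
    and bias: "\<forall>\<^sub>F n in sequentially. \<bar>expectation (U n) - \<theta>\<bar> \<le> D * w n"
    and var: "\<forall>\<^sub>F n in sequentially. variance (U n) \<le> A * (w n)\<^sup>2"
  shows "bigo_prob M (\<lambda>n \<omega>. U n \<omega> - \<theta>) w"
  unfolding bigo_prob_def
proof (intro allI impI)
  fix \<delta> :: real assume \<delta>: "\<delta> > 0"
  \<comment> \<open>Chebyshev's inequality at the level \<open>t * w n\<close> gives at most \<open>A / t\<^sup>2\<close>; the summand \<open>1\<close> keeps \<open>t\<close> positive when \<open>A = 0\<close>.\<close>
  define t where "t = sqrt (\<bar>A\<bar> / \<delta>) + 1"
  have t: "t > 0" unfolding t_def using \<delta> by (intro add_nonneg_pos) auto
  have tA: "A / t\<^sup>2 \<le> \<delta>"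
  proof -
    have "\<bar>A\<bar> / \<delta> = (sqrt (\<bar>A\<bar> / \<delta>))\<^sup>2" using \<delta> by simp
    also have "\<dots> \<le> t\<^sup>2" unfolding t_def using \<delta> by (intro power_mono) auto
    finally show ?thesis using \<delta> t by (simp add: field_simps)
  qed
  define C where "C = \<bar>D\<bar> + t"
  have "\<forall>\<^sub>F n in sequentially. prob {\<omega> \<in> space M. C < \<bar>(U n \<omega> - \<theta>) / w n\<bar>} \<le> \<delta>"
    using w bias var
  proof eventually_elim
    case (elim n)
    have "{\<omega> \<in> space M. C < \<bar>(U n \<omega> - \<theta>) / w n\<bar>} \<subseteq> {\<omega> \<in> space M. t * w n \<le> \<bar>U n \<omega> - expectation (U n)\<bar>}"
    proof clarify
      fix \<omega> assume "C < \<bar>(U n \<omega> - \<theta>) / w n\<bar>"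
      then have "C * w n < \<bar>U n \<omega> - \<theta>\<bar>" using elim(1) by (simp add: abs_divide less_divide_eq)
      then have "\<bar>D\<bar> * w n + t * w n < \<bar>U n \<omega> - \<theta>\<bar>" by (simp add: C_def distrib_right)
      moreover have "D * w n \<le> \<bar>D\<bar> * w n" using elim(1) by (intro mult_right_mono) auto
      ultimately show "t * w n \<le> \<bar>U n \<omega> - expectation (U n)\<bar>" using elim(2) by linarith
    qed
    moreover have "{\<omega> \<in> space M. t * w n \<le> \<bar>U n \<omega> - expectation (U n)\<bar>} \<in> events"
      using U(1)[of n] by measurable
    ultimately have "prob {\<omega> \<in> space M. C < \<bar>(U n \<omega> - \<theta>) / w n\<bar>} \<le> prob {\<omega> \<in> space M. t * w n \<le> \<bar>U n \<omega> - expectation (U n)\<bar>}"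
      by (rule finite_measure_mono)
    also have "\<dots> \<le> variance (U n) / (t * w n)\<^sup>2"
      using t elim(1) by (intro Chebyshev_inequality U) auto
    also have "\<dots> \<le> A * (w n)\<^sup>2 / (t * w n)\<^sup>2"
      using elim(3) by (intro divide_right_mono) auto
    also have "\<dots> = A / t\<^sup>2" using elim(1) by (simp add: power_mult_distrib)
    finally show ?case using tA by linarith
  qed
  moreover have "C > 0" using t by (simp add: C_def add_nonneg_pos)
  ultimately show "\<exists>C>0. \<forall>\<^sub>F n in sequentially. prob {\<omega> \<in> space M. C < \<bar>(U n \<omega> - \<theta>) / w n\<bar>} \<le> \<delta>"
    by blast
qed

lemma abs_ln_diff_le:
  fixes x q :: real
  assumes "q > 0" "\<bar>x - q\<bar> \<le> q / 2"
  shows "\<bar>ln x - ln q\<bar> \<le> \<bar>x - q\<bar> * (2 / q)"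
proof -
  have x: "x \<ge> q / 2" "x > 0" using assms by linarith+
  have "ln x - ln q \<le> (x - q) / q" using assms x by (intro ln_diff_le) auto
  also have "\<dots> \<le> \<bar>x - q\<bar> / (q / 2)" using assms by (intro frac_le) auto
  finally have 1: "ln x - ln q \<le> \<bar>x - q\<bar> * (2 / q)" by simp
  have "ln q - ln x \<le> (q - x) / x" using assms x by (intro ln_diff_le) auto
  also have "\<dots> \<le> \<bar>x - q\<bar> / (q / 2)" using assms x by (intro frac_le) auto
  finally show ?thesis using 1 by simp
qed

text \<open>
  On the event that \<open>U n\<close> deviates from \<open>q\<close> by at most \<open>q /
  2\<close>, the truncation at \<open>1 / n\<close> is eventually inactive and the logarithm is
  Lipschitz with constant \<open>2 / q\<close>.
\<close>

lemma (in prob_space) bigo_prob_log: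
  fixes U :: "nat \<Rightarrow> 'a \<Rightarrow> real"
  assumes U: "\<And>n. U n \<in> borel_measurable M" and q: "q > 0"
    and w: "\<forall>\<^sub>F n in sequentially. w n > 0" "w \<longlonglongrightarrow> 0"
    and O: "bigo_prob M (\<lambda>n \<omega>. U n \<omega> - q) w"
  shows "bigo_prob M (\<lambda>n \<omega>. - ln (max (U n \<omega>) (1 / real n)) - - ln q) w"
  unfolding bigo_prob_def
proof (intro allI impI)
  fix \<delta> :: real assume "\<delta> > 0"
  then obtain C where C: "C > 0" and ev: "\<forall>\<^sub>F n in sequentially. prob {\<omega> \<in> space M. C < \<bar>(U n \<omega> - q) / w n\<bar>} \<le> \<delta>"
    using O by (auto simp: bigo_prob_def)
  have "(\<lambda>n. C * w n) \<longlonglongrightarrow> C * 0" by (intro tendsto_intros w)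
  then have e1: "\<forall>\<^sub>F n in sequentially. C * w n < q / 2" using q by (intro order_tendstoD) auto
  have e2: "\<forall>\<^sub>F n in sequentially. 1 / real n < q / 2"
    using q by (intro order_tendstoD(2)[OF lim_1_over_n]) auto
  have "\<forall>\<^sub>F n in sequentially. prob {\<omega> \<in> space M. C * (2 / q) < \<bar>(- ln (max (U n \<omega>) (1 / real n)) - - ln q) / w n\<bar>} \<le> \<delta>"
    using ev e1 e2 w(1)
  proof eventually_elim
    case (elim n)
    have "{\<omega> \<in> space M. C * (2 / q) < \<bar>(- ln (max (U n \<omega>) (1 / real n)) - - ln q) / w n\<bar>}
       \<subseteq> {\<omega> \<in> space M. C < \<bar>(U n \<omega> - q) / w n\<bar>}"
    proof clarify
      fix \<omega> assume big: "C * (2 / q) < \<bar>(- ln (max (U n \<omega>) (1 / real n)) - - ln q) / w n\<bar>"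
      show "C < \<bar>(U n \<omega> - q) / w n\<bar>"
      proof (rule ccontr)
        assume "\<not> ?thesis"
        then have le: "\<bar>U n \<omega> - q\<bar> \<le> C * w n" using elim(4) by (simp add: abs_divide not_less divide_le_eq)
        then have close: "\<bar>U n \<omega> - q\<bar> \<le> q / 2" using elim(2) by linarith
        have "max (U n \<omega>) (1 / real n) = U n \<omega>"
          using close elim(3) by (intro max_absorb1) linarith
        then have "\<bar>(- ln (max (U n \<omega>) (1 / real n)) - - ln q) / w n\<bar> = \<bar>ln (U n \<omega>) - ln q\<bar> / w n"
          using elim(4) by (simp add: abs_divide abs_minus_commute)
        also have "\<dots> \<le> (C * w n) * (2 / q) / w n"
          using abs_ln_diff_le[OF q close] mult_right_mono[OF le, of "2 / q"] q elim(4)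
          by (intro divide_right_mono) auto
        also have "\<dots> = C * (2 / q)" using elim(4) by simp
        finally show False using big by linarith
      qed
    qed
    moreover have "{\<omega> \<in> space M. C < \<bar>(U n \<omega> - q) / w n\<bar>} \<in> events"
      using U[of n] by measurable
    ultimately have "prob {\<omega> \<in> space M. C * (2 / q) < \<bar>(- ln (max (U n \<omega>) (1 / real n)) - - ln q) / w n\<bar>}
       \<le> prob {\<omega> \<in> space M. C < \<bar>(U n \<omega> - q) / w n\<bar>}"
      by (rule finite_measure_mono)
    then show ?case using elim(1) by linarith
  qed
  then show "\<exists>C>0. \<forall>\<^sub>F n in sequentially. prob {\<omega> \<in> space M. C < \<bar>(- ln (max (U n \<omega>) (1 / real n)) - - ln q) / w n\<bar>} \<le> \<delta>"
    using C q by (intro exI[of _ "C * (2 / q)"]) auto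
qed

context stationary_m_dependent begin

lemma near_prob_bound_smallo:
  fixes \<epsilon> :: "nat \<Rightarrow> real"
  assumes "assumption_A M X p" "\<And>n. n \<ge> 1 \<Longrightarrow> \<epsilon> n > 0" "\<epsilon> \<longlonglongrightarrow> 0"
  shows "(\<lambda>n. near_prob_bound (\<epsilon> n)) \<in> o(\<lambda>n. \<epsilon> n powr (DIM('a) / 2))"
  unfolding near_prob_bound_def using assms
  by (intro big_sum_in_smallo near_close_prob_smallo) auto

lemma powr_half_DIM_square:
  assumes "x > 0"
  shows "(x powr (DIM('a) / 2))\<^sup>2 = x ^ DIM('a)"
  using assms by (simp add: power2_eq_square powr_realpow flip: powr_add)

lemma ball_vol_factor: "ball_vol DIM('a) x = ball_vol DIM('a) 1 * x ^ DIM('a)"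
  by (simp add: ball_vol_def)

text \<open>
  Bounds the contribution to the bias of the pairs with near indices: the remainder of order \<open>o(1 /
  (n * e powr (d / 2)))\<close>.
\<close>

definition near_bias :: "real \<Rightarrow> nat \<Rightarrow> real" where
  "near_bias e n = real n * (2 * real m + 1) * (near_prob_bound e + ball_vol DIM('a) e * q2 p)
     / (real (n choose 2) * ball_vol DIM('a) e)"

lemma Q_est_bias:
  assumes e: "0 < \<epsilon> n" "\<epsilon> n \<le> 1" and p: "p \<in> H2_class \<alpha> K" "\<alpha> > 0" and n: "n \<ge> 2"
  shows "\<bar>expectation (Q_est X \<epsilon> n) - q2 p\<bar> \<le> 1 / 2 * K\<^sup>2 * \<epsilon> n powr (2 * \<alpha>) + near_bias (\<epsilon> n) n"
proof -
  define b where "b = ball_vol DIM('a) (\<epsilon> n)"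
  define c where "c = real (n choose 2)"
  have b: "b > 0" unfolding b_def by (rule ball_vol_pos[OF e(1)])
  have c: "c > 0" unfolding c_def using n by (simp add: zero_less_binomial)
  have "expectation (Q_est X \<epsilon> n) = expectation (close_pairs X (\<epsilon> n) n) / c / b"
    unfolding Q_est_def[abs_def] b_def c_def by simp
  then have "expectation (Q_est X \<epsilon> n) - q2 p = (expectation (close_pairs X (\<epsilon> n) n) - c * (b * q2 p)) / (c * b)"
    using b c by (simp add: field_simps)
  then have "\<bar>expectation (Q_est X \<epsilon> n) - q2 p\<bar> = \<bar>expectation (close_pairs X (\<epsilon> n) n) - c * (b * q2 p)\<bar> / (c * b)"
    using b c by (simp add: abs_divide abs_mult)
  also have "\<dots> \<le> (c * (b * (K\<^sup>2 / 2 * \<epsilon> n powr (2 * \<alpha>))) + real n * (2 * real m + 1) * (near_prob_bound (\<epsilon> n) + b * q2 p)) / (c * b)"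
    using expectation_close_pairs_bias[of "\<epsilon> n" \<alpha> K n] e p b c
    by (intro divide_right_mono) (auto simp: b_def c_def)
  also have "\<dots> = 1 / 2 * K\<^sup>2 * \<epsilon> n powr (2 * \<alpha>) + near_bias (\<epsilon> n) n"
    using b c unfolding near_bias_def b_def[symmetric] c_def[symmetric] by (simp add: add_divide_distrib)
  finally show ?thesis .
qed

lemma near_bias_smallo:
  fixes \<epsilon> :: "nat \<Rightarrow> real"
  assumes A: "assumption_A M X p" and pos: "\<And>n. n \<ge> 1 \<Longrightarrow> \<epsilon> n > 0" and lim: "\<epsilon> \<longlonglongrightarrow> 0"
  shows "(\<lambda>n. near_bias (\<epsilon> n) n) \<in> o(\<lambda>n. 1 / (real n * \<epsilon> n powr (DIM('a) / 2)))"
proof (rule smalloI_tendsto)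
  define s where "s = 2 * real m + 1"
  define v where "v = ball_vol DIM('a) 1"
  define h where "h n = \<epsilon> n powr (DIM('a) / 2)" for n
  define B where "B n = 4 * s * (near_prob_bound (\<epsilon> n) / h n / v + q2 p * h n)" for n
  have v: "v > 0" unfolding v_def by (rule ball_vol_pos) simp
  have s: "s \<ge> 0" by (simp add: s_def)
  have "(\<lambda>n. near_prob_bound (\<epsilon> n) / h n) \<longlonglongrightarrow> 0"
    unfolding h_def by (rule smalloD_tendsto[OF near_prob_bound_smallo[OF A pos lim]])
  moreover have "h \<longlonglongrightarrow> 0"
    unfolding h_def using tendsto_powr2[OF lim tendsto_const, of "DIM('a) / 2"] pos
    by (auto simp: eventually_sequentially intro: less_imp_le)
  ultimately have "B \<longlonglongrightarrow> 4 * s * (0 / v + q2 p * 0)"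
    unfolding B_def using v by (intro tendsto_intros) auto
  then have B0: "B \<longlonglongrightarrow> 0" by simp
  have bound: "0 \<le> near_bias (\<epsilon> n) n / (1 / (real n * h n)) \<and> near_bias (\<epsilon> n) n / (1 / (real n * h n)) \<le> B n"
    if n: "n \<ge> 2" for n
  proof -
    have e: "\<epsilon> n > 0" using pos n by simp
    then have h: "h n > 0" by (simp add: h_def)
    define b where "b = ball_vol DIM('a) (\<epsilon> n)"
    have b: "b = v * (h n)\<^sup>2"
      unfolding b_def h_def v_def powr_half_DIM_square[OF e] by (rule ball_vol_factor)
    have b0: "b > 0" using v h by (simp add: b)
    define \<rho> where "\<rho> = near_prob_bound (\<epsilon> n)"
    have \<rho>: "\<rho> \<ge> 0" unfolding \<rho>_def by (rule near_prob_bound_nonneg)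
    have num: "0 \<le> real n * s * (\<rho> + b * q2 p)"
      using \<rho> b0 s q2_nonneg by simp
    have c: "0 < (real n)\<^sup>2 / 4" "(real n)\<^sup>2 / 4 \<le> real (n choose 2)"
      using n choose_two_lower[OF n] by auto
    have nb: "near_bias (\<epsilon> n) n = real n * s * (\<rho> + b * q2 p) / (real (n choose 2) * b)"
      by (simp add: near_bias_def s_def \<rho>_def b_def)
    also have "\<dots> \<le> real n * s * (\<rho> + b * q2 p) / ((real n)\<^sup>2 / 4 * b)"
      using num b0 c n by (intro divide_left_mono mult_right_mono mult_pos_pos) auto
    finally have "near_bias (\<epsilon> n) n * (real n * h n) \<le> real n * s * (\<rho> + b * q2 p) / ((real n)\<^sup>2 / 4 * b) * (real n * h n)"
      using h by (intro mult_right_mono) auto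
    also have "\<dots> = 4 * s * (\<rho> * h n / b + q2 p * h n)"
      using b0 n by (simp add: field_simps power2_eq_square)
    also have "\<rho> * h n / b = \<rho> / h n / v"
      using h v by (simp add: b power2_eq_square)
    finally have "near_bias (\<epsilon> n) n * (real n * h n) \<le> B n"
      by (simp add: B_def \<rho>_def)
    moreover have "near_bias (\<epsilon> n) n \<ge> 0" unfolding nb using num b0 by simp
    ultimately show ?thesis using h by simp
  qed
  show "(\<lambda>n. near_bias (\<epsilon> n) n / (1 / (real n * \<epsilon> n powr (DIM('a) / 2)))) \<longlonglongrightarrow> 0"
    unfolding h_def[symmetric]
    by (rule tendsto_sandwich[OF _ _ tendsto_const B0])
       (use bound in \<open>auto simp: eventually_sequentially intro!: exI[of _ 2]\<close>)
  show "\<forall>\<^sub>F n in sequentially. 1 / (real n * \<epsilon> n powr (DIM('a) / 2)) \<noteq> 0"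
    by (rule eventually_sequentiallyI[of 1]) (use pos in force)
qed

lemma Q_est_measurable: "Q_est X \<epsilon> n \<in> borel_measurable M"
  using borel_measurable_integrable[OF integrable_close_pairs] unfolding Q_est_def[abs_def] by measurable

lemma Q_est_variance_le:
  fixes \<epsilon> :: "nat \<Rightarrow> real"
  assumes e: "\<epsilon> n > 0" and n: "n \<ge> 2"
  defines "s \<equiv> 2 * real m + 1" and "b \<equiv> ball_vol DIM('a) (\<epsilon> n)"
  shows "variance (Q_est X \<epsilon> n) \<le> 64 * s * ((LINT x|lborel. p x ^ 3) / real n + 5 * q2 p * s / ((real n)\<^sup>2 * b)
     + s\<^sup>2 * near_prob_bound (\<epsilon> n) / ((real n) ^ 3 * b\<^sup>2))"
proof -
  define c where "c = real (n choose 2)"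
  define \<rho> where "\<rho> = near_prob_bound (\<epsilon> n)"
  define k where "k = (LINT x|lborel. p x ^ 3)"
  have b: "b > 0" unfolding b_def by (rule ball_vol_pos[OF e])
  have c: "0 < (real n)\<^sup>2 / 4" "(real n)\<^sup>2 / 4 \<le> c"
    using n choose_two_lower[OF n] by (auto simp: c_def)
  have eq: "Q_est X \<epsilon> n = (\<lambda>\<omega>. close_pairs X (\<epsilon> n) n \<omega> / (c * b))"
    unfolding Q_est_def[abs_def] c_def b_def by simp
  have "variance (Q_est X \<epsilon> n) = expectation (\<lambda>\<omega>. (close_pairs X (\<epsilon> n) n \<omega> - expectation (close_pairs X (\<epsilon> n) n))\<^sup>2 / (c * b)\<^sup>2)"
    unfolding eq by (simp add: power_divide flip: diff_divide_distrib)
  also have "\<dots> = variance (close_pairs X (\<epsilon> n) n) / (c * b)\<^sup>2"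
    by simp
  also have "\<dots> \<le> 4 * (real n * s * (k * b\<^sup>2 * (real n)\<^sup>2 + 5 * q2 p * b * real n * s + \<rho> * s\<^sup>2)) / (c * b)\<^sup>2"
    unfolding k_def \<rho>_def b_def s_def using variance_close_pairs_le[of "\<epsilon> n" n] e
    by (intro divide_right_mono) auto
  also have "\<dots> \<le> 4 * (real n * s * (k * b\<^sup>2 * (real n)\<^sup>2 + 5 * q2 p * b * real n * s + \<rho> * s\<^sup>2)) / ((real n)\<^sup>2 / 4 * b)\<^sup>2"
  proof (intro divide_left_mono power_mono mult_right_mono mult_pos_pos)
    show "0 \<le> 4 * (real n * s * (k * b\<^sup>2 * (real n)\<^sup>2 + 5 * q2 p * b * real n * s + \<rho> * s\<^sup>2))"
      using cube_integral_nonneg b q2_nonneg near_prob_bound_nonneg by (simp add: k_def \<rho>_def s_def)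
  qed (use b c in auto)
  also have "\<dots> = 64 * s * (k / real n + 5 * q2 p * s / ((real n)\<^sup>2 * b) + s\<^sup>2 * \<rho> / ((real n) ^ 3 * b\<^sup>2))"
    using b n by (simp add: field_simps power2_eq_square power3_eq_cube)
  finally show ?thesis by (simp add: k_def \<rho>_def)
qed

text \<open>
  Both regimes of the theorem reduce to comparing \<open>1 / n\<close>, \<open>1 / (n\<^sup>2 *
  \<epsilon> n ^ d)\<close> and \<open>\<epsilon> n powr (4 * \<alpha>)\<close> with the square of
  the rate. The contribution of small lags is of order \<open>1 / y ^ 3\<close> with \<open>y = n *
  \<epsilon> n powr (d / 2)\<close>. It is at most the second of these terms, \<open>1 /
  y\<^sup>2\<close>, since \<open>y > 1\<close> eventually.
\<close>

lemma estimator_rates: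
  fixes \<epsilon> w :: "nat \<Rightarrow> real"
  assumes A: "assumption_A M X p" and pos: "\<And>n. n \<ge> 1 \<Longrightarrow> \<epsilon> n > 0" and lim: "\<epsilon> \<longlonglongrightarrow> 0"
    and p: "p \<in> H2_class \<alpha> K" "\<alpha> > 0"
    and w: "\<And>n. n \<ge> 1 \<Longrightarrow> w n > 0" "w \<longlonglongrightarrow> 0"
    and w1: "\<forall>\<^sub>F n in sequentially. 1 / real n \<le> (w n)\<^sup>2"
    and w2: "\<forall>\<^sub>F n in sequentially. 1 / ((real n)\<^sup>2 * \<epsilon> n ^ DIM('a)) \<le> C2 * (w n)\<^sup>2"
    and w3: "\<forall>\<^sub>F n in sequentially. \<epsilon> n powr (2 * \<alpha>) \<le> C3 * w n"
  shows "bigo_prob M (\<lambda>n \<omega>. Q_est X \<epsilon> n \<omega> - q2 p) w" "bigo_prob M (\<lambda>n \<omega>. H_est X \<epsilon> n \<omega> - h2 p) w"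
proof -
  define s where "s = 2 * real m + 1"
  define v where "v = ball_vol DIM('a) 1"
  define h where "h n = \<epsilon> n powr (DIM('a) / 2)" for n
  define k where "k = (LINT x|lborel. p x ^ 3)"
  have v: "v > 0" unfolding v_def by (rule ball_vol_pos) simp
  have s: "s \<ge> 0" by (simp add: s_def)
  have k: "k \<ge> 0" unfolding k_def by (rule cube_integral_nonneg)
  have ge2: "\<forall>\<^sub>F n::nat in sequentially. n \<ge> 2" by (rule eventually_ge_at_top)
  have wpos: "\<forall>\<^sub>F n in sequentially. w n > 0" using w(1) by (auto intro!: eventually_sequentiallyI[of 1])
  have e1: "\<forall>\<^sub>F n in sequentially. \<epsilon> n \<le> 1" using order_tendstoD(2)[OF lim, of 1] by (auto elim: eventually_mono)
  have "(\<lambda>n. C2 * (w n)\<^sup>2) \<longlonglongrightarrow> C2 * 0\<^sup>2" by (intro tendsto_intros w)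
  then have small: "\<forall>\<^sub>F n in sequentially. C2 * (w n)\<^sup>2 < 1" by (intro order_tendstoD) auto
  have h2: "\<forall>\<^sub>F n in sequentially. 1 / (real n * h n) \<le> sqrt \<bar>C2\<bar> * w n \<and> 1 / (real n * h n) ^ 3 \<le> C2 * (w n)\<^sup>2"
    using w2 small ge2
  proof eventually_elim
    case (elim n)
    have e: "\<epsilon> n > 0" using pos elim by simp
    define y where "y = real n * h n"
    have y: "y > 0" using e elim by (simp add: y_def h_def)
    have "(real n)\<^sup>2 * \<epsilon> n ^ DIM('a) = y\<^sup>2"
      unfolding y_def h_def power_mult_distrib powr_half_DIM_square[OF e] ..
    then have y2: "1 / y\<^sup>2 \<le> C2 * (w n)\<^sup>2" using elim by simp
    then have "1 / y\<^sup>2 < 1" using elim by linarith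
    then have "y\<^sup>2 > 1" using y by (simp add: divide_less_eq)
    then have y1: "y > 1" using y power_less_imp_less_base[of 1 2 y] by simp
    have "(1 / y)\<^sup>2 \<le> (sqrt \<bar>C2\<bar> * w n)\<^sup>2"
      using y2 abs_ge_self[of C2] mult_right_mono[of C2 "\<bar>C2\<bar>" "(w n)\<^sup>2"] by (simp add: power_divide power_mult_distrib)
    then have "1 / y \<le> sqrt \<bar>C2\<bar> * w n"
      by (rule power2_le_imp_le) (use w(1)[of n] elim in \<open>auto intro: less_imp_le\<close>)
    moreover have "1 / y ^ 3 \<le> 1 / y\<^sup>2"
      using y1 by (intro divide_left_mono power_increasing) auto
    ultimately show ?case using y2 unfolding y_def by linarith
  qed
  have o: "(\<lambda>n. near_prob_bound (\<epsilon> n)) \<in> o(h)" "(\<lambda>n. near_bias (\<epsilon> n) n) \<in> o(\<lambda>n. 1 / (real n * h n))"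
    unfolding h_def by (rule near_prob_bound_smallo near_bias_smallo, rule A, rule pos, assumption, rule lim)+
  have near: "\<forall>\<^sub>F n in sequentially. near_prob_bound (\<epsilon> n) \<le> h n"
    using landau_o.smallD[OF o(1) zero_less_one]
    by eventually_elim (simp add: h_def near_prob_bound_nonneg)
  have nbias: "\<forall>\<^sub>F n in sequentially. near_bias (\<epsilon> n) n \<le> 1 / (real n * h n)"
    using landau_o.smallD[OF o(2) zero_less_one] ge2
    by eventually_elim (auto simp: h_def abs_le_iff)
  have bias: "\<forall>\<^sub>F n in sequentially. \<bar>expectation (Q_est X \<epsilon> n) - q2 p\<bar> \<le> (1 / 2 * K\<^sup>2 * C3 + sqrt \<bar>C2\<bar>) * w n"
    using e1 ge2 nbias h2 w3
  proof eventually_elim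
    case (elim n)
    have "\<bar>expectation (Q_est X \<epsilon> n) - q2 p\<bar> \<le> 1 / 2 * K\<^sup>2 * \<epsilon> n powr (2 * \<alpha>) + near_bias (\<epsilon> n) n"
      using elim pos by (intro Q_est_bias p) auto
    also have "\<dots> \<le> 1 / 2 * K\<^sup>2 * (C3 * w n) + sqrt \<bar>C2\<bar> * w n"
      using elim by (intro add_mono mult_left_mono) auto
    finally show ?case by (simp add: algebra_simps)
  qed
  have var: "\<forall>\<^sub>F n in sequentially. variance (Q_est X \<epsilon> n) \<le>
    64 * s * (k + 5 * q2 p * s / v * C2 + s\<^sup>2 / v\<^sup>2 * C2) * (w n)\<^sup>2"
    using ge2 near h2 w1 w2
  proof eventually_elim
    case (elim n)
    have e: "\<epsilon> n > 0" using pos elim by simp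
    have hn: "h n > 0" using e by (simp add: h_def)
    have he: "(h n)\<^sup>2 = \<epsilon> n ^ DIM('a)" unfolding h_def by (rule powr_half_DIM_square[OF e])
    have b: "ball_vol DIM('a) (\<epsilon> n) = v * (h n)\<^sup>2" unfolding he v_def by (rule ball_vol_factor)
    have t1: "k / real n \<le> k * (w n)\<^sup>2" using mult_left_mono[OF elim(4) k] by simp
    have "5 * q2 p * s / ((real n)\<^sup>2 * (v * (h n)\<^sup>2)) = 5 * q2 p * s / v * (1 / ((real n)\<^sup>2 * (h n)\<^sup>2))"
      by simp
    also have "\<dots> \<le> 5 * q2 p * s / v * (C2 * (w n)\<^sup>2)"
      using elim(5) q2_nonneg s v unfolding he by (intro mult_left_mono) auto
    finally have t2: "5 * q2 p * s / ((real n)\<^sup>2 * (v * (h n)\<^sup>2)) \<le> 5 * q2 p * s / v * (C2 * (w n)\<^sup>2)" .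
    have "s\<^sup>2 * near_prob_bound (\<epsilon> n) / ((real n) ^ 3 * (v * (h n)\<^sup>2)\<^sup>2) \<le> s\<^sup>2 * h n / ((real n) ^ 3 * (v * (h n)\<^sup>2)\<^sup>2)"
      using elim(2) by (intro divide_right_mono mult_left_mono) auto
    also have "\<dots> = s\<^sup>2 / v\<^sup>2 * (1 / (real n * h n) ^ 3)"
      using hn v elim(1) by (simp add: power2_eq_square power3_eq_cube)
    also have "\<dots> \<le> s\<^sup>2 / v\<^sup>2 * (C2 * (w n)\<^sup>2)"
      using elim(3) by (intro mult_left_mono) auto
    finally have t3: "s\<^sup>2 * near_prob_bound (\<epsilon> n) / ((real n) ^ 3 * (v * (h n)\<^sup>2)\<^sup>2) \<le> s\<^sup>2 / v\<^sup>2 * (C2 * (w n)\<^sup>2)" .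
    have "variance (Q_est X \<epsilon> n) \<le> 64 * s * (k / real n + 5 * q2 p * s / ((real n)\<^sup>2 * (v * (h n)\<^sup>2))
     + s\<^sup>2 * near_prob_bound (\<epsilon> n) / ((real n) ^ 3 * (v * (h n)\<^sup>2)\<^sup>2))"
      using Q_est_variance_le[of \<epsilon> n] e elim(1) unfolding b s_def k_def by simp
    also have "\<dots> \<le> 64 * s * (k * (w n)\<^sup>2 + 5 * q2 p * s / v * (C2 * (w n)\<^sup>2) + s\<^sup>2 / v\<^sup>2 * (C2 * (w n)\<^sup>2))"
      using t1 t2 t3 s by (intro mult_left_mono add_mono) auto
    also have "\<dots> = 64 * s * (k + 5 * q2 p * s / v * C2 + s\<^sup>2 / v\<^sup>2 * C2) * (w n)\<^sup>2"
      by (simp add: algebra_simps)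
    finally show ?case .
  qed
  have int: "integrable M (\<lambda>\<omega>. (Q_est X \<epsilon> n \<omega>)\<^sup>2)" for n
    using integrable_close_pairs_square unfolding Q_est_def[abs_def] by (simp add: power_divide)
  show Q: "bigo_prob M (\<lambda>n \<omega>. Q_est X \<epsilon> n \<omega> - q2 p) w"
    by (rule bigo_prob_bias_variance[OF Q_est_measurable int wpos bias var])
  show "bigo_prob M (\<lambda>n \<omega>. H_est X \<epsilon> n \<omega> - h2 p) w"
    unfolding H_est_def h2_def
    by (rule bigo_prob_log[OF Q_est_measurable q2_positive wpos w(2) Q])
qed

end

lemma asymp_equiv_eventually_between:
  fixes f g :: "nat \<Rightarrow> real"
  assumes "f \<sim>[sequentially] g" and g: "\<forall>\<^sub>F n in sequentially. g n > 0"
  shows "\<forall>\<^sub>F n in sequentially. g n / 2 \<le> f n \<and> f n \<le> 2 * g n"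
proof -
  have "\<forall>\<^sub>F n in sequentially. f n \<noteq> 0 \<or> g n \<noteq> 0" using g by eventually_elim simp
  from asymp_equivD_strong[OF assms(1) this] have "(\<lambda>n. f n / g n) \<longlonglongrightarrow> 1" .
  then have "\<forall>\<^sub>F n in sequentially. 1 / 2 < f n / g n \<and> f n / g n < 2"
    by (intro eventually_conj order_tendstoD) auto
  with g show ?thesis
    by eventually_elim (auto simp: field_simps)
qed

theorem theorem4:
  fixes M :: "'w measure" and X :: "nat \<Rightarrow> 'w \<Rightarrow> 'a::euclidean_space"
    and p :: "'a \<Rightarrow> real" and m :: nat and \<epsilon> :: "nat \<Rightarrow> real" and \<alpha> K :: real
    and L :: "real \<Rightarrow> real"
  assumes "prob_space M"
    and "strictly_stationary M X"
    and "m_dependent M m X"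
    and "\<And>i. i \<ge> 1 \<Longrightarrow> has_density M (X i) p"
    and "assumption_A M X p"
    and "\<And>n. n \<ge> 1 \<Longrightarrow> \<epsilon> n > 0"
    and "\<epsilon> \<longlonglongrightarrow> 0"
    and "0 < \<alpha>" and "\<alpha> \<le> 1" and "K > 0"
    and "p \<in> H2_class \<alpha> K"
    and "slowly_varying L"
  shows
    "(\<exists>r \<in> o(\<lambda>n. 1 / (real n * \<epsilon> n powr (DIM('a) / 2))). \<forall>n\<ge>2.
        \<bar>prob_space.expectation M (Q_est X \<epsilon> n) - q2 p\<bar> \<le> 1 / 2 * K\<^sup>2 * \<epsilon> n powr (2 * \<alpha>) + r n)
     \<and>
     (\<forall>c>0. \<alpha> \<le> DIM('a) / 4 \<longrightarrow>
        \<epsilon> \<sim>[sequentially] (\<lambda>n. c * real n powr (- (2 / (4 * \<alpha> + DIM('a))))) \<longrightarrow>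
        bigo_prob M (\<lambda>n \<omega>. Q_est X \<epsilon> n \<omega> - q2 p)
          (\<lambda>n. real n powr (- (4 * \<alpha> / (4 * \<alpha> + DIM('a))))) \<and>
        bigo_prob M (\<lambda>n \<omega>. H_est X \<epsilon> n \<omega> - h2 p)
          (\<lambda>n. real n powr (- (4 * \<alpha> / (4 * \<alpha> + DIM('a))))))
     \<and>
     (\<forall>a::ereal. 0 < a \<longrightarrow> \<alpha> > DIM('a) / 4 \<longrightarrow>
        \<epsilon> \<sim>[sequentially] (\<lambda>n. L (real n) * real n powr (- (1 / DIM('a)))) \<longrightarrow>
        (\<lambda>n. ereal (real n * \<epsilon> n ^ DIM('a))) \<longlonglongrightarrow> a \<longrightarrow>
        bigo_prob M (\<lambda>n \<omega>. Q_est X \<epsilon> n \<omega> - q2 p) (\<lambda>n. real n powr (- (1 / 2))) \<and>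
        bigo_prob M (\<lambda>n \<omega>. H_est X \<epsilon> n \<omega> - h2 p) (\<lambda>n. real n powr (- (1 / 2))))"
proof -
  note A = assms(5) and pos = assms(6) and lim = assms(7) and \<alpha> = assms(8) and p = assms(11) and L = assms(12)
  interpret stationary_m_dependent M X p m
    using assms(1-5)
    by (auto simp: stationary_m_dependent_def stationary_m_dependent_axioms_def assumption_A_def)
  define d where "d = real DIM('a)"
  have d: "d > 0" by (simp add: d_def)
  have bias: "\<exists>r \<in> o(\<lambda>n. 1 / (real n * \<epsilon> n powr (DIM('a) / 2))). \<forall>n\<ge>2.
      \<bar>expectation (Q_est X \<epsilon> n) - q2 p\<bar> \<le> 1 / 2 * K\<^sup>2 * \<epsilon> n powr (2 * \<alpha>) + r n"
  proof -
    \<comment> \<open>The smoothness class controls shifts of length at most \<open>1\<close>; the finitely many \<open>n\<close> with \<open>\<epsilon> n > 1\<close> are absorbed into the remainder.\<close>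
    define r where "r n = (if \<epsilon> n \<le> 1 then near_bias (\<epsilon> n) n else \<bar>expectation (Q_est X \<epsilon> n) - q2 p\<bar>)" for n
    have "\<forall>\<^sub>F n in sequentially. \<epsilon> n < 1" using order_tendstoD(2)[OF lim, of 1] by simp
    then have ev: "\<forall>\<^sub>F n in sequentially. near_bias (\<epsilon> n) n = r n" by eventually_elim (simp add: r_def)
    have "(\<lambda>n. near_bias (\<epsilon> n) n) \<in> o(\<lambda>n. 1 / (real n * \<epsilon> n powr (DIM('a) / 2)))"
      using A pos lim by (rule near_bias_smallo)
    then have "r \<in> o(\<lambda>n. 1 / (real n * \<epsilon> n powr (DIM('a) / 2)))"
      by (simp only: landau_o.small.in_cong[OF ev])
    moreover have "\<bar>expectation (Q_est X \<epsilon> n) - q2 p\<bar> \<le> 1 / 2 * K\<^sup>2 * \<epsilon> n powr (2 * \<alpha>) + r n" if "n \<ge> 2" for n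
    proof (cases "\<epsilon> n \<le> 1")
      case True
      moreover have "\<epsilon> n > 0" using that by (intro pos) simp
      ultimately show ?thesis
        using Q_est_bias[of \<epsilon> n \<alpha> K] p \<alpha> that by (simp add: r_def)
    qed (simp add: r_def)
    ultimately show ?thesis by blast
  qed
  have ii: "bigo_prob M (\<lambda>n \<omega>. Q_est X \<epsilon> n \<omega> - q2 p) (\<lambda>n. real n powr (- (4 * \<alpha> / (4 * \<alpha> + DIM('a))))) \<and>
        bigo_prob M (\<lambda>n \<omega>. H_est X \<epsilon> n \<omega> - h2 p) (\<lambda>n. real n powr (- (4 * \<alpha> / (4 * \<alpha> + DIM('a)))))"
    if c: "c > 0" and small: "\<alpha> \<le> DIM('a) / 4"
      and eps: "\<epsilon> \<sim>[sequentially] (\<lambda>n. c * real n powr (- (2 / (4 * \<alpha> + DIM('a)))))" for c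
  proof -
    define \<gamma> where "\<gamma> = 4 * \<alpha> / (4 * \<alpha> + d)"
    define \<beta> where "\<beta> = 2 / (4 * \<alpha> + d)"
    define w where "w = (\<lambda>n. real n powr (- \<gamma>))"
    have ad: "4 * \<alpha> + d > 0" using \<alpha> d by simp
    have \<gamma>: "\<gamma> > 0" "2 * \<gamma> \<le> 1" using \<alpha> ad small by (auto simp: \<gamma>_def d_def field_simps)
    have e1: "- \<beta> * (2 * \<alpha>) = - \<gamma>" by (simp add: \<beta>_def \<gamma>_def)
    have e2: "- 2 - (- \<beta> * d) = - \<gamma> * 2" using ad by (simp add: \<beta>_def \<gamma>_def field_simps)
    have w2: "(w n)\<^sup>2 = real n powr (- \<gamma> * 2)" for n
      by (simp add: w_def power2_eq_square mult.commute flip: powr_add)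
    have ge1: "\<forall>\<^sub>F n::nat in sequentially. n \<ge> 1" by (rule eventually_ge_at_top)
    have "\<forall>\<^sub>F n in sequentially. c * real n powr (- \<beta>) > 0"
      using ge1 by eventually_elim (simp add: c)
    then have between: "\<forall>\<^sub>F n in sequentially. c * real n powr (- \<beta>) / 2 \<le> \<epsilon> n \<and> \<epsilon> n \<le> 2 * (c * real n powr (- \<beta>))"
      using eps unfolding \<beta>_def d_def by (intro asymp_equiv_eventually_between)
    have v1: "\<forall>\<^sub>F n in sequentially. 1 / real n \<le> (w n)\<^sup>2"
      using ge1
    proof eventually_elim
      case (elim n)
      have "1 / real n = real n powr (- 1)" using elim by (simp add: powr_minus_divide)
      also have "\<dots> \<le> real n powr (- \<gamma> * 2)" using elim \<gamma> by (intro powr_mono) auto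
      finally show ?case by (simp add: w2)
    qed
    have v2: "\<forall>\<^sub>F n in sequentially. 1 / ((real n)\<^sup>2 * \<epsilon> n ^ DIM('a)) \<le> (2 / c) powr d * (w n)\<^sup>2"
      using ge1 between
    proof eventually_elim
      case (elim n)
      have n: "real n > 0" using elim by simp
      have "(c / 2) powr d * real n powr (- \<beta> * d) = (c * real n powr (- \<beta>) / 2) powr d"
        using c n by (simp add: powr_mult powr_divide powr_powr)
      also have "\<dots> \<le> \<epsilon> n powr d" using elim c n d by (intro powr_mono2) auto
      also have "\<dots> = \<epsilon> n ^ DIM('a)" using pos elim by (simp add: d_def powr_realpow)
      finally have le: "(c / 2) powr d * real n powr (- \<beta> * d) \<le> \<epsilon> n ^ DIM('a)" .
      have "1 / ((real n)\<^sup>2 * \<epsilon> n ^ DIM('a)) \<le> 1 / ((real n)\<^sup>2 * ((c / 2) powr d * real n powr (- \<beta> * d)))"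
        using le n c pos elim by (intro divide_left_mono mult_left_mono mult_pos_pos) auto
      also have "\<dots> = (2 / c) powr d * (real n powr (- 2) / real n powr (- \<beta> * d))"
        using n c by (simp add: powr_divide powr_minus powr_numeral field_simps)
      also have "real n powr (- 2) / real n powr (- \<beta> * d) = (w n)\<^sup>2"
        unfolding w2 powr_diff[symmetric] e2 ..
      finally show ?case .
    qed
    have v3: "\<forall>\<^sub>F n in sequentially. \<epsilon> n powr (2 * \<alpha>) \<le> (2 * c) powr (2 * \<alpha>) * w n"
      using ge1 between
    proof eventually_elim
      case (elim n)
      have "\<epsilon> n powr (2 * \<alpha>) \<le> (2 * (c * real n powr (- \<beta>))) powr (2 * \<alpha>)"
        using elim pos[of n] \<alpha> by (intro powr_mono2) auto
      also have "\<dots> = (2 * c) powr (2 * \<alpha>) * real n powr (- \<beta> * (2 * \<alpha>))"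
        using c by (simp add: powr_mult powr_powr)
      finally show ?case unfolding e1 w_def .
    qed
    have "w \<longlonglongrightarrow> 0"
      unfolding w_def using \<gamma> by (intro tendsto_neg_powr filterlim_real_sequentially) auto
    then have "bigo_prob M (\<lambda>n \<omega>. Q_est X \<epsilon> n \<omega> - q2 p) w" "bigo_prob M (\<lambda>n \<omega>. H_est X \<epsilon> n \<omega> - h2 p) w"
      using estimator_rates[OF A pos lim p \<alpha> _ _ v1 v2 v3] by (auto simp: w_def)
    then show ?thesis by (simp add: w_def \<gamma>_def d_def)
  qed
  have iii: "bigo_prob M (\<lambda>n \<omega>. Q_est X \<epsilon> n \<omega> - q2 p) (\<lambda>n. real n powr (- (1 / 2))) \<and>
        bigo_prob M (\<lambda>n \<omega>. H_est X \<epsilon> n \<omega> - h2 p) (\<lambda>n. real n powr (- (1 / 2)))"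
    if a: "0 < a" and big: "\<alpha> > DIM('a) / 4"
      and eps: "\<epsilon> \<sim>[sequentially] (\<lambda>n. L (real n) * real n powr (- (1 / DIM('a))))"
      and na: "(\<lambda>n. ereal (real n * \<epsilon> n ^ DIM('a))) \<longlonglongrightarrow> a" for a :: ereal
  proof -
    define w where "w = (\<lambda>n. real n powr (- (1 / 2)))"
    \<comment> \<open>The growth exponent allowed to \<open>L\<close> for which \<open>\<epsilon> n powr (2 * \<alpha>)\<close> is exactly of order \<open>n powr (- 1 / 2)\<close>.\<close>
    define \<eta> where "\<eta> = 1 / d - 1 / (4 * \<alpha>)"
    have \<eta>: "\<eta> > 0" using big \<alpha> d by (simp add: \<eta>_def d_def field_simps)
    have e1: "(\<eta> + - (1 / d)) * (2 * \<alpha>) = - (1 / 2)" using \<alpha> d by (simp add: \<eta>_def field_simps)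
    have w2: "(w n)\<^sup>2 = 1 / real n" if "n \<ge> 1" for n
      using that by (simp add: w_def power2_eq_square powr_minus_divide flip: powr_add)
    have ge1: "\<forall>\<^sub>F n::nat in sequentially. n \<ge> 1" by (rule eventually_ge_at_top)
    have Lpos: "L (real n) > 0" if "n \<ge> 1" for n using L that by (simp add: slowly_varying_def)
    have v1: "\<forall>\<^sub>F n in sequentially. 1 / real n \<le> (w n)\<^sup>2"
      using ge1 by eventually_elim (simp add: w2)
    obtain \<kappa> :: real where \<kappa>: "0 < \<kappa>" "ereal \<kappa> < a"
      using ereal_dense2[OF a] by auto
    have v2: "\<forall>\<^sub>F n in sequentially. 1 / ((real n)\<^sup>2 * \<epsilon> n ^ DIM('a)) \<le> 1 / \<kappa> * (w n)\<^sup>2"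
      using ge1 order_tendstoD(1)[OF na \<kappa>(2)]
    proof eventually_elim
      case (elim n)
      then have "\<kappa> < real n * \<epsilon> n ^ DIM('a)" by simp
      then have "1 / (real n * (real n * \<epsilon> n ^ DIM('a))) \<le> 1 / (real n * \<kappa>)"
        using elim \<kappa> pos by (intro divide_left_mono mult_left_mono mult_pos_pos) auto
      then show ?case unfolding w2[OF elim(1)] power2_eq_square[of "real n"] by (simp add: mult_ac)
    qed
    obtain C where C: "C > 0" and LC: "\<forall>\<^sub>F n in sequentially. L (real n) \<le> C * real n powr \<eta>"
      using slowly_varying_bounded_by_power[OF L \<eta>] by blast
    have "\<forall>\<^sub>F n in sequentially. L (real n) * real n powr (- (1 / d)) > 0"
      using ge1 by eventually_elim (simp add: Lpos)
    then have between: "\<forall>\<^sub>F n in sequentially. L (real n) * real n powr (- (1 / d)) / 2 \<le> \<epsilon> n \<and>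
        \<epsilon> n \<le> 2 * (L (real n) * real n powr (- (1 / d)))"
      using eps unfolding d_def by (intro asymp_equiv_eventually_between)
    have v3: "\<forall>\<^sub>F n in sequentially. \<epsilon> n powr (2 * \<alpha>) \<le> (2 * C) powr (2 * \<alpha>) * w n"
      using ge1 between LC
    proof eventually_elim
      case (elim n)
      have "\<epsilon> n \<le> 2 * (L (real n) * real n powr (- (1 / d)))" using elim by simp
      also have "\<dots> \<le> 2 * ((C * real n powr \<eta>) * real n powr (- (1 / d)))"
        using elim by (intro mult_left_mono mult_right_mono) auto
      also have "\<dots> = 2 * C * real n powr (\<eta> + - (1 / d))"
        by (subst powr_add) simp
      finally have "\<epsilon> n powr (2 * \<alpha>) \<le> (2 * C * real n powr (\<eta> + - (1 / d))) powr (2 * \<alpha>)"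
        using elim pos[of n] \<alpha> by (intro powr_mono2) auto
      also have "\<dots> = (2 * C) powr (2 * \<alpha>) * real n powr ((\<eta> + - (1 / d)) * (2 * \<alpha>))"
        using C by (simp only: powr_mult powr_powr)
      finally show ?case unfolding e1 w_def .
    qed
    have "w \<longlonglongrightarrow> 0"
      unfolding w_def by (intro tendsto_neg_powr filterlim_real_sequentially) auto
    then have "bigo_prob M (\<lambda>n \<omega>. Q_est X \<epsilon> n \<omega> - q2 p) w" "bigo_prob M (\<lambda>n \<omega>. H_est X \<epsilon> n \<omega> - h2 p) w"
      using estimator_rates[OF A pos lim p \<alpha> _ _ v1 v2 v3] by (auto simp: w_def)
    then show ?thesis by (simp add: w_def)
  qed
  show ?thesis using bias ii iii by blast
qed

end
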